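(* Let $n\ge1$, $\delta=(n,n-1,\ldots,1)$ and $m=n$. Then $$\begin{aligned}D_{sp(2n)}(x;t)&=\sum_{ST\in\mathcal{ST}^{\delta}(n,\overline n)}t^{\mathrm{var}(ST)+\mathrm{bar}(ST)}(1+t)^{\mathrm{str}(ST)-n}\,x^{\mathrm{wgt}(ST)}\\&=\sum_{UA\in\mathcal{UA}^{\delta}(2n)}t^{\mathrm{ssi}(UA)+\mathrm{bar}(UA)}(1+t)^{\mathrm{neg}(UA)}\,x^{\mathrm{wgt}(UA)}\\&=\sum_{CM\in\mathcal{CM}^{\delta}(2n)}t^{\mathrm{ne}_o(CM)+\mathrm{se}_e(CM)+\mathrm{wgt}_e(CM)}(1+t)^{\mathrm{ns}(CM)}\,x^{\mathrm{wgt}(CM)},\end{aligned}$$ where the summations are over all $sp(2n)$-standard shifted tableaux $ST$ of shape $\delta$, all $2n\times n$ U-turn alternating sign matrices $UA$ (whose column sums are all $1$), and all $2n\times n$ U-turn square ice configuration matrices $CM$ in $\mathcal{CM}^\delta(2n)$ (whose top-most element in each column is WE, NE or NW).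
   Context: Here $x=(x_1,\ldots,x_n)$ and $t$ are indeterminates, and $\displaystyle D_{sp(2n)}(x;t)=\prod_{i=1}^n x_i^{n-i+1}\prod_{i=1}^n(1+tx_i^{-2})\prod_{1\le i<j\le n}(1+tx_i^{-1}x_j)(1+tx_i^{-1}x_j^{-1})$. Let $[n,\overline n]=\{1,\ldots,n\}\cup\{\overline1,\ldots,\overline n\}$ be ordered by $\overline1<1<\overline2<2<\cdots<\overline n<n$. Matrix rows are numbered from the top, columns from the left. Shifted tableaux: $SF^\delta=\{(i,j):1\le i\le j\le n\}$. $\mathcal{ST}^\delta(n,\overline n)$ is the set of fillings $ST=(\eta_{ij})_{(i,j)\in SF^\delta}$ with $\eta_{ij}\in[n,\overline n]$, $\eta_{ii}\in\{i,\overline i\}$, $\eta_{ij}\le\eta_{i,j+1}$, $\eta_{ij}\le\eta_{i+1,j}$, $\eta_{ij}<\eta_{i+1,j+1}$ whenever the boxes lie in $SF^\delta$. For $c\in[n,\overline n]$, $m_c(ST)$ is the number of entries $c$, and $\mathrm{con}_c(ST)$ is the number of connected components of the set of boxes with entry $c$ (boxes being adjacent when they share an edge; $0$ if there are none). $x^{\mathrm{wgt}(ST)}=\prod_{k=1}^n x_k^{m_k(ST)-m_{\overline k}(ST)}$; $\mathrm{str}(ST)=\sum_{c}\mathrm{con}_c(ST)$; $\mathrm{bar}(ST)=\sum_k m_{\overline k}(ST)$; $\mathrm{row}_k(ST)$ is the number of rows containing an entry $k$; $\mathrm{col}_{\overline k}(ST)$ is the number of columns containing an entry $\overline k$; and $\mathrm{var}(ST)=\sum_{k=1}^n\big(\mathrm{row}_k(ST)-\mathrm{con}_k(ST)+\mathrm{col}_{\overline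 k}(ST)-\mathrm{con}_{\overline k}(ST)\big)$. U-turn matrices: $\mathcal{UA}^\delta(2n)$ is the set of $2n\times n$ matrices $UA=(a_{iq})$ with: $a_{iq}\in\{-1,0,1\}$; $\sum_{q=p}^n a_{iq}\in\{0,1\}$ for $1\le i\le 2n$, $1\le p\le n$; $\sum_{i=j}^{2n}a_{iq}\in\{0,1\}$ for $1\le j\le 2n$, $1\le q\le n$; $\sum_{q=1}^n(a_{2i-1,q}+a_{2i,q})=1$ for $1\le i\le n$; and $\sum_{i=1}^{2n}a_{iq}=1$ for $1\le q\le n$. A zero entry is positive if the nearest non-zero entry to its right in the same row exists and equals $1$. $m_k(UA)$ and $m_{\overline k}(UA)$ are the numbers of $1$'s and positive zeros in row $2n+1-2k$ and in row $2n+2-2k$, respectively, and $x^{\mathrm{wgt}(UA)}=\prod_{k=1}^n x_k^{m_k(UA)-m_{\overline k}(UA)}$. $\mathrm{neg}(UA)$ is the number of entries $-1$; $\mathrm{bar}(UA)$ is the total number of $1$'s and positive zeros in even-numbered rows; $\mathrm{ssi}(UA)$ is the number of positions $(i,q)$ holding a positive zero such that either $i$ is odd and the nearest non-zero entry below $(i,q)$ in column $q$ exists and equals $1$, or $i$ is even and the nearest non-zero entry below $(i,q)$ in column $q$ either equals $-1$ or does not exist. Square ice configuration matrices: consider the $2n\times n$ grid of internal vertices, each with four edges (up, down, left, right), shared with the neighbouring vertex or, at the border, a boundary edge. Orient all edges so that each internal vertex has exactly two incoming and two outgoing edges, and: every right boundary edge is incoming (points into the grid); every bottom and every top boundary edge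 is outgoing; for each $1\le i\le n$, exactly one of the left boundary edges of rows $2i-1$ and $2i$ is incoming and the other outgoing. To each such orientation associate the $2n\times n$ matrix $CM$ whose element at each vertex is: WE if the incoming edges are the left and right ones; NS if the incoming edges are the upper and lower ones; otherwise NE, SW, NW or SE according as the two outgoing edges are up and right, down and left, up and left, or down and right. $\mathcal{CM}^\delta(2n)$ is the set of all such $CM$. $\mathrm{ns}(CM)$ is the number of elements NS; $\mathrm{ne}_o(CM)$ the number of NE in odd-numbered rows; $\mathrm{se}_e(CM)$ the number of SE in even-numbered rows; $\mathrm{wgt}_e(CM)$ the total number of NE, SE and WE in even-numbered rows. With $m_k(CM)$ and $m_{\overline k}(CM)$ the total numbers of NE, SE, WE in rows $2n+1-2k$ and $2n+2-2k$ respectively, $x^{\mathrm{wgt}(CM)}=\prod_{k=1}^n x_k^{m_k(CM)-m_{\overline k}(CM)}$. *)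

theory Defs
  imports Complex_Main "HOL-Library.FuncSet" "HOL-Library.Poly_Mapping"
    "HOL-Computational_Algebra.Polynomial"
begin

section \<open>Laurent polynomials\<close>

text \<open>
  Laurent polynomials in the indeterminates \<open>x\<^sub>0, x\<^sub>1, \<dots>\<close> over \<open>\<int>[t]\<close>: an exponent vector
  is a finitely supported map \<open>nat \<Rightarrow>\<^sub>0 int\<close>, and the product is convolution.
\<close>

type_synonym laurent = "(nat \<Rightarrow>\<^sub>0 int) \<Rightarrow>\<^sub>0 int poly"

definition t_var :: laurent
  where "t_var = Poly_Mapping.single 0 [:0, 1:]"

text \<open>\<open>x_pow i e\<close> is the Laurent monomial \<open>x\<^sub>i\<^sup>e\<close>; the exponent \<open>e\<close> may be negative.\<close>

definition x_pow :: "nat \<Rightarrow> int \<Rightarrow> laurent"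
  where "x_pow i e = Poly_Mapping.single (Poly_Mapping.single i e) 1"

lemma x_pow_0 [simp]: "x_pow i 0 = 1"
  by (simp add: x_pow_def)

lemma x_pow_add: "x_pow i (d + e) = x_pow i d * x_pow i e"
  by (simp add: x_pow_def mult_single single_add)

definition D_sp :: "nat \<Rightarrow> laurent"
  where "D_sp n =
    (\<Prod>i\<in>{1..n}. x_pow i (int (n - i + 1))) *
    (\<Prod>i\<in>{1..n}. 1 + t_var * x_pow i (-2)) *
    (\<Prod>i\<in>{1..n}. \<Prod>j\<in>{i<..n}.
       (1 + t_var * x_pow i (-1) * x_pow j 1) * (1 + t_var * x_pow i (-1) * x_pow j (-1)))"


section \<open>Shifted tableaux\<close>

text \<open>\<open>Bar k\<close> is the barred letter and \<open>Unbar k\<close> the letter \<open>k\<close> itself.\<close>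

datatype letter = Bar nat | Unbar nat

fun letter_rank :: "letter \<Rightarrow> nat" where
  "letter_rank (Bar k) = 2 * k"
| "letter_rank (Unbar k) = 2 * k + 1"

lemma letter_rank_inject: "letter_rank a = letter_rank b \<longleftrightarrow> a = b"
  by (cases a; cases b) (simp_all, presburger+)

instantiation letter :: linorder
begin

definition less_eq_letter :: "letter \<Rightarrow> letter \<Rightarrow> bool"
  where "a \<le> b \<longleftrightarrow> letter_rank a \<le> letter_rank b"

definition less_letter :: "letter \<Rightarrow> letter \<Rightarrow> bool"
  where "a < b \<longleftrightarrow> letter_rank a < letter_rank b"

instance
  by standard (auto simp: less_eq_letter_def less_letter_def letter_rank_inject)

end

definition alphabet :: "nat \<Rightarrow> letter set"
  where "alphabet n = Unbar ` {1..n} \<union> Bar ` {1..n}"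

type_synonym box = "nat \<times> nat"

definition SF :: "nat \<Rightarrow> box set"
  where "SF n = {(i, j). 1 \<le> i \<and> i \<le> j \<and> j \<le> n}"

text \<open>
  Fillings and matrices are functions on pairs (row, column), numbered from 1, and equal to
  \<open>undefined\<close> outside their index set, so that distinct functions are distinct objects.
\<close>

definition ST :: "nat \<Rightarrow> (box \<Rightarrow> letter) set"
  where "ST n = {\<eta> \<in> SF n \<rightarrow>\<^sub>E alphabet n.
    (\<forall>i. (i, i) \<in> SF n \<longrightarrow> \<eta> (i, i) \<in> {Unbar i, Bar i}) \<and>
    (\<forall>i j. (i, j) \<in> SF n \<and> (i, j + 1) \<in> SF n \<longrightarrow> \<eta> (i, j) \<le> \<eta> (i, j + 1)) \<and>
    (\<forall>i j. (i, j) \<in> SF n \<and> (i + 1, j) \<in> SF n \<longrightarrow> \<eta> (i, j) \<le> \<eta> (i + 1, j)) \<and>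
    (\<forall>i j. (i, j) \<in> SF n \<and> (i + 1, j + 1) \<in> SF n \<longrightarrow> \<eta> (i, j) < \<eta> (i + 1, j + 1))}"

definition boxes :: "nat \<Rightarrow> (box \<Rightarrow> letter) \<Rightarrow> letter \<Rightarrow> box set"
  where "boxes n \<eta> c = {b \<in> SF n. \<eta> b = c}"

fun share_edge :: "box \<Rightarrow> box \<Rightarrow> bool" where
  "share_edge (i, j) (k, l) \<longleftrightarrow>
     (i = k \<and> (l = j + 1 \<or> j = l + 1)) \<or> (j = l \<and> (k = i + 1 \<or> i = k + 1))"

definition components :: "box set \<Rightarrow> box set set"
  where "components S = S // {(a, b). a \<in> S \<and> b \<in> S \<and> share_edge a b}\<^sup>*"

definition m_ST :: "nat \<Rightarrow> (box \<Rightarrow> letter) \<Rightarrow> letter \<Rightarrow> nat"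
  where "m_ST n \<eta> c = card (boxes n \<eta> c)"

definition con :: "nat \<Rightarrow> (box \<Rightarrow> letter) \<Rightarrow> letter \<Rightarrow> nat"
  where "con n \<eta> c = card (components (boxes n \<eta> c))"

definition str :: "nat \<Rightarrow> (box \<Rightarrow> letter) \<Rightarrow> nat"
  where "str n \<eta> = (\<Sum>c\<in>alphabet n. con n \<eta> c)"

definition bar_ST :: "nat \<Rightarrow> (box \<Rightarrow> letter) \<Rightarrow> nat"
  where "bar_ST n \<eta> = (\<Sum>k\<in>{1..n}. m_ST n \<eta> (Bar k))"

definition row :: "nat \<Rightarrow> (box \<Rightarrow> letter) \<Rightarrow> nat \<Rightarrow> nat"
  where "row n \<eta> k = card {i. \<exists>j. (i, j) \<in> boxes n \<eta> (Unbar k)}"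

definition col :: "nat \<Rightarrow> (box \<Rightarrow> letter) \<Rightarrow> nat \<Rightarrow> nat"
  where "col n \<eta> k = card {j. \<exists>i. (i, j) \<in> boxes n \<eta> (Bar k)}"

definition var :: "nat \<Rightarrow> (box \<Rightarrow> letter) \<Rightarrow> int"
  where "var n \<eta> = (\<Sum>k\<in>{1..n}.
    int (row n \<eta> k) - int (con n \<eta> (Unbar k)) + int (col n \<eta> k) - int (con n \<eta> (Bar k)))"

text \<open>
  The exponents \<open>var n \<eta> + bar_ST n \<eta>\<close> and \<open>str n \<eta> - n\<close> are non-negative, so
  neither truncates when read as a natural number.
\<close>

lemma finite_SF: "finite (SF n)"
  by (rule finite_subset[of _ "{1..n} \<times> {1..n}"]) (auto simp: SF_def)

lemma finite_boxes: "finite (boxes n \<eta> c)"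
  by (simp add: boxes_def finite_SF)

lemma ST_row_mono:
  assumes "\<eta> \<in> ST n" "(i, j) \<in> SF n" "j \<le> l" "l \<le> n"
  shows "\<eta> (i, j) \<le> \<eta> (i, l)"
  using assms(3,4)
proof (induction l rule: dec_induct)
  case (step l)
  then have "(i, l) \<in> SF n" "(i, l + 1) \<in> SF n"
    using assms(2) by (auto simp: SF_def)
  then have "\<eta> (i, l) \<le> \<eta> (i, l + 1)"
    using assms(1) by (auto simp: ST_def)
  with step show ?case by auto
qed simp

lemma ST_col_mono:
  assumes "\<eta> \<in> ST n" "(i, j) \<in> SF n" "i \<le> k" "k \<le> j"
  shows "\<eta> (i, j) \<le> \<eta> (k, j)"
  using assms(3,4)
proof (induction k rule: dec_induct)
  case (step k)
  then have "(k, j) \<in> SF n" "(k + 1, j) \<in> SF n"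
    using assms(2) by (auto simp: SF_def)
  then have "\<eta> (k, j) \<le> \<eta> (k + 1, j)"
    using assms(1) by (auto simp: ST_def)
  with step show ?case by auto
qed simp

lemma card_components_le:
  assumes "finite B"
    and conn: "\<And>a b. a \<in> B \<Longrightarrow> b \<in> B \<Longrightarrow> f a = f b \<Longrightarrow>
      (a, b) \<in> {(a, b). a \<in> B \<and> b \<in> B \<and> share_edge a b}\<^sup>*"
  shows "card (components B) \<le> card (f ` B)"
proof -
  let ?R = "{(a, b). a \<in> B \<and> b \<in> B \<and> share_edge a b}\<^sup>*"
  define g where "g = (\<lambda>y. ?R `` {SOME b. b \<in> B \<and> f b = y})"
  have "?R `` {a} = g (f a)" if "a \<in> B" for a
  proof -
    let ?b = "SOME b. b \<in> B \<and> f b = f a"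
    have b: "?b \<in> B \<and> f ?b = f a"
      by (rule someI[of _ a]) (use that in simp)
    have "(a, ?b) \<in> ?R" "(?b, a) \<in> ?R"
      using conn[of a ?b] conn[of ?b a] b that by simp_all
    then show ?thesis
      unfolding g_def by (auto intro: rtrancl_trans)
  qed
  then have "components B = g ` f ` B"
    unfolding components_def quotient_def by (auto simp: image_image)
  then show ?thesis
    using assms(1) by (simp add: card_image_le)
qed

lemma con_le_row:
  assumes "\<eta> \<in> ST n"
  shows "con n \<eta> (Unbar k) \<le> row n \<eta> k"
proof -
  let ?B = "boxes n \<eta> (Unbar k)"
  let ?E = "{(a, b). a \<in> ?B \<and> b \<in> ?B \<and> share_edge a b}"
  have *: "((i, j), (i, l)) \<in> ?E\<^sup>* \<and> ((i, l), (i, j)) \<in> ?E\<^sup>*"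
    if "(i, j) \<in> ?B" "(i, l) \<in> ?B" "j \<le> l" for i j l
    using that(3,2)
  proof (induction l rule: dec_induct)
    case (step l)
    have "(i, j) \<in> SF n" "(i, l) \<in> SF n" "(i, Suc l) \<in> SF n"
      using that(1) step by (auto simp: boxes_def SF_def)
    then have "\<eta> (i, j) \<le> \<eta> (i, l)" "\<eta> (i, l) \<le> \<eta> (i, Suc l)"
      using ST_row_mono[OF assms] step by (auto simp: SF_def)
    then have B: "(i, l) \<in> ?B"
      using that(1) step \<open>(i, l) \<in> SF n\<close> by (auto simp: boxes_def)
    then have "((i, l), (i, Suc l)) \<in> ?E" "((i, Suc l), (i, l)) \<in> ?E"
      using step by auto
    then show ?case
      using step.IH[OF B] by (blast intro: rtrancl_into_rtrancl converse_rtrancl_into_rtrancl)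
  qed simp
  have "card (components ?B) \<le> card (fst ` ?B)"
  proof (rule card_components_le[OF finite_boxes])
    fix a b assume "a \<in> ?B" "b \<in> ?B" "fst a = fst b"
    then obtain i j l where ab: "a = (i, j)" "b = (i, l)" "(i, j) \<in> ?B" "(i, l) \<in> ?B"
      by (cases a; cases b) simp
    show "(a, b) \<in> ?E\<^sup>*"
    proof (cases "j \<le> l")
      case True
      then show ?thesis using *[OF ab(3,4)] by (simp only: ab)
    next
      case False
      then have "l \<le> j" by simp
      then show ?thesis using *[OF ab(4,3)] by (simp only: ab)
    qed
  qed
  also have "fst ` ?B = {i. \<exists>j. (i, j) \<in> ?B}" by force
  finally show ?thesis by (simp add: con_def row_def)
qed

lemma con_le_col:
  assumes "\<eta> \<in> ST n"
  shows "con n \<eta> (Bar k) \<le> col n \<eta> k"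
proof -
  let ?B = "boxes n \<eta> (Bar k)"
  let ?E = "{(a, b). a \<in> ?B \<and> b \<in> ?B \<and> share_edge a b}"
  have *: "((i, j), (l, j)) \<in> ?E\<^sup>* \<and> ((l, j), (i, j)) \<in> ?E\<^sup>*"
    if "(i, j) \<in> ?B" "(l, j) \<in> ?B" "i \<le> l" for i j l
    using that(3,2)
  proof (induction l rule: dec_induct)
    case (step l)
    have "(i, j) \<in> SF n" "(l, j) \<in> SF n" "(Suc l, j) \<in> SF n"
      using that(1) step by (auto simp: boxes_def SF_def)
    then have "\<eta> (i, j) \<le> \<eta> (l, j)" "\<eta> (l, j) \<le> \<eta> (Suc l, j)"
      using ST_col_mono[OF assms] step by (auto simp: SF_def)
    then have B: "(l, j) \<in> ?B"
      using that(1) step \<open>(l, j) \<in> SF n\<close> by (auto simp: boxes_def)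
    then have "((l, j), (Suc l, j)) \<in> ?E" "((Suc l, j), (l, j)) \<in> ?E"
      using step by auto
    then show ?case
      using step.IH[OF B] by (blast intro: rtrancl_into_rtrancl converse_rtrancl_into_rtrancl)
  qed simp
  have "card (components ?B) \<le> card (snd ` ?B)"
  proof (rule card_components_le[OF finite_boxes])
    fix a b assume "a \<in> ?B" "b \<in> ?B" "snd a = snd b"
    then obtain i j l where ab: "a = (i, j)" "b = (l, j)" "(i, j) \<in> ?B" "(l, j) \<in> ?B"
      by (cases a; cases b) simp
    show "(a, b) \<in> ?E\<^sup>*"
    proof (cases "i \<le> l")
      case True
      then show ?thesis using *[OF ab(3,4)] by (simp only: ab)
    next
      case False
      then have "l \<le> i" by simp
      then show ?thesis using *[OF ab(4,3)] by (simp only: ab)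
    qed
  qed
  also have "snd ` ?B = {j. \<exists>i. (i, j) \<in> ?B}" by force
  finally show ?thesis by (simp add: con_def col_def)
qed

lemma var_nonneg:
  assumes "\<eta> \<in> ST n"
  shows "0 \<le> var n \<eta>"
  unfolding var_def
proof (rule sum_nonneg)
  fix k
  show "0 \<le> int (row n \<eta> k) - int (con n \<eta> (Unbar k)) + int (col n \<eta> k) - int (con n \<eta> (Bar k))"
    using con_le_row[OF assms, of k] con_le_col[OF assms, of k] by linarith
qed

lemma con_pos:
  assumes "b \<in> boxes n \<eta> c"
  shows "1 \<le> con n \<eta> c"
proof -
  have "finite (components (boxes n \<eta> c))"
    by (simp add: components_def quotient_def finite_boxes)
  moreover have "components (boxes n \<eta> c) \<noteq> {}"
    using assms unfolding components_def quotient_def by blast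
  ultimately show ?thesis
    by (simp add: con_def Suc_le_eq card_gt_0_iff)
qed

lemma str_ge:
  assumes "\<eta> \<in> ST n"
  shows "n \<le> str n \<eta>"
proof -
  let ?D = "(\<lambda>i. \<eta> (i, i)) ` {1..n}"
  have d: "\<eta> (i, i) \<in> {Unbar i, Bar i}" "(i, i) \<in> SF n" if "i \<in> {1..n}" for i
    using assms that by (auto simp: ST_def SF_def)
  have "inj_on (\<lambda>i. \<eta> (i, i)) {1..n}"
  proof (rule inj_onI)
    fix i j assume "i \<in> {1..n}" "j \<in> {1..n}" "\<eta> (i, i) = \<eta> (j, j)"
    then show "i = j" using d(1)[of i] d(1)[of j] by auto
  qed
  then have "n = card ?D" by (simp add: card_image)
  also have "\<dots> = (\<Sum>c\<in>?D. 1)" by simp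
  also have "\<dots> \<le> (\<Sum>c\<in>?D. con n \<eta> c)"
  proof (rule sum_mono)
    fix c assume "c \<in> ?D"
    then obtain i where "i \<in> {1..n}" "c = \<eta> (i, i)" by auto
    then show "1 \<le> con n \<eta> c"
      using d(2)[of i] by (intro con_pos[of "(i, i)"]) (simp add: boxes_def)
  qed
  also have "\<dots> \<le> str n \<eta>"
    unfolding str_def
  proof (rule sum_mono2)
    show "finite (alphabet n)" by (simp add: alphabet_def)
    show "?D \<subseteq> alphabet n"
    proof (rule image_subsetI)
      fix i assume "i \<in> {1..n}"
      then show "\<eta> (i, i) \<in> alphabet n" using d(1)[of i] by (auto simp: alphabet_def)
    qed
  qed simp
  finally show ?thesis .
qed

lemma finite_ST: "finite (ST n)"
  by (rule finite_subset[of _ "SF n \<rightarrow>\<^sub>E alphabet n"])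
    (auto simp: ST_def alphabet_def intro!: finite_PiE finite_SF)

definition xwgt_ST :: "nat \<Rightarrow> (box \<Rightarrow> letter) \<Rightarrow> laurent"
  where "xwgt_ST n \<eta> =
    (\<Prod>k\<in>{1..n}. x_pow k (int (m_ST n \<eta> (Unbar k)) - int (m_ST n \<eta> (Bar k))))"


section \<open>U-turn alternating sign matrices\<close>

definition UA :: "nat \<Rightarrow> (nat \<times> nat \<Rightarrow> int) set"
  where "UA n = {a \<in> {1..2*n} \<times> {1..n} \<rightarrow>\<^sub>E {-1, 0, 1}.
    (\<forall>i\<in>{1..2*n}. \<forall>p\<in>{1..n}. (\<Sum>q\<in>{p..n}. a (i, q)) \<in> {0, 1}) \<and>
    (\<forall>j\<in>{1..2*n}. \<forall>q\<in>{1..n}. (\<Sum>i\<in>{j..2*n}. a (i, q)) \<in> {0, 1}) \<and>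
    (\<forall>i\<in>{1..n}. (\<Sum>q\<in>{1..n}. a (2*i-1, q) + a (2*i, q)) = 1) \<and>
    (\<forall>q\<in>{1..n}. (\<Sum>i\<in>{1..2*n}. a (i, q)) = 1)}"

lemma finite_UA: "finite (UA n)"
  by (rule finite_subset[of _ "{1..2*n} \<times> {1..n} \<rightarrow>\<^sub>E {-1, 0, 1}"])
    (auto simp: UA_def intro!: finite_PiE)

text \<open>The nearest non-zero entry to the right of (resp. below) a position exists and equals \<open>e\<close>.\<close>

definition next_right :: "nat \<Rightarrow> (nat \<times> nat \<Rightarrow> int) \<Rightarrow> nat \<Rightarrow> nat \<Rightarrow> int \<Rightarrow> bool"
  where "next_right n a i q e \<longleftrightarrow>
    (\<exists>p\<in>{q<..n}. a (i, p) \<noteq> 0 \<and> a (i, p) = e \<and> (\<forall>r\<in>{q<..<p}. a (i, r) = 0))"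

definition next_below :: "nat \<Rightarrow> (nat \<times> nat \<Rightarrow> int) \<Rightarrow> nat \<Rightarrow> nat \<Rightarrow> int \<Rightarrow> bool"
  where "next_below n a i q e \<longleftrightarrow>
    (\<exists>p\<in>{i<..2*n}. a (p, q) \<noteq> 0 \<and> a (p, q) = e \<and> (\<forall>r\<in>{i<..<p}. a (r, q) = 0))"

definition pos_zero :: "nat \<Rightarrow> (nat \<times> nat \<Rightarrow> int) \<Rightarrow> nat \<Rightarrow> nat \<Rightarrow> bool"
  where "pos_zero n a i q \<longleftrightarrow> a (i, q) = 0 \<and> next_right n a i q 1"

definition row_count_UA :: "nat \<Rightarrow> (nat \<times> nat \<Rightarrow> int) \<Rightarrow> nat \<Rightarrow> nat"
  where "row_count_UA n a i = card {q \<in> {1..n}. a (i, q) = 1 \<or> pos_zero n a i q}"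

definition m_UA :: "nat \<Rightarrow> (nat \<times> nat \<Rightarrow> int) \<Rightarrow> letter \<Rightarrow> nat"
  where "m_UA n a c = (case c of
      Unbar k \<Rightarrow> row_count_UA n a (2*n + 1 - 2*k)
    | Bar k \<Rightarrow> row_count_UA n a (2*n + 2 - 2*k))"

definition neg :: "nat \<Rightarrow> (nat \<times> nat \<Rightarrow> int) \<Rightarrow> nat"
  where "neg n a = card {(i, q) \<in> {1..2*n} \<times> {1..n}. a (i, q) = -1}"

definition bar_UA :: "nat \<Rightarrow> (nat \<times> nat \<Rightarrow> int) \<Rightarrow> nat"
  where "bar_UA n a =
    card {(i, q) \<in> {1..2*n} \<times> {1..n}. even i \<and> (a (i, q) = 1 \<or> pos_zero n a i q)}"

definition ssi :: "nat \<Rightarrow> (nat \<times> nat \<Rightarrow> int) \<Rightarrow> nat"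
  where "ssi n a = card {(i, q) \<in> {1..2*n} \<times> {1..n}. pos_zero n a i q \<and>
    (odd i \<and> next_below n a i q 1 \<or>
     even i \<and> (next_below n a i q (-1) \<or> (\<forall>r\<in>{i<..2*n}. a (r, q) = 0)))}"

definition xwgt_UA :: "nat \<Rightarrow> (nat \<times> nat \<Rightarrow> int) \<Rightarrow> laurent"
  where "xwgt_UA n a = (\<Prod>k\<in>{1..n}. x_pow k (int (m_UA n a (Unbar k)) - int (m_UA n a (Bar k))))"


section \<open>U-turn square ice\<close>

datatype ice = WE | NS | NE | SW | NW | SE

text \<open>
  An orientation of the grid is a pair \<open>(v, h)\<close>: \<open>v i q\<close> holds iff the vertical edge between the
  vertices \<open>(i, q)\<close> and \<open>(i + 1, q)\<close> points down, \<open>h i q\<close> holds iff the horizontal edge between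
  \<open>(i, q)\<close> and \<open>(i, q + 1)\<close> points right. The indices \<open>v 0 q\<close>, \<open>v (2*n) q\<close>, \<open>h i 0\<close>, \<open>h i n\<close> are
  the boundary edges. Whether an edge is incoming is relative to the vertex \<open>(i, q)\<close>.
\<close>

type_synonym orientation = "(nat \<Rightarrow> nat \<Rightarrow> bool) \<times> (nat \<Rightarrow> nat \<Rightarrow> bool)"

datatype side = Up | Down | Left | Right

definition incoming :: "orientation \<Rightarrow> nat \<times> nat \<Rightarrow> side set"
  where "incoming = (\<lambda>(v, h) (i, q).
    {d. case d of Up \<Rightarrow> v (i - 1) q | Down \<Rightarrow> \<not> v i q | Left \<Rightarrow> h i (q - 1) | Right \<Rightarrow> \<not> h i q})"

definition outgoing :: "orientation \<Rightarrow> nat \<times> nat \<Rightarrow> side set"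
  where "outgoing \<omega> p = - incoming \<omega> p"

definition ice_orientation :: "nat \<Rightarrow> orientation \<Rightarrow> bool"
  where "ice_orientation n \<omega> \<longleftrightarrow>
    (\<forall>p\<in>{1..2*n} \<times> {1..n}. card (incoming \<omega> p) = 2 \<and> card (outgoing \<omega> p) = 2) \<and>
    (\<forall>i\<in>{1..2*n}. Right \<in> incoming \<omega> (i, n)) \<and>
    (\<forall>q\<in>{1..n}. Down \<in> outgoing \<omega> (2*n, q) \<and> Up \<in> outgoing \<omega> (1, q)) \<and>
    (\<forall>i\<in>{1..n}. Left \<in> incoming \<omega> (2*i-1, 1) \<longleftrightarrow> Left \<in> outgoing \<omega> (2*i, 1))"

definition ice_type :: "orientation \<Rightarrow> nat \<times> nat \<Rightarrow> ice"
  where "ice_type \<omega> p =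
    (if incoming \<omega> p = {Left, Right} then WE
     else if incoming \<omega> p = {Up, Down} then NS
     else if outgoing \<omega> p = {Up, Right} then NE
     else if outgoing \<omega> p = {Down, Left} then SW
     else if outgoing \<omega> p = {Up, Left} then NW
     else SE)"

definition CM :: "nat \<Rightarrow> (nat \<times> nat \<Rightarrow> ice) set"
  where "CM n = {restrict (ice_type \<omega>) ({1..2*n} \<times> {1..n}) | \<omega>. ice_orientation n \<omega>}"

lemma finite_CM: "finite (CM n)"
proof (rule finite_subset)
  show "CM n \<subseteq> {1..2*n} \<times> {1..n} \<rightarrow>\<^sub>E {WE, NS, NE, SW, NW, SE}"
  proof
    fix C assume "C \<in> CM n"
    then obtain \<omega> where C: "C = restrict (ice_type \<omega>) ({1..2*n} \<times> {1..n})"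
      unfolding CM_def by blast
    have "ice_type \<omega> p \<in> {WE, NS, NE, SW, NW, SE}" for p
      by (cases "ice_type \<omega> p") simp_all
    then show "C \<in> {1..2*n} \<times> {1..n} \<rightarrow>\<^sub>E {WE, NS, NE, SW, NW, SE}"
      unfolding C by (intro restrict_PiE_iff[THEN iffD2] ballI)
  qed
qed (auto intro!: finite_PiE)

definition ns :: "nat \<Rightarrow> (nat \<times> nat \<Rightarrow> ice) \<Rightarrow> nat"
  where "ns n C = card {p \<in> {1..2*n} \<times> {1..n}. C p = NS}"

definition ne_odd :: "nat \<Rightarrow> (nat \<times> nat \<Rightarrow> ice) \<Rightarrow> nat"
  where "ne_odd n C = card {(i, q) \<in> {1..2*n} \<times> {1..n}. odd i \<and> C (i, q) = NE}"

definition se_even :: "nat \<Rightarrow> (nat \<times> nat \<Rightarrow> ice) \<Rightarrow> nat"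
  where "se_even n C = card {(i, q) \<in> {1..2*n} \<times> {1..n}. even i \<and> C (i, q) = SE}"

definition wgt_even :: "nat \<Rightarrow> (nat \<times> nat \<Rightarrow> ice) \<Rightarrow> nat"
  where "wgt_even n C =
    card {(i, q) \<in> {1..2*n} \<times> {1..n}. even i \<and> C (i, q) \<in> {NE, SE, WE}}"

definition row_count_CM :: "nat \<Rightarrow> (nat \<times> nat \<Rightarrow> ice) \<Rightarrow> nat \<Rightarrow> nat"
  where "row_count_CM n C i = card {q \<in> {1..n}. C (i, q) \<in> {NE, SE, WE}}"

definition m_CM :: "nat \<Rightarrow> (nat \<times> nat \<Rightarrow> ice) \<Rightarrow> letter \<Rightarrow> nat"
  where "m_CM n C c = (case c of
      Unbar k \<Rightarrow> row_count_CM n C (2*n + 1 - 2*k)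
    | Bar k \<Rightarrow> row_count_CM n C (2*n + 2 - 2*k))"

definition xwgt_CM :: "nat \<Rightarrow> (nat \<times> nat \<Rightarrow> ice) \<Rightarrow> laurent"
  where "xwgt_CM n C = (\<Prod>k\<in>{1..n}. x_pow k (int (m_CM n C (Unbar k)) - int (m_CM n C (Bar k))))"

end

theory Submission
  imports Defs
begin

text \<open>
  All three families are encodings of the same states of a free-fermionic six-vertex model: sets
  \<open>f 0, \<dots>, f (2n)\<close>, where \<open>f c\<close> holds the row lengths of the subtableau formed by the \<open>c\<close> smallest
  letters, the column partial sums of the lowest \<open>c\<close> rows of the matrix, or the upward vertical
  edges above those rows; \<open>q\<close> is a column, and a diagonal \<open>j - i + 1 = q\<close> of the tableau.

  The local weights make a row transfer act on an alternating form \<open>L\<close>, evaluated at the basis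
  vectors \<open>e\<^sub>s\<close> with \<open>s\<close> in a row set, by a linear map on the arguments plus a contraction with a
  linear functional; no determinants or interlacing patterns are needed. The two rows of a letter
  pair together contract with a functional \<open>\<phi>\<close> and apply a map \<open>K\<close> with
  \<open>K ((U - u) v) = (U + t (x + 1/x)) v\<close> and \<open>\<phi> (U v) = u \<phi> v\<close>, where \<open>u = x + t\<^sup>2/x\<close> and
  \<open>U\<close> acts by \<open>e\<^sub>s \<mapsto> e\<^bsub>s+1\<^esub> + t\<^sup>2 e\<^bsub>s-1\<^esub>\<close>. On a list \<open>U\<^bsup>k-1\<^esup> v, \<dots>, U v, v\<close>, column operations replace all
  entries but the last by vectors \<open>(U - u) w\<close>, which \<open>\<phi>\<close> kills, so every letter pair splits off
  the factors of the product formula.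
\<close>

section \<open>Alternating forms and row sums\<close>

text \<open>Origin of \<open>U\<close> and \<open>u\<close>: a particle in column s is coded as
  z^(s-1), and a row map is f \<mapsto> f + c (f(z) - f(r))/(z - r) with node r = x for an unbarred
  letter and r = t^2/x for a barred one. On a multiple of z - r the divided difference is the
  cofactor, so the two maps turn the factors z - x and z - t^2/x into z + t x and z + t/x. Up to the
  truncation of 1/z to polynomials, \<open>U\<close> is multiplication by z + t^2/z, and U - u = (z
  - x)(z - t^2/x)/z; applying both maps gives (z + t x)(z + t/x)/z = U + t (x + 1/x). The two nodes
  of every letter pair multiply to the same t^2, so a single \<open>U\<close> serves all pairs and
  the argument can be repeated. The obstacle is that particles may leave the grid on the left, so a
  row need not preserve the degree of the form. A contraction records the departure, at most one per
  row; the U-turn condition makes exactly one of the two rows of a pair lose a particle, which is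
  what leaves a single functional per pair.\<close>

definition alternating :: "('a::comm_ring_1 poly list \<Rightarrow> 'a) \<Rightarrow> bool" where
  "alternating L \<longleftrightarrow>
     (\<forall>xs ys u v. L (xs @ (u + v) # ys) = L (xs @ u # ys) + L (xs @ v # ys)) \<and>
     (\<forall>xs ys c u. L (xs @ smult c u # ys) = c * L (xs @ u # ys)) \<and>
     (\<forall>xs ys u. L (xs @ u # u # ys) = 0)"

definition linear_map :: "('a::comm_ring_1 poly \<Rightarrow> 'a poly) \<Rightarrow> bool" where
  "linear_map A \<longleftrightarrow> (\<forall>u v. A (u + v) = A u + A v) \<and> (\<forall>c u. A (smult c u) = smult c (A u))"

definition linear_functional :: "('a::comm_ring_1 poly \<Rightarrow> 'a) \<Rightarrow> bool" where
  "linear_functional \<phi> \<longleftrightarrow> (\<forall>u v. \<phi> (u + v) = \<phi> u + \<phi> v) \<and> (\<forall>c u. \<phi> (smult c u) = c * \<phi> u)"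

text \<open>The interior product with \<open>\<phi>\<close>. The sign counts the entries to the
  right of the deleted one, so deleting the last entry has sign +. In a decreasing list of columns
  the last slot is where a particle leaving on the left is recorded.\<close>

fun contract ::
    "('v \<Rightarrow> 'a::comm_ring_1) \<Rightarrow> ('v list \<Rightarrow> 'a) \<Rightarrow> 'v list \<Rightarrow> 'a" where
  "contract \<phi> L [] = 0"
| "contract \<phi> L (f # fs) =
     (-1) ^ length fs * \<phi> f * L fs + contract \<phi> (\<lambda>gs. L (f # gs)) fs"

lemma alternatingD:
  assumes "alternating L"
  shows "L (xs @ (u + v) # ys) = L (xs @ u # ys) + L (xs @ v # ys)"
    "L (xs @ smult c u # ys) = c * L (xs @ u # ys)"
    "L (xs @ u # u # ys) = 0"
  using assms unfolding alternating_def by blast+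

lemma alternating_hd:
  assumes "alternating L"
  shows "L ((u + v) # ys) = L (u # ys) + L (v # ys)"
    "L (smult c u # ys) = c * L (u # ys)"
    "L (u # u # ys) = 0"
  using alternatingD[OF assms, of "[]"] by simp_all

lemma alternating_hd2:
  assumes "alternating L"
  shows "L (w # (u + v) # ys) = L (w # u # ys) + L (w # v # ys)"
    "L (w # smult c u # ys) = c * L (w # u # ys)"
  using alternatingD(1,2)[OF assms, of "[w]"] by simp_all

lemma alternating_swap:
  assumes "alternating L"
  shows "L (u # v # ys) = - L (v # u # ys)"
proof -
  have "0 = L ((u + v) # (u + v) # ys)"
    by (simp add: alternating_hd(3)[OF assms])
  also have "\<dots> = L (u # v # ys) + L (v # u # ys)"
    by (simp add: alternating_hd(1)[OF assms] alternating_hd2(1)[OF assms]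
        alternating_hd(3)[OF assms, of u] alternating_hd(3)[OF assms, of v])
  finally have "L (u # v # ys) + L (v # u # ys) = 0" by (rule sym)
  then show ?thesis by (simp only: eq_neg_iff_add_eq_0)
qed

lemma alternating_Cons: "alternating L \<Longrightarrow> alternating (\<lambda>gs. L (f # gs))"
  unfolding alternating_def by (metis append_Cons)

lemma alternating_map:
  assumes "alternating L" "linear_map A"
  shows "alternating (\<lambda>gs. L (map A gs))"
  using assms unfolding alternating_def linear_map_def by auto

lemma alternating_add:
  assumes "alternating L" "alternating L'"
  shows "alternating (\<lambda>gs. L gs + L' gs)"
  unfolding alternating_def
  by (simp add: alternatingD[OF assms(1)] alternatingD[OF assms(2)] algebra_simps)

lemma alternating_zero: "alternating L \<Longrightarrow> L (xs @ 0 # ys) = 0"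
  using alternatingD(2)[of L xs 0 0 ys] by simp

text \<open>The restriction to lists one shorter with entries from \<open>fs\<close> lets forms be
  compared that agree only in one degree or only on certain vectors.\<close>

lemma contract_cong:
  assumes "\<And>gs. Suc (length gs) = length fs \<Longrightarrow> set gs \<subseteq> set fs \<Longrightarrow> L gs = L' gs"
    "\<And>f. f \<in> set fs \<Longrightarrow> \<phi> f = \<psi> f"
  shows "contract \<phi> L fs = contract \<psi> L' fs"
  using assms
proof (induction fs arbitrary: L L')
  case (Cons f fs)
  have "L fs = L' fs"
    by (rule Cons.prems(1)) auto
  moreover have "contract \<phi> (\<lambda>gs. L (f # gs)) fs = contract \<psi> (\<lambda>gs. L' (f # gs)) fs"
  proof (rule Cons.IH)
    fix gs assume "Suc (length gs) = length fs" "set gs \<subseteq> set fs"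
    then show "L (f # gs) = L' (f # gs)" by (intro Cons.prems(1)) auto
  qed (simp add: Cons.prems(2))
  ultimately show ?case
    using Cons.prems(2) by simp
qed simp

lemma contract_zero_form: "contract \<phi> (\<lambda>_. 0) fs = 0"
  by (induction fs) auto

lemma contract_wrong_degree:
  assumes "\<And>gs. Suc (length gs) = length fs \<Longrightarrow> L gs = 0"
  shows "contract \<phi> L fs = 0"
  using contract_cong[of fs L "\<lambda>_. 0" \<phi> \<phi>] assms by (simp add: contract_zero_form)

lemma contract_add: "contract \<phi> (\<lambda>gs. L gs + L' gs) fs = contract \<phi> L fs + contract \<phi> L' fs"
  by (induction fs arbitrary: L L') (auto simp: algebra_simps)

lemma contract_scale: "contract \<phi> (\<lambda>gs. c * L gs) fs = c * contract \<phi> L fs"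
  by (induction fs arbitrary: L) (auto simp: algebra_simps)

lemma contract_add_functional:
  "contract (\<lambda>f. \<phi> f + \<psi> f) L fs = contract \<phi> L fs + contract \<psi> L fs"
  by (induction fs arbitrary: L) (auto simp: algebra_simps)

lemma contract_map:
  "contract \<phi> L (map A fs) = contract (\<lambda>f. \<phi> (A f)) (\<lambda>gs. L (map A gs)) fs"
  by (induction fs arbitrary: L) auto

lemma contract_vanishing:
  "(\<And>f. f \<in> set fs \<Longrightarrow> \<phi> f = 0) \<Longrightarrow> contract \<phi> L fs = 0"
  by (induction fs arbitrary: L) auto

lemma contract_last:
  "(\<And>f. f \<in> set fs \<Longrightarrow> \<phi> f = 0) \<Longrightarrow> contract \<phi> L (fs @ [g]) = \<phi> g * L fs"
  by (induction fs arbitrary: L) auto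

text \<open>Each property goes by induction on the prefix with \<open>L\<close> arbitrary, since the
  recursion of \<open>contract\<close> fixes the head and passes to
  \<open>\<lambda>gs. L (x # gs)\<close>.\<close>

lemma alternating_contract:
  assumes "alternating L" "linear_functional \<phi>"
  shows "alternating (contract \<phi> L)"
proof -
  have add: "contract \<phi> L (xs @ (u + v) # ys) = contract \<phi> L (xs @ u # ys) + contract \<phi> L (xs @ v # ys)"
    if "alternating L" for L xs ys u v
    using that
  proof (induction xs arbitrary: L)
    case Nil
    have "(\<lambda>gs. L ((u + v) # gs)) = (\<lambda>gs. L (u # gs) + L (v # gs))"
      by (rule ext, rule alternating_hd(1)[OF Nil])
    then show ?case
      using assms(2) by (simp add: linear_functional_def contract_add algebra_simps)
  next
    case (Cons x xs)
    show ?case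
      using Cons.IH[OF alternating_Cons[OF Cons.prems]] alternatingD(1)[OF Cons.prems]
      by (simp add: algebra_simps)
  qed
  have scale: "contract \<phi> L (xs @ smult c u # ys) = c * contract \<phi> L (xs @ u # ys)"
    if "alternating L" for L xs ys u c
    using that
  proof (induction xs arbitrary: L)
    case Nil
    have "(\<lambda>gs. L (smult c u # gs)) = (\<lambda>gs. c * L (u # gs))"
      by (rule ext, rule alternating_hd(2)[OF Nil])
    then show ?case
      using assms(2) by (simp add: linear_functional_def contract_scale algebra_simps)
  next
    case (Cons x xs)
    show ?case
      using Cons.IH[OF alternating_Cons[OF Cons.prems]] alternatingD(2)[OF Cons.prems]
      by (simp add: algebra_simps)
  qed
  have alt: "contract \<phi> L (xs @ u # u # ys) = 0" if "alternating L" for L xs ys u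
    using that
  proof (induction xs arbitrary: L)
    \<comment> \<open>The two deletions of \<open>u\<close> leave the same list with opposite signs;
      deletions from \<open>ys\<close> keep both copies of \<open>u\<close>.\<close>
    case Nil
    have "(\<lambda>gs. L (u # u # gs)) = (\<lambda>_. 0)"
      by (rule ext, rule alternating_hd(3)[OF Nil])
    then show ?case
      by (simp add: contract_zero_form)
  next
    case (Cons x xs)
    show ?case
      using Cons.IH[OF alternating_Cons[OF Cons.prems]] alternatingD(3)[OF Cons.prems]
      by simp
  qed
  show ?thesis
    unfolding alternating_def using add scale alt assms(1) by blast
qed

text \<open>
  The state above and below a vertex is \<open>s\<close> and \<open>s'\<close>, and \<open>h\<close> is the state of its right edge; a
  vertex violating the ice rule has weight 0.
\<close>

definition vertex_wt :: "'a::comm_ring_1 \<Rightarrow> 'a \<Rightarrow> 'a \<Rightarrow> bool \<Rightarrow> bool \<Rightarrow> int \<Rightarrow> 'a" where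
  "vertex_wt \<beta> \<gamma> r s s' h =
    (if h = 0 then (if s then if s' then 1 else \<beta> else if s' then 0 else 1)
     else if h = 1 then (if s then if s' then \<gamma> * \<beta> - r else 0 else if s' then \<gamma> else r)
     else 0)"

text \<open>The ice rule summed over the columns p to q: the state of the edge left of column
  \<open>p\<close> if the edge right of column \<open>q\<close> has state \<open>h\<close>. It is an
  integer, so a forbidden configuration shows as a value other than 0 and 1.\<close>

definition flow :: "int \<Rightarrow> nat \<Rightarrow> nat set \<Rightarrow> nat set \<Rightarrow> nat \<Rightarrow> int" where
  "flow h q S S' p = h + int (card (S \<inter> {p..q})) - int (card (S' \<inter> {p..q}))"

definition row_wt ::
    "'a::comm_ring_1 \<Rightarrow> 'a \<Rightarrow> 'a \<Rightarrow> nat \<Rightarrow> int \<Rightarrow> nat set \<Rightarrow> nat set \<Rightarrow> 'a" where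
  "row_wt \<beta> \<gamma> r q h S S' =
    (\<Prod>p\<in>{1..q}. vertex_wt \<beta> \<gamma> r (p \<in> S) (p \<in> S') (flow h q S S' (Suc p)))"

lemma card_Int_Suc:
  "p \<le> Suc q \<Longrightarrow> card (S \<inter> {p..Suc q}) = of_bool (Suc q \<in> S) + card (S \<inter> {p..q})"
  by (cases "Suc q \<in> S") (auto simp: atLeastAtMostSuc_conv)

lemma flow_Suc:
  "p \<le> Suc q \<Longrightarrow>
    flow h (Suc q) S S' p = flow (h + of_bool (Suc q \<in> S) - of_bool (Suc q \<in> S')) q S S' p"
  by (simp add: flow_def card_Int_Suc)

lemma flow_empty: "q < p \<Longrightarrow> flow h q S S' p = h"
  by (simp add: flow_def)

lemma row_wt_Suc:
  "row_wt \<beta> \<gamma> r (Suc q) h S S' =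
    vertex_wt \<beta> \<gamma> r (Suc q \<in> S) (Suc q \<in> S') h *
    row_wt \<beta> \<gamma> r q (h + of_bool (Suc q \<in> S) - of_bool (Suc q \<in> S')) S S'"
proof -
  have "row_wt \<beta> \<gamma> r (Suc q) h S S' =
    (\<Prod>p\<in>{1..q}. vertex_wt \<beta> \<gamma> r (p \<in> S) (p \<in> S') (flow h (Suc q) S S' (Suc p))) *
    vertex_wt \<beta> \<gamma> r (Suc q \<in> S) (Suc q \<in> S') h"
    unfolding row_wt_def by (simp add: flow_empty)
  also have "(\<Prod>p\<in>{1..q}. vertex_wt \<beta> \<gamma> r (p \<in> S) (p \<in> S') (flow h (Suc q) S S' (Suc p))) =
      row_wt \<beta> \<gamma> r q (h + of_bool (Suc q \<in> S) - of_bool (Suc q \<in> S')) S S'"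
    unfolding row_wt_def by (intro prod.cong refl) (simp add: flow_Suc)
  finally show ?thesis by (simp add: mult.commute)
qed

lemma flow_insert_greater:
  "q < a \<Longrightarrow> flow h q S (insert a S') p = flow h q S S' p"
  by (simp add: flow_def)

lemma row_wt_insert_greater:
  "q < a \<Longrightarrow> row_wt \<beta> \<gamma> r q h S (insert a S') = row_wt \<beta> \<gamma> r q h S S'"
  unfolding row_wt_def by (intro prod.cong refl) (auto simp: flow_insert_greater)

text \<open>The decreasing order puts the rightmost column at the head of the list, where the
  recursion on \<open>q\<close> peels it off.\<close>

fun desc :: "(nat \<Rightarrow> 'b) \<Rightarrow> nat \<Rightarrow> nat set \<Rightarrow> 'b list" where
  "desc e 0 S = []"
| "desc e (Suc q) S = (if Suc q \<in> S then e (Suc q) # desc e q S else desc e q S)"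

lemma desc_insert_greater: "q < a \<Longrightarrow> desc e q (insert a S) = desc e q S"
  by (induction q) auto

lemma map_desc: "map g (desc e q S) = desc (\<lambda>s. g (e s)) q S"
  by (induction q) auto

lemma desc_cong: "(\<And>s. 1 \<le> s \<Longrightarrow> s \<le> q \<Longrightarrow> e s = e' s) \<Longrightarrow> desc e q S = desc e' q S"
  by (induction q) auto

lemma length_desc: "length (desc e q S) = card (S \<inter> {1..q})"
  by (induction q) (auto simp: card_Int_Suc)

lemma set_desc: "set (desc e q S) \<subseteq> e ` {1..q}"
  by (induction q) auto

section \<open>Summing over one row of vertices\<close>

lemma sum_Pow_Suc:
  "(\<Sum>B\<in>Pow {1..Suc q}. F B) =
    (\<Sum>B\<in>Pow {1..q}. F B) + (\<Sum>B\<in>Pow {1..q}. F (insert (Suc q) B))"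
proof -
  have eq: "{1..Suc q} = insert (Suc q) {1..q}" by auto
  have disj: "Pow {1..q} \<inter> insert (Suc q) ` Pow {1..q} = {}" by auto
  have inj: "inj_on (insert (Suc q)) (Pow {1..q})"
    by (rule inj_onI) (metis PowD Suc_n_not_le_n atLeastAtMost_iff insert_ident subsetD)
  show ?thesis
    unfolding eq Pow_insert
    by (subst sum.union_disjoint) (use disj inj in \<open>auto simp: sum.reindex\<close>)
qed

text \<open>The vector of a particle that enters column \<open>q\<close> from the right: it turns
  down with weight \<open>\<gamma>\<close> or moves on with weight \<open>r\<close>, and finally
  leaves the grid as \<open>e 0\<close>.\<close>

fun carry :: "'a::comm_ring_1 \<Rightarrow> 'a \<Rightarrow> (nat \<Rightarrow> 'a poly) \<Rightarrow> nat \<Rightarrow> 'a poly" where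
  "carry \<gamma> r e 0 = e 0"
| "carry \<gamma> r e (Suc q) = smult \<gamma> (e (Suc q)) + smult r (carry \<gamma> r e q)"

text \<open>Each particle of \<open>S\<close> moves as if it were alone: it goes straight down as
  \<open>e s\<close>, or turns left with weight \<open>\<beta>\<close> and becomes a carry.
  Multilinear expansion of \<open>L\<close> reproduces the row sum because the alternating sign
  accounts for the vertex where two particles meet.\<close>

lemma row_sum:
  fixes e :: "nat \<Rightarrow> 'a::comm_ring_1 poly"
  assumes "alternating L" "h \<in> {0, 1}"
  shows "(\<Sum>S'\<in>Pow {1..q}. row_wt \<beta> \<gamma> r q h S S' *
      L (desc e q S' @ (if flow h q S S' 1 = 1 then [e 0] else []))) =
    L ((if h = 1 then [carry \<gamma> r e q] else []) @
      desc (\<lambda>s. e s + smult \<beta> (carry \<gamma> r e (s - 1))) q S)"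
  using assms
proof (induction q arbitrary: h L)
  case 0
  then show ?case by (simp add: row_wt_def flow_def)
next
  case (Suc q)
  let ?D = "desc (\<lambda>s. e s + smult \<beta> (carry \<gamma> r e (s - 1))) q S"
  define P where "P = (\<lambda>h L. (\<Sum>S'\<in>Pow {1..q}. row_wt \<beta> \<gamma> r q h S S' *
      L (desc e q S' @ (if flow h q S S' 1 = 1 then [e 0] else []))))"
  \<comment> \<open>\<open>P\<close> at -1 or 2 is multiplied by a vanishing vertex weight, so the
    induction hypothesis covers every remaining term.\<close>
  have P0: "P 0 L = L ?D" and P1: "P 1 L = L (carry \<gamma> r e q # ?D)" if "alternating L" for L
    using Suc.IH[OF that, of 0] Suc.IH[OF that, of 1] by (simp_all add: P_def)
  define s :: int where "s = of_bool (Suc q \<in> S)"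
  have no: "Suc q \<notin> S'" if "S' \<in> Pow {1..q}" for S' using that by auto
  have "(\<Sum>S'\<in>Pow {1..Suc q}. row_wt \<beta> \<gamma> r (Suc q) h S S' *
      L (desc e (Suc q) S' @ (if flow h (Suc q) S S' 1 = 1 then [e 0] else []))) =
    vertex_wt \<beta> \<gamma> r (Suc q \<in> S) False h * P (h + s) L +
    vertex_wt \<beta> \<gamma> r (Suc q \<in> S) True h * P (h + s - 1) (\<lambda>gs. L (e (Suc q) # gs))"
    unfolding sum_Pow_Suc P_def sum_distrib_left
    by (intro arg_cong2[where f = "(+)"] sum.cong refl)
      (use no in \<open>simp_all add: row_wt_Suc s_def flow_Suc row_wt_insert_greater desc_insert_greater
        flow_insert_greater mult.assoc\<close>)
  also have "\<dots> = L ((if h = 1 then [carry \<gamma> r e (Suc q)] else []) @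
      desc (\<lambda>s. e s + smult \<beta> (carry \<gamma> r e (s - 1))) (Suc q) S)"
  proof -
    note alt = Suc.prems(1)
    note alts = alternating_hd[OF alt] alternating_hd2[OF alt]
    note PP = P0[OF alt] P1[OF alt] P0[OF alternating_Cons[OF alt]] P1[OF alternating_Cons[OF alt]]
    consider "h = 0" "Suc q \<in> S" | "h = 0" "Suc q \<notin> S" | "h = 1" "Suc q \<in> S" | "h = 1" "Suc q \<notin> S"
      using Suc.prems(2) by auto
    then show ?thesis
    proof cases
      \<comment> \<open>A carry meets a particle of \<open>S\<close>. If the carry turns down and
        the particle turns left the weight is \<gamma>\<beta>; if the carry moves on and the
        particle goes down it is \<open>r\<close>, with the entries swapped. Hence
        \<open>\<gamma> * \<beta> - r\<close>, the free-fermion condition.\<close>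
      case 3
      have sw: "L (carry \<gamma> r e q # e (Suc q) # D) = - L (e (Suc q) # carry \<gamma> r e q # D)" for D
        by (rule alternating_swap[OF alt])
      show ?thesis
        using 3 by (simp add: vertex_wt_def s_def PP alts sw algebra_simps)
    qed (simp_all add: vertex_wt_def s_def PP alts)
  qed
  finally show ?case .
qed

section \<open>Row sums of free-fermionic weights as alternating forms\<close>

text \<open>\<open>synthetic_div f r\<close> is the divided difference (f(z) - f(r))/(z -
  r).\<close>

definition divided_map :: "'a::comm_ring_1 \<Rightarrow> 'a \<Rightarrow> 'a poly \<Rightarrow> 'a poly" where
  "divided_map c r f = f + smult c (synthetic_div f r)"

lemma synthetic_div_pCons_eq:
  "synthetic_div (pCons a p) r = p + smult r (synthetic_div p r)"
  by (simp add: synthetic_div_correct)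

lemma synthetic_div_add:
  "synthetic_div (p + q) r = synthetic_div p r + synthetic_div q (r :: 'a::comm_ring_1)"
proof (induction p q rule: poly_induct2)
  case (pCons a p b q)
  then show ?case by (simp add: synthetic_div_pCons_eq smult_add_right algebra_simps)
qed simp

lemma synthetic_div_smult:
  "synthetic_div (smult c p) r = smult c (synthetic_div p (r :: 'a::comm_ring_1))"
  by (induction p) (simp_all add: synthetic_div_pCons_eq smult_add_right mult.commute)

lemma linear_divided_map: "linear_map (divided_map c r)"
  by (simp add: linear_map_def divided_map_def synthetic_div_add synthetic_div_smult
      smult_add_right algebra_simps)

lemma poly_shift_1_pCons [simp]: "poly_shift (Suc 0) (pCons a p) = p"
  by (simp add: poly_eq_iff coeff_poly_shift)

lemma linear_poly_shift: "linear_map (poly_shift 1)"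
  by (simp add: linear_map_def poly_eq_iff coeff_poly_shift)

lemma linear_functional_coeff_0: "linear_functional (\<lambda>f. coeff f 0)"
  by (simp add: linear_functional_def)

lemma linear_functional_eval: "linear_functional (\<lambda>f. c * poly f r)"
  by (simp add: linear_functional_def algebra_simps)

lemma linear_functional_comp:
  "linear_functional \<phi> \<Longrightarrow> linear_map A \<Longrightarrow> linear_functional (\<lambda>f. \<phi> (A f))"
  by (simp add: linear_functional_def linear_map_def)

lemma linear_functional_add:
  "linear_functional \<phi> \<Longrightarrow> linear_functional \<psi> \<Longrightarrow> linear_functional (\<lambda>f. \<phi> f + \<psi> f)"
  by (simp add: linear_functional_def algebra_simps)

lemma linear_map_comp: "linear_map A \<Longrightarrow> linear_map B \<Longrightarrow> linear_map (\<lambda>f. A (B f))"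
  by (simp add: linear_map_def)

text \<open>Column 1 is the constant polynomial. Inside a row sum column s is z^s instead, which
  leaves z^0 for a particle that has left the grid.\<close>

definition basis :: "nat \<Rightarrow> 'a::comm_ring_1 poly" where
  "basis s = monom 1 (s - 1)"

text \<open>Travelling through all q columns contributes r^q, and turning down in column p
  contributes \<gamma> r^(q-p) z^p; the latter terms add up to z \<gamma> (z^q - r^q)/(z -
  r).\<close>

lemma carry_monom:
  "carry \<gamma> r (monom 1) q = [:r ^ q:] + pCons 0 (smult \<gamma> (synthetic_div (monom 1 q) r))"
proof (induction q)
  case 0
  then show ?case by (simp add: monom_0)
next
  case (Suc q)
  then show ?case
    by (simp add: monom_Suc synthetic_div_pCons_eq smult_add_right mult.commute
        del: synthetic_div_pCons)
qed

text \<open>In the first term no particle leaves the row; in the second one does. A particle of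
  column s turns left with weight \<beta> and passes s - 1 columns, which is \<beta> times the value
  of \<open>basis s\<close> at \<open>r\<close>.\<close>

definition row_form ::
  "'a::comm_ring_1 \<Rightarrow> 'a \<Rightarrow> 'a \<Rightarrow> ('a poly list \<Rightarrow> 'a) \<Rightarrow> 'a poly list \<Rightarrow> 'a" where
  "row_form \<beta> \<gamma> r L fs =
    L (map (divided_map (\<gamma> * \<beta>) r) fs) +
    contract (\<lambda>f. \<beta> * poly f r) (\<lambda>gs. L (map (divided_map (\<gamma> * \<beta>) r) gs)) fs"

lemma row_form_alternating: "alternating L \<Longrightarrow> alternating (row_form \<beta> \<gamma> r L)"
  unfolding row_form_def
  by (intro alternating_add alternating_map alternating_contract linear_divided_map
      linear_functional_eval)

lemma row_sum_form:
  assumes "alternating L"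
  shows "(\<Sum>S'\<in>Pow {1..q}. row_wt \<beta> \<gamma> r q 0 S S' * L (desc basis q S')) =
    row_form \<beta> \<gamma> r L (desc basis q S)"
proof -
  \<comment> \<open>\<open>E\<close> sums over the left boundary edge. A list ending in z^0 is
    killed by the shift in the first term and loses exactly this entry in the contraction; a list
    without z^0 has no constant terms, so only the first term survives. Either way the value is
    \<open>L (desc basis q S')\<close>.\<close>
  define E where "E = (\<lambda>gs. L (map (poly_shift 1) gs) +
    contract (\<lambda>f. coeff f 0) (\<lambda>gs. L (map (poly_shift 1) gs)) gs)"
  have alt: "alternating E"
    unfolding E_def
    by (intro alternating_add alternating_contract alternating_map assms linear_poly_shift
        linear_functional_coeff_0)
  have shift: "desc (\<lambda>s. poly_shift (Suc 0) (monom 1 s)) q S' = desc basis q S'" for S'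
  proof (rule desc_cong)
    fix s assume "(1::nat) \<le> s"
    then show "poly_shift (Suc 0) (monom 1 s) = basis s"
      by (cases s) (simp_all add: basis_def monom_Suc)
  qed
  have c0: "coeff f 0 = 0" if "f \<in> set (desc (monom 1) q S')" for f and S'
    using set_desc[of "monom 1" q S'] that by auto
  have E1: "E (desc (monom 1) q S' @ (if b then [monom 1 0] else [])) = L (desc basis q S')"
    for S' b
    using alternating_zero[OF assms, of _ "[]"]
    by (cases b) (simp_all add: E_def map_desc shift monom_0
        contract_last[of "desc (monom 1) q S'" "\<lambda>f. coeff f 0", OF c0]
        contract_vanishing[of "desc (monom 1) q S'" "\<lambda>f. coeff f 0", OF c0])
  have E2: "E (desc (\<lambda>s. monom 1 s + smult \<beta> (carry \<gamma> r (monom 1) (s - 1))) q S) =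
      row_form \<beta> \<gamma> r L (desc basis q S)"
  proof -
    \<comment> \<open>The shift keeps the divided difference part of the carry, the constant
      coefficient keeps its part r^(s-1) that leaves the grid.\<close>
    have a: "poly_shift (Suc 0) (monom 1 s + smult \<beta> (carry \<gamma> r (monom 1) (s - 1))) =
        divided_map (\<gamma> * \<beta>) r (basis s)"
      and b: "coeff (monom 1 s + smult \<beta> (carry \<gamma> r (monom 1) (s - 1))) 0 =
        \<beta> * poly (basis s) r" if "1 \<le> s" for s
      using that by (cases s; simp add: carry_monom basis_def divided_map_def monom_Suc
          poly_monom mult.commute)+
    \<comment> \<open>Over a list of indices, \<open>contract_map\<close> turns both sides into
      contractions of the same list, whose forms and functionals are then compared entry by
      entry.\<close>
    let ?I = "desc id q S"
    have I: "1 \<le> s" if "s \<in> set ?I" for s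
      using set_desc[of id q S] that by auto
    have D: "desc g q S = map g ?I" for g :: "nat \<Rightarrow> 'a poly"
      by (simp add: map_desc)
    have M: "map (poly_shift (Suc 0))
          (map (\<lambda>s. monom 1 s + smult \<beta> (carry \<gamma> r (monom 1) (s - 1))) ks) =
        map (divided_map (\<gamma> * \<beta>) r) (map basis ks)"
      if "\<And>s. s \<in> set ks \<Longrightarrow> 1 \<le> s" for ks
      using that a by simp
    show ?thesis
      unfolding E_def row_form_def D contract_map One_nat_def
    proof (intro arg_cong2[where f = "(+)"] arg_cong[where f = L] contract_cong)
      show "map (poly_shift (Suc 0))
          (map (\<lambda>s. monom 1 s + smult \<beta> (carry \<gamma> r (monom 1) (s - Suc 0))) ?I) =
        map (divided_map (\<gamma> * \<beta>) r) (map basis ?I)"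
        using M[of ?I] I by simp
      fix ks assume "set ks \<subseteq> set ?I"
      then show "map (poly_shift (Suc 0))
          (map (\<lambda>s. monom 1 s + smult \<beta> (carry \<gamma> r (monom 1) (s - Suc 0))) ks) =
        map (divided_map (\<gamma> * \<beta>) r) (map basis ks)"
        using M[of ks] I by auto
    next
      fix s assume "s \<in> set ?I"
      then show "coeff (monom 1 s + smult \<beta> (carry \<gamma> r (monom 1) (s - Suc 0))) 0 =
          \<beta> * poly (basis s) r"
        using b[of s] I[of s] by simp
    qed
  qed
  have "(\<Sum>S'\<in>Pow {1..q}. row_wt \<beta> \<gamma> r q 0 S S' * L (desc basis q S')) =
    (\<Sum>S'\<in>Pow {1..q}. row_wt \<beta> \<gamma> r q 0 S S' *
      E (desc (monom 1) q S' @ (if flow 0 q S S' 1 = 1 then [monom 1 0] else [])))"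
    by (simp only: E1)
  also have "\<dots> = E (desc (\<lambda>s. monom 1 s + smult \<beta> (carry \<gamma> r (monom 1) (s - 1))) q S)"
    using row_sum[OF alt, of 0 \<beta> \<gamma> r q S "monom 1"] by simp
  also have "\<dots> = row_form \<beta> \<gamma> r L (desc basis q S)"
    by (rule E2)
  finally show ?thesis .
qed

text \<open>
  If \<open>basis s\<close> stands for the antisymmetrization \<open>z\<^sup>s - (d/z)\<^sup>s\<close>, this is multiplication by
  \<open>z + d/z\<close>.
\<close>

definition chebyshev_mult :: "'a::comm_ring_1 \<Rightarrow> 'a poly \<Rightarrow> 'a poly" where
  "chebyshev_mult d f = pCons 0 f + smult d (poly_shift 1 f)"

lemma linear_chebyshev_mult: "linear_map (chebyshev_mult d)"
  by (simp add: linear_map_def chebyshev_mult_def poly_eq_iff coeff_poly_shift coeff_pCons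
      algebra_simps split: nat.split)

section \<open>The row maps of one letter pair\<close>

lemma divided_map_const: "divided_map c r [:a:] = [:a:]"
  by (simp add: divided_map_def)

lemma divided_map_linear:
  "divided_map c r (f + g) = divided_map c r f + divided_map c r g"
  "divided_map c r (smult a f) = smult a (divided_map c r f)"
  "divided_map c r (f - g) = divided_map c r f - divided_map c r g"
proof -
  show *: "divided_map c r (f + g) = divided_map c r f + divided_map c r g"
    "divided_map c r (smult a f) = smult a (divided_map c r f)" for f g a
    using linear_divided_map[of c r] by (simp_all add: linear_map_def)
  show "divided_map c r (f - g) = divided_map c r f - divided_map c r g"
    using *(1)[of f "smult (-1) g"] *(2)[of "-1" g] by simp
qed

lemma divided_map_pCons:
  "divided_map c r (pCons 0 f) = pCons 0 f + smult (c - r) f + smult r (divided_map c r f)"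
  by (simp add: divided_map_def synthetic_div_pCons_eq algebra_simps smult_add_right smult_diff_left
      del: synthetic_div_pCons)

text \<open>The constants are \<open>\<gamma> * \<beta>\<close> and \<open>r\<close> of the vertex
  weights: \<beta> = r = x for an unbarred letter, \<beta> = t/x and r = t^2/x for a barred one,
  \<gamma> = 1 + t for both. The name \<open>xi\<close> stands for 1/x.\<close>

definition "unbar_map x t = divided_map ((1 + t) * x) (x :: 'a::comm_ring_1)"
definition "bar_map xi t = divided_map ((1 + t) * (t * xi)) (t^2 * (xi :: 'a::comm_ring_1))"
text \<open>The two ways to lose a particle in a pair of rows: in the barred row, reached through
  \<open>unbar_map\<close>, or already in the unbarred row.\<close>

definition "pair_functional x xi t f = t * xi * poly (unbar_map x t f) (t^2 * xi) + x * poly f x"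
definition "root_sum x xi t = x + t^2 * (xi :: 'a::comm_ring_1)"

lemma unbar_map_pCons: "unbar_map x t (pCons 0 f) = pCons 0 f + smult (t * x) f + smult x (unbar_map x t f)"
  unfolding unbar_map_def divided_map_pCons by (simp add: algebra_simps)

lemma bar_map_pCons:
  "bar_map xi t (pCons 0 f) = pCons 0 f + smult (t * xi) f + smult (t^2 * xi) (bar_map xi t f)"
  unfolding bar_map_def divided_map_pCons by (simp add: algebra_simps power2_eq_square)

lemma unbar_map_const: "unbar_map x t [:a:] = [:a:]" and bar_map_const: "bar_map xi t [:a:] = [:a:]"
  by (simp_all add: unbar_map_def bar_map_def divided_map_const)

lemmas unbar_map_lin = divided_map_linear[of "(1 + t) * x" x for x t, folded unbar_map_def]
lemmas bar_map_lin = divided_map_linear[of "(1 + t) * (t * xi)" "t^2 * xi" for xi t, folded bar_map_def]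

context
  fixes x xi t :: "'a::comm_ring_1"
  assumes inverse: "x * xi = 1"
begin

lemma inverse': "x * (xi * a) = a" "xi * (x * a) = a" "xi * x = 1"
  using inverse by (simp_all add: mult.assoc[symmetric] mult.commute[of xi x])

text \<open>With f = a + z g the argument is (z - x) f - t^2/x (a + (z - x) g). The map turns z - x
  into z + t x and fixes the constant \<open>a\<close>; the result is regrouped around the next node
  t^2/x.\<close>

lemma unbar_map_shifted:
  "unbar_map x t (chebyshev_mult (t^2) (pCons a g) - smult (root_sum x xi t) (pCons a g)) =
    pCons 0 (pCons a g) - smult (t^2 * xi) (pCons a g) +
    smult (t * x) (pCons 0 g + [:a:] - smult (t^2 * xi) g)"
proof -
  have "chebyshev_mult (t^2) (pCons a g) - smult (root_sum x xi t) (pCons a g) =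
    pCons 0 (pCons a g) - smult x (pCons a g) -
    smult (t^2 * xi) ([:a:] + (pCons 0 g - smult x g))"
    unfolding chebyshev_mult_def root_sum_def One_nat_def poly_shift_1_pCons
    by (rule poly_eqI) (simp add: coeff_pCons algebra_simps inverse' split: nat.split)
  then show ?thesis
    by (simp only: unbar_map_lin unbar_map_pCons unbar_map_const)
      (rule poly_eqI, simp add: coeff_pCons algebra_simps inverse' split: nat.split)
qed

text \<open>In the regrouped form the barred map only has to turn z - t^2/x into z + t/x.\<close>

lemma pair_map_shifted:
  "bar_map xi t (unbar_map x t (chebyshev_mult (t^2) f - smult (root_sum x xi t) f)) =
    chebyshev_mult (t^2) f + smult (t * (x + xi)) f"
proof (cases f)
  case (pCons a g)
  show ?thesis
    unfolding pCons unbar_map_shifted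
    apply (simp only: bar_map_lin bar_map_pCons bar_map_const)
    unfolding chebyshev_mult_def One_nat_def poly_shift_1_pCons
    by (rule poly_eqI) (simp add: coeff_pCons algebra_simps inverse' power2_eq_square split: nat.split)
qed

text \<open>Equivalently, the functional vanishes on (U - u) f. All terms with a factor that
  vanishes at the node drop out, and the constant term \<open>a\<close> of f contributes t^2 a from
  the barred row and -t^2 a from the unbarred one.\<close>

lemma pair_functional_shifted:
  "pair_functional x xi t (chebyshev_mult (t^2) f) = root_sum x xi t * pair_functional x xi t f"
proof (cases f)
  case (pCons a g)
  have "pair_functional x xi t (chebyshev_mult (t^2) f) - root_sum x xi t * pair_functional x xi t f =
    pair_functional x xi t (chebyshev_mult (t^2) f - smult (root_sum x xi t) f)"
    unfolding pair_functional_def by (simp add: unbar_map_lin algebra_simps)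
  also have "\<dots> = 0"
    unfolding pair_functional_def pCons unbar_map_shifted
    by (simp add: chebyshev_mult_def root_sum_def algebra_simps inverse' power2_eq_square)
  finally show ?thesis by simp
qed

lemma pair_functional_1: "pair_functional x xi t 1 = x + t * xi"
  by (simp add: pair_functional_def one_pCons unbar_map_const)

end

section \<open>The partition function\<close>

lemma linear_mapD:
  assumes "linear_map A"
  shows "A (u + v) = A u + A v" "A (smult c u) = smult c (A u)" "A 0 = 0" "A (u - v) = A u - A v"
proof -
  show *: "A (u + v) = A u + A v" "A (smult c u) = smult c (A u)" for u v c
    using assms by (simp_all add: linear_map_def)
  show "A 0 = 0" using *(2)[of 0 0] by simp
  show "A (u - v) = A u - A v" using *(1)[of u "smult (-1) v"] *(2)[of "-1" v] by simp
qed

lemma linear_unbar_map: "linear_map (unbar_map x t)"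
  and linear_bar_map: "linear_map (bar_map xi t)"
  by (simp_all add: linear_map_def unbar_map_lin bar_map_lin)

lemma linear_pair_functional: "linear_functional (pair_functional x xi t)"
  unfolding pair_functional_def
  by (intro linear_functional_add linear_functional_eval linear_unbar_map
      linear_functional_comp[OF linear_functional_eval, of "unbar_map x t"])

text \<open>Since \<open>L\<close> has degree k and the list k + 1 entries, of the four terms of the
  two row forms only those survive in which exactly one row loses a particle; they share the same
  composed map and merge into one contraction.\<close>

lemma row_form_pair:
  assumes "\<And>gs. length gs \<noteq> k \<Longrightarrow> L gs = 0" "length fs = Suc k"
  shows "row_form x (1 + t) x (row_form (t * xi) (1 + t) (t^2 * xi) L) fs =
    contract (pair_functional x xi t) (\<lambda>gs. L (map (\<lambda>f. bar_map xi t (unbar_map x t f)) gs)) fs"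
proof -
  have z: "contract \<phi> (\<lambda>gs. L (map A gs)) hs = 0" if "length hs \<noteq> Suc k" for \<phi> A and hs :: "'a poly list"
    by (rule contract_wrong_degree) (use assms(1) that in simp)
  show ?thesis
    unfolding row_form_def unbar_map_def[symmetric] bar_map_def[symmetric]
    using assms(2)
    by (simp add: assms(1) contract_add contract_map comp_def contract_wrong_degree[OF z]
        pair_functional_def[abs_def] contract_add_functional)
qed

section \<open>Iterated letter pairs\<close>

definition "pair_map x xi t k f = bar_map (xi k) t (unbar_map (x k) t f)"

text \<open>The partition function of the lowest \<open>2 * k\<close> rows as a form in the state
  above them. It has degree k, as every pair removes one vector; the empty list is the empty state
  at the bottom.\<close>

fun pair_form ::
    "(nat \<Rightarrow> 'a::comm_ring_1) \<Rightarrow> (nat \<Rightarrow> 'a) \<Rightarrow> 'a \<Rightarrow> nat \<Rightarrow> 'a poly list \<Rightarrow> 'a" where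
  "pair_form x xi t 0 fs = (if fs = [] then 1 else 0)"
| "pair_form x xi t (Suc k) fs =
     contract (pair_functional (x (Suc k)) (xi (Suc k)) t)
       (\<lambda>gs. pair_form x xi t k (map (pair_map x xi t (Suc k)) gs)) fs"

lemma linear_pair_map: "linear_map (pair_map x xi t k)"
  unfolding pair_map_def by (rule linear_map_comp[OF linear_bar_map linear_unbar_map])

lemma alternating_pair_form: "alternating (pair_form x xi t k)"
proof (induction k)
  case 0
  then show ?case by (simp add: alternating_def)
next
  case (Suc k)
  have eq: "pair_form x xi t (Suc k) = contract (pair_functional (x (Suc k)) (xi (Suc k)) t)
       (\<lambda>gs. pair_form x xi t k (map (pair_map x xi t (Suc k)) gs))"
    by (rule ext) simp
  show ?case
    unfolding eq
    by (rule alternating_contract[OF alternating_map[OF Suc linear_pair_map] linear_pair_functional])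
qed

lemma pair_form_wrong_degree: "length gs \<noteq> k \<Longrightarrow> pair_form x xi t k gs = 0"
proof (induction k arbitrary: gs)
  case (Suc k)
  then show ?case by (auto intro!: contract_wrong_degree)
qed simp

text \<open>By induction the head is followed by \<open>v k\<close>, so its correction term repeats
  an entry.\<close>

lemma alternating_difference_columns:
  assumes "alternating L"
  shows "L (map (\<lambda>j. v (Suc j) - smult c (v j)) (rev [0..<k]) @ [v 0]) = L (map v (rev [0..<Suc k]))"
  using assms
proof (induction k arbitrary: L)
  case 0
  then show ?case by simp
next
  case (Suc k)
  let ?w = "v (Suc k) - smult c (v k)"
  have "L (map (\<lambda>j. v (Suc j) - smult c (v j)) (rev [0..<Suc k]) @ [v 0]) =
      L (?w # map v (rev [0..<Suc k]))"
    using Suc.IH[OF alternating_Cons[OF Suc.prems, of ?w]] by simp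
  also have "\<dots> = L ((v (Suc k) + smult (- c) (v k)) # v k # map v (rev [0..<k]))"
    by simp
  also have "\<dots> = L (map v (rev [0..<Suc (Suc k)]))"
    by (simp only: alternating_hd(1,2)[OF Suc.prems] alternating_hd(3)[OF Suc.prems]) simp
  finally show ?case .
qed

lemma alternating_member:
  assumes "alternating L" "v \<in> set xs"
  shows "L (v # xs) = 0"
  using assms
proof (induction xs arbitrary: L)
  case (Cons y xs)
  show ?case
  proof (cases "v = y")
    case True
    then show ?thesis using alternating_hd(3)[OF Cons.prems(1)] by simp
  next
    case False
    then have "L (y # v # xs) = 0"
      using Cons.IH[OF alternating_Cons[OF Cons.prems(1)], of y] Cons.prems(2) by simp
    then show ?thesis
      using alternating_swap[OF Cons.prems(1), of v y xs] by simp
  qed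
qed simp

text \<open>Such an \<open>f\<close> is a combination of the monomials that are already in the
  list.\<close>

lemma alternating_low_degree:
  assumes "alternating L" "\<And>i. i \<ge> k \<Longrightarrow> coeff f i = 0"
  shows "L (f # map (monom 1) (rev [0..<k])) = 0"
proof -
  have sum: "L ((\<Sum>i\<in>I. smult (g i) (w i)) # ys) = (\<Sum>i\<in>I. g i * L (w i # ys))"
    if "finite I" for I :: "nat set" and g w ys
    using that
    by (induction I) (use alternating_zero[OF assms(1), of "[]"] in
        \<open>simp_all add: alternating_hd[OF assms(1)]\<close>)
  have "f = (\<Sum>i<k. smult (coeff f i) (monom 1 i))"
    by (rule poly_eqI) (use assms(2) in \<open>auto simp: coeff_sum sum.delta' not_less if_distrib cong: if_cong\<close>)
  then have "L (f # map (monom 1) (rev [0..<k])) =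
      (\<Sum>i<k. coeff f i * L (monom 1 i # map (monom 1) (rev [0..<k])))"
    using sum[of "{..<k}" "coeff f" "monom 1"] by simp
  also have "\<dots> = 0"
    by (intro sum.neutral ballI) (use alternating_member[OF assms(1)] in simp)
  finally show ?thesis .
qed

lemma chebyshev_mult_leading:
  "coeff ((chebyshev_mult d ^^ j) 1) j = 1 \<and> (\<forall>i>j. coeff ((chebyshev_mult d ^^ j) 1) i = 0)"
  by (induction j) (auto simp: chebyshev_mult_def coeff_pCons coeff_poly_shift split: nat.split)

text \<open>U^j 1 is monic of degree j, so the change from the monomials is unitriangular and the
  form does not see it.\<close>

lemma alternating_chebyshev:
  assumes "alternating L"
  shows "L (map (monom 1) (rev [0..<k])) = L (map (\<lambda>j. (chebyshev_mult d ^^ j) 1) (rev [0..<k]))"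
  using assms
proof (induction k arbitrary: L)
  case (Suc k)
  let ?v = "(chebyshev_mult d ^^ k) 1" and ?m = "monom 1 k :: 'a poly"
  have "L (map (\<lambda>j. (chebyshev_mult d ^^ j) 1) (rev [0..<Suc k])) =
      L (?v # map (monom 1) (rev [0..<k]))"
    using Suc.IH[OF alternating_Cons[OF Suc.prems, of ?v]] by simp
  also have "\<dots> = L ((?m + (?v - ?m)) # map (monom 1) (rev [0..<k]))"
    by simp
  also have "\<dots> = L (?m # map (monom 1) (rev [0..<k])) +
      L ((?v - ?m) # map (monom 1) (rev [0..<k]))"
    by (rule alternating_hd(1)[OF Suc.prems])
  also have "L ((?v - ?m) # map (monom 1) (rev [0..<k])) = 0"
    by (rule alternating_low_degree[OF Suc.prems])
      (use chebyshev_mult_leading[of k d] in \<open>auto simp: le_less\<close>)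
  finally show ?case by simp
qed simp

lemma desc_all: "desc basis k {1..n} = map (monom 1) (rev [0..<k])" if "k \<le> n"
  using that by (induction k) (simp_all add: basis_def)

context
  fixes x xi :: "nat \<Rightarrow> 'a::comm_ring_1" and t :: 'a
  assumes inverse: "\<And>i. x i * xi i = 1"
begin

text \<open>The seed \<open>v\<close> is arbitrary because a letter pair changes it to (U + c) v
  with c = t (x_k + 1/x_k). Every remaining functional is an eigenvector of composition with
  \<open>U\<close>, so the new seed multiplies it by u_i + c; these are the factors split
  off.\<close>

lemma pair_form_chebyshev:
  "pair_form x xi t k (map (\<lambda>j. (chebyshev_mult (t^2) ^^ j) v) (rev [0..<k])) =
    (\<Prod>i\<in>{1..k}. pair_functional (x i) (xi i) t v) *
    (\<Prod>j\<in>{1..k}. \<Prod>i\<in>{1..<j}. root_sum (x i) (xi i) t + t * (x j + xi j))"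
proof (induction k arbitrary: v)
  case 0
  then show ?case by simp
next
  case (Suc k)
  let ?U = "chebyshev_mult (t^2) :: 'a poly \<Rightarrow> 'a poly"
  let ?\<phi> = "\<lambda>i. pair_functional (x i) (xi i) t"
  let ?u = "\<lambda>i. root_sum (x i) (xi i) t"
  let ?k = "Suc k"
  let ?c = "t * (x ?k + xi ?k)"
  let ?W = "\<lambda>j. (?U ^^ Suc j) v - smult (?u ?k) ((?U ^^ j) v)"
  define v' where "v' = ?U v + smult ?c v"
  have \<phi>_U: "?\<phi> i (?U f) = ?u i * ?\<phi> i f" for i f
    by (rule pair_functional_shifted[OF inverse])
  have \<phi>_lin: "?\<phi> i (f + smult c g) = ?\<phi> i f + c * ?\<phi> i g" for i f g c
    using linear_pair_functional[of "x i" "xi i" t] by (simp add: linear_functional_def)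
  have \<phi>_W: "?\<phi> ?k (?W j) = 0" for j
    using \<phi>_lin[of ?k "?U ((?U ^^ j) v)" "- ?u ?k" "(?U ^^ j) v"] by (simp add: \<phi>_U)
  have K_W: "pair_map x xi t ?k (?W j) = (?U ^^ j) v'" for j
  proof -
    have U_pow: "(?U ^^ j) (f + smult c g) = (?U ^^ j) f + smult c ((?U ^^ j) g)" for f g c
      by (induction j) (simp_all add: linear_mapD[OF linear_chebyshev_mult])
    show ?thesis
      unfolding pair_map_def v'_def U_pow
      using pair_map_shifted[OF inverse, of ?k t "(?U ^^ j) v"]
      by (simp add: funpow_swap1)
  qed
  have "pair_form x xi t ?k (map (\<lambda>j. (?U ^^ j) v) (rev [0..<?k])) =
      pair_form x xi t ?k (map ?W (rev [0..<k]) @ [v])"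
    using alternating_difference_columns[OF alternating_pair_form[of x xi t ?k],
        of "\<lambda>j. (?U ^^ j) v" "?u ?k" k] by simp
  also have "\<dots> = ?\<phi> ?k v * pair_form x xi t k (map (\<lambda>j. (?U ^^ j) v') (rev [0..<k]))"
  proof -
    have "map (pair_map x xi t ?k) (map ?W (rev [0..<k])) = map (\<lambda>j. (?U ^^ j) v') (rev [0..<k])"
      by (simp only: map_map comp_def K_W)
    moreover have "?\<phi> ?k f = 0" if "f \<in> set (map ?W (rev [0..<k]))" for f
      using that unfolding set_map by (elim imageE) (simp only: \<phi>_W)
    ultimately show ?thesis
      by (simp only: pair_form.simps contract_last)
  qed
  also have "\<dots> = ?\<phi> ?k v * ((\<Prod>i\<in>{1..k}. ?\<phi> i v') *
      (\<Prod>j\<in>{1..k}. \<Prod>i\<in>{1..<j}. ?u i + t * (x j + xi j)))"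
    by (simp only: Suc.IH)
  also have "(\<Prod>i\<in>{1..k}. ?\<phi> i v') = (\<Prod>i\<in>{1..k}. ?\<phi> i v) * (\<Prod>i\<in>{1..k}. ?u i + ?c)"
    unfolding v'_def \<phi>_lin \<phi>_U prod.distrib[symmetric] by (simp add: algebra_simps)
  finally show ?case
    by (simp add: atLeastLessThanSuc_atLeastAtMost ac_simps)
qed

lemma pair_form_staircase:
  "pair_form x xi t n (desc basis n {1..n}) =
    (\<Prod>i\<in>{1..n}. x i + t * xi i) *
    (\<Prod>j\<in>{1..n}. \<Prod>i\<in>{1..<j}. x i + t^2 * xi i + t * (x j + xi j))"
  unfolding desc_all[OF le_refl] alternating_chebyshev[OF alternating_pair_form, where d = "t^2"]
    pair_form_chebyshev
  by (simp add: pair_functional_1[OF inverse] root_sum_def)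

end

text \<open>Level 2k belongs to the unbarred letter k, level 2k - 1 to the barred one. With these
  constants two particles meeting at a vertex have weight \<open>t * x k\<close> and
  \<open>t * xi k\<close> respectively.\<close>

definition letter_wt ::
    "(nat \<Rightarrow> 'a::comm_ring_1) \<Rightarrow> (nat \<Rightarrow> 'a) \<Rightarrow> 'a \<Rightarrow> nat \<Rightarrow> nat \<Rightarrow> nat set \<Rightarrow> nat set \<Rightarrow> 'a" where
  "letter_wt x xi t n c S S' =
    (if even c then row_wt (x (c div 2)) (1 + t) (x (c div 2)) n 0 S S'
     else row_wt (t * xi (Suc c div 2)) (1 + t) (t^2 * xi (Suc c div 2)) n 0 S S')"

text \<open>The size is prescribed at even levels only, because either row of a pair may be the one
  that loses a particle.\<close>

definition level_sets :: "nat \<Rightarrow> nat \<Rightarrow> nat set set" where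
  "level_sets n c = {S. S \<subseteq> {1..n} \<and> (even c \<longrightarrow> card S = c div 2)}"

section \<open>Transfer from level to level\<close>

fun transfer :: "(nat \<Rightarrow> 'b set) \<Rightarrow> (nat \<Rightarrow> 'b \<Rightarrow> 'b \<Rightarrow> 'a::comm_ring_1) \<Rightarrow> nat \<Rightarrow> 'b \<Rightarrow> 'a" where
  "transfer A w 0 S = 1"
| "transfer A w (Suc c) S = (\<Sum>S'\<in>A c. w (Suc c) S S' * transfer A w c S')"

lemma sum_paths:
  fixes A :: "nat \<Rightarrow> 'b set" and w :: "nat \<Rightarrow> 'b \<Rightarrow> 'b \<Rightarrow> 'a::comm_ring_1"
  shows "(\<Sum>f\<in>PiE {0..m} A. \<Prod>c\<in>{1..m}. w c (f c) (f (c - 1))) = (\<Sum>S\<in>A m. transfer A w m S)"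
proof -
  have split: "(\<Sum>f\<in>PiE {0..Suc m} A. F f) = (\<Sum>S\<in>A (Suc m). \<Sum>g\<in>PiE {0..m} A. F (g(Suc m := S)))"
    for m and F :: "(nat \<Rightarrow> 'b) \<Rightarrow> 'a"
  proof -
    have eq: "{0..Suc m} = insert (Suc m) {0..m}" by auto
    have inj: "inj_on (\<lambda>(S, g). g(Suc m := S)) (A (Suc m) \<times> PiE {0..m} A)"
      by (rule inj_combinator) simp
    show ?thesis
      unfolding eq PiE_insert_eq
      by (subst sum.reindex[OF inj]) (simp add: sum.cartesian_product case_prod_beta comp_def)
  qed
  \<comment> \<open>A factor \<open>G\<close> of the top state is included so that the induction
    step can absorb the weight of the last row into it.\<close>
  have "(\<Sum>f\<in>PiE {0..m} A. (\<Prod>c\<in>{1..m}. w c (f c) (f (c - 1))) * G (f m)) =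
      (\<Sum>S\<in>A m. transfer A w m S * G S)" for G
  proof (induction m arbitrary: G)
    case 0
    have "(\<Sum>f\<in>PiE {0} A. G (f 0)) = (\<Sum>S\<in>A 0. G S)"
      by (rule sum.reindex_bij_witness[of _ "\<lambda>S. \<lambda>i\<in>{0}. S" "\<lambda>f. f 0"])
        (auto simp: PiE_def extensional_def fun_eq_iff)
    then show ?case by simp
  next
    case (Suc m)
    have "(\<Sum>f\<in>PiE {0..Suc m} A. (\<Prod>c\<in>{1..Suc m}. w c (f c) (f (c - 1))) * G (f (Suc m))) =
      (\<Sum>S\<in>A (Suc m). \<Sum>g\<in>PiE {0..m} A.
        (\<Prod>c\<in>{1..m}. w c (g c) (g (c - 1))) * (w (Suc m) S (g m) * G S))"
      unfolding split
    proof (intro sum.cong refl)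
      fix S and g :: "nat \<Rightarrow> 'b"
      have "(\<Prod>c\<in>{1..m}. w c ((g(Suc m := S)) c) ((g(Suc m := S)) (c - 1))) =
          (\<Prod>c\<in>{1..m}. w c (g c) (g (c - 1)))"
        by (intro prod.cong refl) auto
      then show "(\<Prod>c\<in>{1..Suc m}. w c ((g(Suc m := S)) c) ((g(Suc m := S)) (c - 1))) *
          G ((g(Suc m := S)) (Suc m)) =
        (\<Prod>c\<in>{1..m}. w c (g c) (g (c - 1))) * (w (Suc m) S (g m) * G S)"
        by (simp add: algebra_simps)
    qed
    also have "\<dots> = (\<Sum>S\<in>A (Suc m). \<Sum>S'\<in>A m. transfer A w m S' * (w (Suc m) S S' * G S))"
      by (intro sum.cong refl) (rule Suc.IH)
    finally show ?case
      by (simp add: sum_distrib_right sum_distrib_left algebra_simps)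
  qed
  from this[of "\<lambda>_. 1"] show ?thesis by simp
qed

context
  fixes x xi :: "nat \<Rightarrow> 'a::comm_ring_1" and t :: 'a
  assumes inverse: "\<And>i. x i * xi i = 1"
begin

lemma transfer_pair_form:
  assumes "S \<in> level_sets n (2 * k)"
  shows "transfer (level_sets n) (letter_wt x xi t n) (2 * k) S = pair_form x xi t k (desc basis n S)"
  using assms
proof (induction k arbitrary: S)
  case 0
  have "desc basis n {} = ([] :: 'a poly list)" by (induction n) auto
  with 0 show ?case by (auto simp: level_sets_def finite_subset)
next
  case (Suc k)
  let ?F = "pair_form x xi t k" and ?k = "Suc k"
  let ?b = "row_form (t * xi ?k) (1 + t) (t^2 * xi ?k)"
  let ?T = "transfer (level_sets n) (letter_wt x xi t n)"
  have odd_level: "level_sets n (Suc (2 * k)) = Pow {1..n}"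
    by (auto simp: level_sets_def)
  have card: "length (desc basis n S :: 'a poly list) = card S" if "S \<subseteq> {1..n}" for S
    using that by (simp add: length_desc inf_absorb1)
  have bar: "?T (Suc (2 * k)) S' = ?b ?F (desc basis n S')" for S'
  proof -
    have "?T (Suc (2 * k)) S' = (\<Sum>S''\<in>level_sets n (2 * k).
        row_wt (t * xi ?k) (1 + t) (t^2 * xi ?k) n 0 S' S'' * ?F (desc basis n S''))"
      by (simp add: letter_wt_def Suc.IH)
    \<comment> \<open>Sets of the wrong size may be added because the form vanishes outside degree
      k; the unrestricted sum is the one that \<open>row_sum_form\<close> evaluates.\<close>
    also have "\<dots> = (\<Sum>S''\<in>Pow {1..n}.
        row_wt (t * xi ?k) (1 + t) (t^2 * xi ?k) n 0 S' S'' * ?F (desc basis n S''))"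
      by (rule sum.mono_neutral_left)
        (auto simp: level_sets_def card pair_form_wrong_degree)
    also have "\<dots> = ?b ?F (desc basis n S')"
      by (rule row_sum_form[OF alternating_pair_form])
    finally show ?thesis .
  qed
  have "?T (2 * ?k) S = (\<Sum>S'\<in>Pow {1..n}.
        row_wt (x ?k) (1 + t) (x ?k) n 0 S S' * ?b ?F (desc basis n S'))"
    using bar by (simp add: odd_level letter_wt_def del: transfer.simps(2))
      (simp add: odd_level letter_wt_def)
  also have "\<dots> = row_form (x ?k) (1 + t) (x ?k) (?b ?F) (desc basis n S)"
    by (rule row_sum_form[OF row_form_alternating[OF alternating_pair_form]])
  also have "\<dots> = pair_form x xi t ?k (desc basis n S)"
    using Suc.prems
    by (subst row_form_pair[of k])
      (auto simp: pair_form_wrong_degree card level_sets_def pair_map_def[abs_def])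
  finally show ?case .
qed

lemma partition_function:
  "(\<Sum>f\<in>PiE {0..2*n} (level_sets n). \<Prod>c\<in>{1..2*n}. letter_wt x xi t n c (f c) (f (c - 1))) =
    (\<Prod>i\<in>{1..n}. x i + t * xi i) *
    (\<Prod>j\<in>{1..n}. \<Prod>i\<in>{1..<j}. x i + t^2 * xi i + t * (x j + xi j))"
proof -
  have "level_sets n (2 * n) = {{1..n}}"
    using card_subset_eq[of "{1..n}"] by (auto simp: level_sets_def)
  then show ?thesis
    using transfer_pair_form[of "{1..n}" n n] pair_form_staircase[OF inverse, where t = t and n = n]
    unfolding sum_paths by simp
qed

end

section \<open>The partition function as a sum over states\<close>

lemma prod_if_power:
  "finite A \<Longrightarrow> (\<Prod>x\<in>A. if P x then a else 1) = (a::'a::comm_monoid_mult) ^ card {x \<in> A. P x}"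
  by (simp add: prod.inter_filter[symmetric])

lemma card_pairs:
  assumes "finite A" "finite B"
  shows "card {(c, q) \<in> A \<times> B. P c q} = (\<Sum>c\<in>A. card {q \<in> B. P c q})"
proof -
  have "{(c, q) \<in> A \<times> B. P c q} = (SIGMA c:A. {q \<in> B. P c q})" by auto
  then show ?thesis using assms by simp
qed

lemma prod_pairs: "(\<Prod>c\<in>{1..2*n}. F c) = (\<Prod>k\<in>{1..n}. F (2*k-1) * F (2*k :: nat))"
  by (induction n) (simp_all add: mult.assoc)

lemma sum_pairs: "(\<Sum>c\<in>{1..2*n}. F c) = (\<Sum>k\<in>{1..n}. F (2*k-1) + F (2*k :: nat))"
  by (induction n) (simp_all add: add.assoc)

lemma card_Int_atLeast:
  "q \<le> n \<Longrightarrow> card (S \<inter> {q..n}) = of_bool (q \<in> S) + card (S \<inter> {Suc q..n})"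
proof -
  assume "q \<le> n"
  then have "{q..n} = insert q {Suc q..n}" by auto
  then show ?thesis by (cases "q \<in> S") auto
qed

lemma flow_step:
  "q \<le> n \<Longrightarrow> flow h n S S' q = flow h n S S' (Suc q) + of_bool (q \<in> S) - of_bool (q \<in> S')"
  by (simp add: flow_def card_Int_atLeast)

definition row_ok :: "nat \<Rightarrow> nat set \<Rightarrow> nat set \<Rightarrow> bool" where
  "row_ok n S S' \<longleftrightarrow> (\<forall>q\<in>{1..n}. flow 0 n S S' q \<in> {0, 1})"

text \<open>At the rightmost column whose left edge has an illegal state the right edge is still
  legal, so that vertex violates the ice rule and has weight 0.\<close>

lemma row_wt_not_ok:
  assumes "\<not> row_ok n S S'"
  shows "row_wt \<beta> \<gamma> r n 0 S S' = 0"
proof -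
  let ?Q = "{q\<in>{1..n}. flow 0 n S S' q \<notin> {0, 1}}"
  have fin: "finite ?Q" and ne: "?Q \<noteq> {}"
    using assms by (auto simp: row_ok_def)
  define q where "q = Max ?Q"
  have q: "q \<in> ?Q" unfolding q_def by (rule Max_in[OF fin ne])
  have "flow 0 n S S' (Suc q) \<in> {0, 1}"
  proof (cases "q = n")
    case False
    then have "Suc q \<notin> ?Q" using Max_ge[OF fin, of "Suc q"] unfolding q_def[symmetric] by auto
    then show ?thesis using q False by auto
  qed (simp add: flow_empty)
  then have "vertex_wt \<beta> \<gamma> r (q \<in> S) (q \<in> S') (flow 0 n S S' (Suc q)) = 0"
    using q flow_step[of q n 0 S S'] by (auto simp: vertex_wt_def split: if_splits)
  then show ?thesis
    unfolding row_wt_def using q by (intro prod_zero) auto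
qed

text \<open>Every occupied left edge gives \<open>\<beta>\<close>. The flag \<open>b\<close> tells
  which of the two vertices with both horizontal edges occupied carries the additional
  \<open>t\<close>: the one crossed by a vertical particle, or the one with empty vertical
  edges.\<close>

lemma row_wt_ok:
  assumes "row_ok n S S'"
    and b: "b \<and> \<gamma> * \<beta> - r = t * \<beta> \<and> r = \<beta> \<or> \<not> b \<and> \<gamma> * \<beta> - r = \<beta> \<and> r = t * \<beta>"
  shows "row_wt \<beta> \<gamma> r n 0 S S' =
    \<beta> ^ card {q\<in>{1..n}. flow 0 n S S' q = 1} *
    t ^ card {q\<in>{1..n}. flow 0 n S S' q = 1 \<and> flow 0 n S S' (Suc q) = 1 \<and> (b \<longleftrightarrow> q \<in> S')} *
    \<gamma> ^ card {q\<in>{1..n}. flow 0 n S S' q = 0 \<and> flow 0 n S S' (Suc q) = 1}"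
proof -
  have "vertex_wt \<beta> \<gamma> r (q \<in> S) (q \<in> S') (flow 0 n S S' (Suc q)) =
    (if flow 0 n S S' q = 1 then \<beta> else 1) *
    (if flow 0 n S S' q = 1 \<and> flow 0 n S S' (Suc q) = 1 \<and> (b \<longleftrightarrow> q \<in> S') then t else 1) *
    (if flow 0 n S S' q = 0 \<and> flow 0 n S S' (Suc q) = 1 then \<gamma> else 1)" if "q \<in> {1..n}" for q
  proof -
    have ok: "flow 0 n S S' q \<in> {0, 1}"
      using assms(1) that by (simp add: row_ok_def)
    have ok': "flow 0 n S S' (Suc q) \<in> {0, 1}"
      using assms(1) that by (cases "q = n") (simp_all add: flow_empty row_ok_def)
    show ?thesis
      using ok ok' flow_step[of q n 0 S S'] that b
      by (cases "q \<in> S"; cases "q \<in> S'"; elim disjE) (auto simp: vertex_wt_def mult.commute)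
  qed
  then show ?thesis
    unfolding row_wt_def by (simp add: prod.distrib prod_if_power)
qed

text \<open>The state of the edge left of column \<open>q\<close> in the row of level
  \<open>c\<close>; in the tableau, whether the letter of level \<open>c\<close> occurs on diagonal
  \<open>q\<close>.\<close>

definition occupied :: "nat \<Rightarrow> (nat \<Rightarrow> nat set) \<Rightarrow> nat \<Rightarrow> nat \<Rightarrow> bool" where
  "occupied n f c q \<longleftrightarrow> flow 0 n (f c) (f (c - 1)) q = 1"

definition states :: "nat \<Rightarrow> (nat \<Rightarrow> nat set) set" where
  "states n = {f \<in> PiE {0..2*n} (level_sets n). \<forall>c\<in>{1..2*n}. row_ok n (f c) (f (c - 1))}"

text \<open>The common local form of the positions counted by \<open>ssi\<close>, by
  \<open>ne_odd\<close> together with \<open>se_even\<close>, and of the adjacent boxes behind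
  \<open>var\<close>.\<close>

definition joined :: "nat \<Rightarrow> (nat \<Rightarrow> nat set) \<Rightarrow> nat \<Rightarrow> nat \<Rightarrow> bool" where
  "joined n f c q \<longleftrightarrow> occupied n f c q \<and> occupied n f c (Suc q) \<and> (even c \<longleftrightarrow> q \<in> f (c - 1))"

definition state_wt :: "nat \<Rightarrow> (nat \<Rightarrow> nat set) \<Rightarrow> laurent" where
  "state_wt n f =
    t_var ^ (card {(c, q) \<in> {1..2*n} \<times> {1..n}. joined n f c q} +
      card {(c, q) \<in> {1..2*n} \<times> {1..n}. odd c \<and> occupied n f c q}) *
    (1 + t_var) ^ card {(c, q) \<in> {1..2*n} \<times> {1..n}. \<not> occupied n f c q \<and> occupied n f c (Suc q)} *
    (\<Prod>k\<in>{1..n}. x_pow k (int (card {q\<in>{1..n}. occupied n f (2*k) q}) -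
      int (card {q\<in>{1..n}. occupied n f (2*k-1) q})))"

lemma x_pow_power: "x_pow i 1 ^ a = x_pow i (int a)" "x_pow i (-1) ^ a = x_pow i (- int a)"
proof -
  show "x_pow i 1 ^ a = x_pow i (int a)"
    by (induction a) (simp_all add: x_pow_add[symmetric])
  have "x_pow i (-1) ^ a = x_pow i (- int a)"
    by (induction a) (simp_all add: x_pow_add[symmetric])
  then show "x_pow i (-1) ^ a = x_pow i (- int a)" .
qed

lemma finite_PiE_level_sets: "finite (PiE {0..2*n} (level_sets n))"
  by (intro finite_PiE finite_subset[of "level_sets n _" "Pow {1..n}"]) (auto simp: level_sets_def)

lemma state_wt_eq:
  assumes "f \<in> states n"
  shows "(\<Prod>c\<in>{1..2*n}. letter_wt (\<lambda>i. x_pow i 1) (\<lambda>i. x_pow i (-1)) t_var n c (f c) (f (c - 1))) =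
    state_wt n f"
proof -
  let ?xi = "\<lambda>i. x_pow i (-1)"
  define R where "R c = card {q\<in>{1..n}. occupied n f c q}" for c
  define J where "J c = card {q\<in>{1..n}. joined n f c q}" for c
  define E where "E c = card {q\<in>{1..n}. \<not> occupied n f c q \<and> occupied n f c (Suc q)}" for c
  have ok: "row_ok n (f c) (f (c - 1))" if "c \<in> {1..2*n}" for c
    using assms that by (auto simp: states_def)
  have zero: "flow 0 n (f c) (f (c - 1)) q = 0 \<longleftrightarrow> \<not> occupied n f c q"
    if "c \<in> {1..2*n}" "q \<in> {1..n}" for c q
    using ok[OF that(1)] that(2) by (auto simp: row_ok_def occupied_def)
  have E: "E c = card {q\<in>{1..n}. flow 0 n (f c) (f (c - 1)) q = 0 \<and> flow 0 n (f c) (f (c - 1)) (Suc q) = 1}"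
    if "c \<in> {1..2*n}" for c
    unfolding E_def using zero[OF that] by (intro arg_cong[where f = card]) (auto simp: occupied_def)
  have even: "letter_wt (\<lambda>i. x_pow i 1) ?xi t_var n (2*k) (f (2*k)) (f (2*k-1)) =
      x_pow k 1 ^ R (2*k) * t_var ^ J (2*k) * (1 + t_var) ^ E (2*k)"
    if "k \<in> {1..n}" for k
    using that row_wt_ok[OF ok[of "2*k"], of True "1 + t_var" "x_pow k 1" "x_pow k 1" t_var]
    by (simp add: letter_wt_def R_def J_def E joined_def occupied_def algebra_simps)
  have odd': "letter_wt (\<lambda>i. x_pow i 1) ?xi t_var n c (f c) (f (c - 1)) =
      t_var ^ R c * ?xi (Suc c div 2) ^ R c * t_var ^ J c * (1 + t_var) ^ E c"
    if "c \<in> {1..2*n}" "odd c" for c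
    using that row_wt_ok[OF ok[of c], of False "1 + t_var" "t_var * ?xi (Suc c div 2)"
        "t_var^2 * ?xi (Suc c div 2)" t_var]
    by (simp add: letter_wt_def R_def J_def E joined_def occupied_def algebra_simps power2_eq_square
        power_mult_distrib)
  have odd: "letter_wt (\<lambda>i. x_pow i 1) ?xi t_var n (2*k-1) (f (2*k-1)) (f (2*k-1-1)) =
      t_var ^ R (2*k-1) * ?xi k ^ R (2*k-1) * t_var ^ J (2*k-1) * (1 + t_var) ^ E (2*k-1)"
    if "k \<in> {1..n}" for k
    using that odd'[of "2*k-1"] by fastforce
  have J': "card {(c, q) \<in> {1..2*n} \<times> {1..n}. joined n f c q} = (\<Sum>k\<in>{1..n}. J (2*k-1) + J (2*k))"
    unfolding card_pairs[OF finite_atLeastAtMost finite_atLeastAtMost] sum_pairs J_def ..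
  have E': "card {(c, q) \<in> {1..2*n} \<times> {1..n}. \<not> occupied n f c q \<and> occupied n f c (Suc q)} =
      (\<Sum>k\<in>{1..n}. E (2*k-1) + E (2*k))"
    unfolding card_pairs[OF finite_atLeastAtMost finite_atLeastAtMost] sum_pairs E_def ..
  have R': "card {(c, q) \<in> {1..2*n} \<times> {1..n}. odd c \<and> occupied n f c q} = (\<Sum>k\<in>{1..n}. R (2*k-1))"
    unfolding card_pairs[OF finite_atLeastAtMost finite_atLeastAtMost] sum_pairs
    by (intro sum.cong refl) (simp add: R_def)
  show ?thesis
    unfolding prod_pairs state_wt_def J' E' R' R_def[symmetric] power_add power_sum
      prod.distrib[symmetric]
  proof (rule prod.cong[OF refl])
    fix k assume k: "k \<in> {1..n}"
    have "x_pow k (int (R (2*k)) - int (R (2*k-1))) = x_pow k 1 ^ R (2*k) * ?xi k ^ R (2*k-1)"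
      by (simp add: x_pow_power x_pow_add[symmetric])
    then show "letter_wt (\<lambda>i. x_pow i 1) ?xi t_var n (2*k-1) (f (2*k-1)) (f (2*k-1-1)) *
        letter_wt (\<lambda>i. x_pow i 1) ?xi t_var n (2*k) (f (2*k)) (f (2*k-1)) =
      t_var ^ J (2*k-1) * t_var ^ J (2*k) * t_var ^ R (2*k-1) *
        ((1 + t_var) ^ E (2*k-1) * (1 + t_var) ^ E (2*k)) *
        x_pow k (int (R (2*k)) - int (R (2*k-1)))"
      unfolding even[OF k] odd[OF k] by (simp only: ac_simps)
  qed
qed

text \<open>x_i (1 + t x_j/x_i)(1 + t/(x_i x_j)) = x_i + t^2/x_i + t (x_j + 1/x_j). The pairs i < j
  use up x_i^(n-i), and the last x_i goes to 1 + t x_i^(-2).\<close>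

lemma D_sp_product:
  "D_sp n = (\<Prod>i\<in>{1..n}. x_pow i 1 + t_var * x_pow i (-1)) *
    (\<Prod>j\<in>{1..n}. \<Prod>i\<in>{1..<j}. x_pow i 1 + t_var^2 * x_pow i (-1) + t_var * (x_pow j 1 + x_pow j (-1)))"
proof -
  let ?F = "\<lambda>i j. x_pow i 1 + t_var^2 * x_pow i (-1) + t_var * (x_pow j 1 + x_pow j (-1))"
  have cancel: "x_pow i 1 * x_pow i (-1) = 1" "x_pow i 1 * x_pow i (-2) = x_pow i (-1)" for i
    by (simp_all add: x_pow_add[symmetric])
  have cancel': "x_pow i 1 * (x_pow i (-1) * a) = a" "x_pow i 1 * (x_pow i (-2) * a) = x_pow i (-1) * a"
    for i a
    by (simp_all add: mult.assoc[symmetric] cancel)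
  have expand: "a + t^2 * b + t * (c + d) = a * ((1 + t * b * c) * (1 + t * b * d))"
    if "a * b = 1" "c * d = 1" for a b c d t :: laurent
  proof -
    have "a * ((1 + t * b * c) * (1 + t * b * d)) =
        a + t * (a * b) * (c + d) + t^2 * b * (a * b) * (c * d)"
      by (simp add: algebra_simps power2_eq_square)
    then show ?thesis using that by simp
  qed
  have F: "?F i j = x_pow i 1 * ((1 + t_var * x_pow i (-1) * x_pow j 1) * (1 + t_var * x_pow i (-1) * x_pow j (-1)))"
    for i j
    by (rule expand[OF cancel(1) cancel(1)])
  have "(\<Prod>j\<in>{1..n}. \<Prod>i\<in>{1..<j}. ?F i j) = (\<Prod>j\<in>{1..n}. \<Prod>i\<in>{i\<in>{1..n}. i < j}. ?F i j)"
    by (intro prod.cong refl) auto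
  also have "\<dots> = (\<Prod>i\<in>{1..n}. \<Prod>j\<in>{j\<in>{1..n}. i < j}. ?F i j)"
    by (rule prod.swap_restrict) auto
  also have "\<dots> = (\<Prod>i\<in>{1..n}. \<Prod>j\<in>{i<..n}. ?F i j)"
    by (intro prod.cong refl) auto
  also have "\<dots> = (\<Prod>i\<in>{1..n}. x_pow i (int (n - i))) * (\<Prod>i\<in>{1..n}. \<Prod>j\<in>{i<..n}.
       (1 + t_var * x_pow i (-1) * x_pow j 1) * (1 + t_var * x_pow i (-1) * x_pow j (-1)))"
    by (simp only: F prod.distrib prod_constant card_greaterThanAtMost x_pow_power)
  finally have *: "(\<Prod>j\<in>{1..n}. \<Prod>i\<in>{1..<j}. ?F i j) =
     (\<Prod>i\<in>{1..n}. x_pow i (int (n - i))) * (\<Prod>i\<in>{1..n}. \<Prod>j\<in>{i<..n}.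
       (1 + t_var * x_pow i (-1) * x_pow j 1) * (1 + t_var * x_pow i (-1) * x_pow j (-1)))" .
  have **: "x_pow i 1 + t_var * x_pow i (-1) = x_pow i 1 * (1 + t_var * x_pow i (-2))" for i
    by (simp add: algebra_simps cancel cancel')
  have ***: "x_pow i (int (n - i + 1)) = x_pow i (int (n - i)) * x_pow i 1" for i
    by (simp add: x_pow_add[symmetric] add.commute)
  show ?thesis
    unfolding * ** D_sp_def *** prod.distrib by (simp add: ac_simps)
qed

lemma D_sp_states: "D_sp n = (\<Sum>f\<in>states n. state_wt n f)"
proof -
  let ?w = "letter_wt (\<lambda>i. x_pow i 1) (\<lambda>i. x_pow i (-1)) t_var n"
  have "D_sp n = (\<Sum>f\<in>PiE {0..2*n} (level_sets n). \<Prod>c\<in>{1..2*n}. ?w c (f c) (f (c - 1)))"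
    by (subst partition_function) (simp_all add: x_pow_add[symmetric] D_sp_product)
  also have "\<dots> = (\<Sum>f\<in>states n. \<Prod>c\<in>{1..2*n}. ?w c (f c) (f (c - 1)))"
  proof (rule sum.mono_neutral_right[OF finite_PiE_level_sets])
    show "\<forall>f\<in>PiE {0..2*n} (level_sets n) - states n. (\<Prod>c\<in>{1..2*n}. ?w c (f c) (f (c - 1))) = 0"
    proof
      fix f assume "f \<in> PiE {0..2*n} (level_sets n) - states n"
      then obtain c where c: "c \<in> {1..2*n}" "\<not> row_ok n (f c) (f (c - 1))"
        by (auto simp: states_def)
      then have "?w c (f c) (f (c - 1)) = 0"
        by (simp add: letter_wt_def row_wt_not_ok)
      then show "(\<Prod>c\<in>{1..2*n}. ?w c (f c) (f (c - 1))) = 0"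
        using c(1) by (intro prod_zero) auto
    qed
  qed (auto simp: states_def)
  also have "\<dots> = (\<Sum>f\<in>states n. state_wt n f)"
    by (intro sum.cong refl state_wt_eq)
  finally show ?thesis .
qed

section \<open>U-turn alternating sign matrices\<close>

text \<open>The partial sums starting at and just after the first non-zero entry both lie in {0, 1},
  so an entry 1 forces the sum 1 and an entry -1 the sum 0. A tail of zeros also has sum 0 and
  therefore sides with -1.\<close>

lemma next_nonzero:
  fixes b :: "nat \<Rightarrow> int"
  assumes "\<And>p. q < p \<Longrightarrow> p \<le> N \<Longrightarrow> (\<Sum>r\<in>{p..N}. b r) \<in> {0, 1}"
  shows "(\<exists>p\<in>{q<..N}. b p \<noteq> 0 \<and> b p = 1 \<and> (\<forall>r\<in>{q<..<p}. b r = 0)) \<longleftrightarrow>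
      (\<Sum>r\<in>{Suc q..N}. b r) = 1" (is "?A \<longleftrightarrow> _")
    and "(\<exists>p\<in>{q<..N}. b p \<noteq> 0 \<and> b p = -1 \<and> (\<forall>r\<in>{q<..<p}. b r = 0)) \<or> (\<forall>r\<in>{q<..N}. b r = 0) \<longleftrightarrow>
      (\<Sum>r\<in>{Suc q..N}. b r) = 0" (is "?B \<longleftrightarrow> _")
proof -
  have "(?A \<longleftrightarrow> (\<Sum>r\<in>{Suc q..N}. b r) = 1) \<and> (?B \<longleftrightarrow> (\<Sum>r\<in>{Suc q..N}. b r) = 0)"
  proof (cases "\<forall>r\<in>{q<..N}. b r = 0")
    case True
    then have "(\<Sum>r\<in>{Suc q..N}. b r) = 0" by (intro sum.neutral) auto
    then show ?thesis using True by fastforce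
  next
    case False
    define p where "p = (LEAST p. p \<in> {q<..N} \<and> b p \<noteq> 0)"
    have "\<exists>p. p \<in> {q<..N} \<and> b p \<noteq> 0" using False by blast
    from LeastI_ex[OF this] have p: "p \<in> {q<..N}" "b p \<noteq> 0"
      unfolding p_def[symmetric] by blast+
    have zero: "b r = 0" if "q < r" "r < p" for r
      using not_less_Least[of r "\<lambda>p. p \<in> {q<..N} \<and> b p \<noteq> 0"] that p(1) unfolding p_def[symmetric]
      by auto
    have uniq: "p' = p" if "p' \<in> {q<..N}" "b p' \<noteq> 0" "\<forall>r\<in>{q<..<p'}. b r = 0" for p'
    proof (rule ccontr)
      assume "p' \<noteq> p"
      then consider "p' < p" | "p < p'" by linarith
      then show False using that zero[of p'] p by cases auto
    qed
    have first: "(\<exists>p\<in>{q<..N}. b p \<noteq> 0 \<and> b p = e \<and> (\<forall>r\<in>{q<..<p}. b r = 0)) \<longleftrightarrow> b p = e" for e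
    proof
      assume "\<exists>p\<in>{q<..N}. b p \<noteq> 0 \<and> b p = e \<and> (\<forall>r\<in>{q<..<p}. b r = 0)"
      then show "b p = e" using uniq by blast
    next
      assume "b p = e"
      then show "\<exists>p\<in>{q<..N}. b p \<noteq> 0 \<and> b p = e \<and> (\<forall>r\<in>{q<..<p}. b r = 0)"
        using p zero by (intro bexI[of _ p]) auto
    qed
    have "(\<Sum>r\<in>{Suc q..N}. b r) = (\<Sum>r\<in>{p..N}. b r)"
      by (rule sum.mono_neutral_right) (use p zero in auto)
    moreover have "(\<Sum>r\<in>{p..N}. b r) = b p + (\<Sum>r\<in>{Suc p..N}. b r)"
      using p by (intro sum.atLeast_Suc_atMost) auto
    moreover have "(\<Sum>r\<in>{p..N}. b r) \<in> {0, 1}"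
      using assms[of p] p by auto
    moreover have "(\<Sum>r\<in>{Suc p..N}. b r) \<in> {0, 1}"
      using assms[of "Suc p"] p by (cases "p = N") auto
    ultimately show ?thesis
      using p(2) False unfolding first by auto
  qed
  then show "?A \<longleftrightarrow> (\<Sum>r\<in>{Suc q..N}. b r) = 1" "?B \<longleftrightarrow> (\<Sum>r\<in>{Suc q..N}. b r) = 0" by auto
qed

lemma int_card_Int:
  "int (card (S \<inter> {p..n :: nat})) = (\<Sum>q\<in>{p..n}. of_bool (q \<in> S))"
  by (simp add: sum_of_bool_eq Int_commute)

lemma flow_sum: "flow 0 n S S' p = (\<Sum>q\<in>{p..n}. of_bool (q \<in> S) - of_bool (q \<in> S'))"
  by (simp add: flow_def int_card_Int sum_subtractf)

lemma statesD:
  assumes "f \<in> states n"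
  shows "f 0 = {}" "\<And>c. c \<le> 2 * n \<Longrightarrow> f c \<subseteq> {1..n}" "\<And>k. k \<le> n \<Longrightarrow> card (f (2 * k)) = k"
    "f (2 * n) = {1..n}" "\<And>c. 2 * n < c \<Longrightarrow> f c = undefined"
    "\<And>c q. 1 \<le> c \<Longrightarrow> c \<le> 2 * n \<Longrightarrow> 1 \<le> q \<Longrightarrow> q \<le> Suc n \<Longrightarrow>
      flow 0 n (f c) (f (c - 1)) q = of_bool (occupied n f c q)"
proof -
  show sub: "f c \<subseteq> {1..n}" if "c \<le> 2 * n" for c
    using assms that by (fastforce simp: states_def level_sets_def PiE_def Pi_def)
  show card: "card (f (2 * k)) = k" if "k \<le> n" for k
    using assms that by (fastforce simp: states_def level_sets_def PiE_def Pi_def)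
  show "f 0 = {}"
    using card[of 0] sub[of 0] finite_subset[of "f 0" "{1..n}"] by simp
  show "f (2 * n) = {1..n}"
    using card[of n] sub[of "2 * n"] card_subset_eq[of "{1..n}"] by simp
  show "f c = undefined" if "2 * n < c" for c
    using assms that by (auto simp: states_def PiE_def extensional_def)
  show "flow 0 n (f c) (f (c - 1)) q = of_bool (occupied n f c q)"
    if "1 \<le> c" "c \<le> 2 * n" "1 \<le> q" "q \<le> Suc n" for c q
  proof (cases "q = Suc n")
    case False
    then have "flow 0 n (f c) (f (c - 1)) q \<in> {0, 1}"
      using assms that by (auto simp: states_def row_ok_def)
    then show ?thesis by (auto simp: occupied_def)
  qed (simp add: occupied_def flow_empty)
qed

lemma statesI:
  assumes "\<And>c. c \<le> 2*n \<Longrightarrow> f c \<subseteq> {1..n}" "\<And>k. k \<le> n \<Longrightarrow> card (f (2*k)) = k"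
    "\<And>c. 2*n < c \<Longrightarrow> f c = undefined" "\<And>c. c \<in> {1..2*n} \<Longrightarrow> row_ok n (f c) (f (c - 1))"
  shows "f \<in> states n"
proof -
  have "f c \<in> level_sets n c" if "c \<le> 2*n" for c
    using assms(1)[OF that] assms(2) that by (auto simp: level_sets_def elim!: evenE)
  then show ?thesis
    using assms(3,4) unfolding states_def by (auto intro!: PiE_I)
qed

text \<open>Particle conservation at a single vertex, the form in which the bijections use the ice
  rule.\<close>

lemma states_step:
  assumes "f \<in> states n" "1 \<le> c" "c \<le> 2*n" "q \<in> {1..n}"
  shows "of_bool (occupied n f c q) =
    of_bool (occupied n f c (Suc q)) + of_bool (q \<in> f c) - (of_bool (q \<in> f (c - 1)) :: int)"
  using flow_step[of q n 0 "f c" "f (c - 1)"] statesD(6)[OF assms(1-3), of q]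
    statesD(6)[OF assms(1-3), of "Suc q"] assms(4) by simp

text \<open>Levels count rows from the bottom, so matrix row i is the row of level 2n + 1 - i,
  between the states of levels 2n + 1 - i and 2n - i.\<close>

definition ua_of :: "nat \<Rightarrow> (nat \<Rightarrow> nat set) \<Rightarrow> nat \<times> nat \<Rightarrow> int" where
  "ua_of n f = restrict (\<lambda>(i, q). of_bool (q \<in> f (2*n + 1 - i)) - of_bool (q \<in> f (2*n - i)))
     ({1..2*n} \<times> {1..n})"

definition state_of_ua :: "nat \<Rightarrow> (nat \<times> nat \<Rightarrow> int) \<Rightarrow> nat \<Rightarrow> nat set" where
  "state_of_ua n a = restrict (\<lambda>c. {q \<in> {1..n}. (\<Sum>i\<in>{2*n + 1 - c..2*n}. a (i, q)) = 1}) {0..2*n}"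

lemma ua_of_eq:
  "i \<in> {1..2*n} \<Longrightarrow> q \<in> {1..n} \<Longrightarrow>
    ua_of n f (i, q) = of_bool (q \<in> f (2*n + 1 - i)) - of_bool (q \<in> f (2*n - i))"
  by (simp add: ua_of_def)

lemma ua_of_column_sum:
  assumes "f 0 = {}" "q \<in> {1..n}" "1 \<le> j" "j \<le> 2*n + 1"
  shows "(\<Sum>i\<in>{j..2*n}. ua_of n f (i, q)) = of_bool (q \<in> f (2*n + 1 - j))"
  using assms(4,3)
proof (induction j rule: inc_induct)
  case base
  then show ?case by (simp add: assms)
next
  case (step j)
  then have "(\<Sum>i\<in>{j..2*n}. ua_of n f (i, q)) =
      ua_of n f (j, q) + (\<Sum>i\<in>{Suc j..2*n}. ua_of n f (i, q))"
    by (intro sum.atLeast_Suc_atMost) auto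
  then show ?case
    using step assms(2) by (simp add: ua_of_eq)
qed

lemma ua_of_row_sum:
  assumes "i \<in> {1..2*n}" "1 \<le> p"
  shows "(\<Sum>q\<in>{p..n}. ua_of n f (i, q)) = flow 0 n (f (2*n + 1 - i)) (f (2*n + 1 - i - 1)) p"
  unfolding flow_sum using assms by (intro sum.cong refl) (auto simp: ua_of_eq)

lemma card_eq_flow_sum: "S \<subseteq> {1..n::nat} \<Longrightarrow> int (card S) = (\<Sum>q\<in>{1..n}. of_bool (q \<in> S))"
  using int_card_Int[of S 1 n] by (simp add: inf_absorb1)

lemma ua_of_in_UA:
  assumes "f \<in> states n"
  shows "ua_of n f \<in> UA n"
proof -
  note f = statesD[OF assms]
  have row: "(\<Sum>q\<in>{p..n}. ua_of n f (i, q)) \<in> {0, 1}" if "i \<in> {1..2*n}" "p \<in> {1..n}" for i p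
    using that f(6)[of "2*n + 1 - i" p] by (subst ua_of_row_sum) auto
  have col: "(\<Sum>i\<in>{j..2*n}. ua_of n f (i, q)) \<in> {0, 1}" if "j \<in> {1..2*n}" "q \<in> {1..n}" for j q
    using that f(1) by (subst ua_of_column_sum) auto
  have col1: "(\<Sum>i\<in>{1..2*n}. ua_of n f (i, q)) = 1" if "q \<in> {1..n}" for q
    using that f(1,4) by (subst ua_of_column_sum) auto
  \<comment> \<open>The two rows of a U-turn telescope: the odd level cancels, leaving the growth in
    size from one even level to the next.\<close>
  have turn: "(\<Sum>q\<in>{1..n}. ua_of n f (2*i-1, q) + ua_of n f (2*i, q)) = 1" if "i \<in> {1..n}" for i
  proof -
    have "(\<Sum>q\<in>{1..n}. ua_of n f (2*i-1, q) + ua_of n f (2*i, q)) =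
      (\<Sum>q\<in>{1..n}. of_bool (q \<in> f (2 * (n + 1 - i))) - of_bool (q \<in> f (2 * (n - i))))"
    proof (rule sum.cong[OF refl])
      fix q assume "q \<in> {1..n}"
      moreover have "2*n + 1 - (2*i-1) = 2 * (n + 1 - i)" "2*n - (2*i-1) = 2*n + 1 - 2*i"
        "2*n - 2*i = 2 * (n - i)"
        using that by auto
      ultimately show "ua_of n f (2*i-1, q) + ua_of n f (2*i, q) =
          of_bool (q \<in> f (2 * (n + 1 - i))) - of_bool (q \<in> f (2 * (n - i)))"
        using that by (subst (1 2) ua_of_eq) auto
    qed
    also have "\<dots> = int (card (f (2 * (n + 1 - i)))) - int (card (f (2 * (n - i))))"
    proof -
      have "2 * (n + 1 - i) \<le> 2*n" "2 * (n - i) \<le> 2*n" using that by auto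
      then show ?thesis
        using card_eq_flow_sum[OF f(2), symmetric] by (simp only: sum_subtractf)
    qed
    also have "\<dots> = 1"
      using that f(3)[of "n + 1 - i"] f(3)[of "n - i"] by auto
    finally show ?thesis .
  qed
  have "ua_of n f \<in> {1..2*n} \<times> {1..n} \<rightarrow>\<^sub>E {-1, 0, 1}"
    by (auto simp: ua_of_def of_bool_def split: if_splits)
  then show ?thesis
    unfolding UA_def using row col col1 turn by blast
qed

lemma UA_column_sum:
  "a \<in> UA n \<Longrightarrow> j \<in> {1..2*n} \<Longrightarrow> q \<in> {1..n} \<Longrightarrow> (\<Sum>i\<in>{j..2*n}. a (i, q)) \<in> {0, 1}"
  unfolding UA_def by blast

lemma state_of_ua_member:
  assumes "a \<in> UA n" "c \<le> 2*n" "q \<in> {1..n}"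
  shows "of_bool (q \<in> state_of_ua n a c) = (\<Sum>i\<in>{2*n + 1 - c..2*n}. a (i, q))"
\<comment> \<open>Level 0 is the empty column sum; the column condition on the matrix speaks of
  nonempty ranges only.\<close>
proof (cases "c = 0")
  case False
  then have "(\<Sum>i\<in>{2*n + 1 - c..2*n}. a (i, q)) \<in> {0, 1}"
    using assms by (intro UA_column_sum) auto
  then show ?thesis
    using assms by (auto simp: state_of_ua_def)
qed (use assms in \<open>simp add: state_of_ua_def\<close>)

lemma state_of_ua_entry:
  assumes "a \<in> UA n" "i \<in> {1..2*n}" "q \<in> {1..n}"
  shows "of_bool (q \<in> state_of_ua n a (2*n + 1 - i)) - of_bool (q \<in> state_of_ua n a (2*n - i)) = a (i, q)"
proof -
  have "(\<Sum>i\<in>{i..2*n}. a (i, q)) = a (i, q) + (\<Sum>i\<in>{Suc i..2*n}. a (i, q))"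
    using assms by (intro sum.atLeast_Suc_atMost) auto
  moreover have "2*n + 1 - (2*n + 1 - i) = i" "2*n + 1 - (2*n - i) = Suc i"
      "2*n + 1 - i \<le> 2*n" "2*n - i \<le> 2*n"
    using assms by auto
  ultimately show ?thesis
    using state_of_ua_member[OF assms(1), of "2*n + 1 - i" q]
      state_of_ua_member[OF assms(1), of "2*n - i" q] assms(3) by (simp only:)
qed

lemma state_of_ua_in_states:
  assumes "a \<in> UA n"
  shows "state_of_ua n a \<in> states n"
proof -
  let ?f = "state_of_ua n a"
  have sub: "?f c \<subseteq> {1..n}" if "c \<le> 2*n" for c
    using that by (auto simp: state_of_ua_def)
  have card: "card (?f (2*k)) = k" if "k \<le> n" for k
    using that
  proof (induction k)
    case 0
    then show ?case by (simp add: state_of_ua_def)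
  next
    case (Suc k)
    define i where "i = n - k"
    have i: "i \<in> {1..n}" "2 * Suc k = 2*n + 1 - (2*i-1)" "2*k + 1 = 2*n - (2*i-1)"
      "2*k + 1 = 2*n + 1 - 2*i" "2*k = 2*n - 2*i"
      using Suc.prems by (auto simp: i_def)
    have "int (card (?f (2 * Suc k))) - int (card (?f (2*k))) =
        (\<Sum>q\<in>{1..n}. of_bool (q \<in> ?f (2 * Suc k)) - of_bool (q \<in> ?f (2*k+1))) +
        (\<Sum>q\<in>{1..n}. of_bool (q \<in> ?f (2*k+1)) - of_bool (q \<in> ?f (2*k)))"
      using Suc.prems by (simp add: card_eq_flow_sum[OF sub] sum_subtractf)
    also have "(\<Sum>q\<in>{1..n}. of_bool (q \<in> ?f (2 * Suc k)) - of_bool (q \<in> ?f (2*k+1))) =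
        (\<Sum>q\<in>{1..n}. a (2*i-1, q))"
      unfolding i(2,3) using i(1) by (intro sum.cong refl state_of_ua_entry assms) auto
    also have "(\<Sum>q\<in>{1..n}. of_bool (q \<in> ?f (2*k+1)) - of_bool (q \<in> ?f (2*k))) =
        (\<Sum>q\<in>{1..n}. a (2*i, q))"
    proof (rule sum.cong[OF refl])
      fix q assume "q \<in> {1..n}"
      then show "of_bool (q \<in> ?f (2*k+1)) - of_bool (q \<in> ?f (2*k)) = a (2*i, q)"
        using state_of_ua_entry[OF assms, of "2*i" q] i(1)
        unfolding i(4)[symmetric] i(5)[symmetric] by simp
    qed
    also have "(\<Sum>q\<in>{1..n}. a (2*i-1, q)) + (\<Sum>q\<in>{1..n}. a (2*i, q)) = 1"
      using assms i(1) by (simp add: UA_def sum.distrib[symmetric])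
    finally show ?case using Suc by simp
  qed
  have "row_ok n (?f c) (?f (c - 1))" if "c \<in> {1..2*n}" for c
    unfolding row_ok_def
  proof
    fix p assume p: "p \<in> {1..n}"
    define i where "i = 2*n + 1 - c"
    have i: "i \<in> {1..2*n}" "c = 2*n + 1 - i" "c - 1 = 2*n - i"
      using that by (auto simp: i_def)
    have "flow 0 n (?f c) (?f (c - 1)) p = (\<Sum>q\<in>{p..n}. a (i, q))"
      unfolding flow_sum
    proof (rule sum.cong[OF refl])
      fix q assume "q \<in> {p..n}"
      then show "of_bool (q \<in> ?f c) - of_bool (q \<in> ?f (c - 1)) = a (i, q)"
        using state_of_ua_entry[OF assms i(1), of q] p unfolding i(2)[symmetric] i(3)[symmetric]
        by simp
    qed
    then show "flow 0 n (?f c) (?f (c - 1)) p \<in> {0, 1}"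
      using assms i(1) p by (simp add: UA_def)
  qed
  then show ?thesis
    using sub card by (intro statesI) (simp_all add: state_of_ua_def)
qed

lemma state_of_ua_of:
  assumes "f \<in> states n"
  shows "state_of_ua n (ua_of n f) = f"
proof
  fix c
  show "state_of_ua n (ua_of n f) c = f c"
  proof (cases "c \<le> 2*n")
    case True
    then have "(\<Sum>i\<in>{2*n + 1 - c..2*n}. ua_of n f (i, q)) = of_bool (q \<in> f c)" if "q \<in> {1..n}" for q
      using that ua_of_column_sum[of f q n "2*n + 1 - c"] statesD(1)[OF assms] by auto
    then have "state_of_ua n (ua_of n f) c = {q \<in> {1..n}. q \<in> f c}"
      using True by (auto simp: state_of_ua_def)
    then show ?thesis using statesD(2)[OF assms True] by auto
  qed (simp add: state_of_ua_def statesD(5)[OF assms])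
qed

lemma ua_of_state_of_ua:
  assumes "a \<in> UA n"
  shows "ua_of n (state_of_ua n a) = a"
proof
  fix p :: "nat \<times> nat"
  obtain i q where p: "p = (i, q)" by (cases p)
  show "ua_of n (state_of_ua n a) p = a p"
  proof (cases "p \<in> {1..2*n} \<times> {1..n}")
    case True
    then show ?thesis
      using state_of_ua_entry[OF assms, of i q] by (simp add: p ua_of_eq)
  next
    case False
    then show ?thesis
      using assms PiE_arb[of a "{1..2*n} \<times> {1..n}" "\<lambda>_. {-1, 0, 1}" p]
      unfolding UA_def ua_of_def by simp
  qed
qed

lemma card_reflect:
  fixes n :: nat and P :: "nat \<Rightarrow> nat \<Rightarrow> bool"
  shows "card {(i, q) \<in> {1..2*n} \<times> {1..n}. P (2*n + 1 - i) q} = card {(c, q) \<in> {1..2*n} \<times> {1..n}. P c q}"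
  by (intro bij_betw_same_card[of "\<lambda>(i, q). (2*n + 1 - i, q)"]
      bij_betw_byWitness[where f' = "\<lambda>(i, q). (2*n + 1 - i, q)"]) auto

lemma UA_wt:
  assumes "f \<in> states n"
  defines "a \<equiv> ua_of n f"
  shows "t_var ^ (ssi n a + bar_UA n a) * (1 + t_var) ^ neg n a * xwgt_UA n a = state_wt n f"
proof -
  note f = statesD[OF assms(1)]
  have row: "(\<Sum>q\<in>{p..n}. a (i, q)) = of_bool (occupied n f (2*n + 1 - i) p)"
    if "i \<in> {1..2*n}" "1 \<le> p" "p \<le> Suc n" for i p
    using that f(6)[of "2*n + 1 - i" p] by (simp add: a_def ua_of_row_sum del: atLeastAtMost_iff) auto
  have col: "(\<Sum>i\<in>{j..2*n}. a (i, q)) = of_bool (q \<in> f (2*n + 1 - j))"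
    if "1 \<le> j" "j \<le> 2*n + 1" "q \<in> {1..n}" for j q
    using that f(1) by (simp add: a_def ua_of_column_sum)
  \<comment> \<open>An entry is also a difference of row partial sums. In this form -1 means an
    empty left edge and an occupied right edge.\<close>
  have entry: "a (i, q) = of_bool (occupied n f (2*n + 1 - i) q) - of_bool (occupied n f (2*n + 1 - i) (Suc q))"
    if "i \<in> {1..2*n}" "q \<in> {1..n}" for i q
    using that row[of i q] row[of i "Suc q"] sum.atLeast_Suc_atMost[of q n "\<lambda>q. a (i, q)"] by auto
  have right: "next_right n a i q 1 \<longleftrightarrow> occupied n f (2*n + 1 - i) (Suc q)"
    if "i \<in> {1..2*n}" "q \<in> {1..n}" for i q
    unfolding next_right_def using that row
    by (subst next_nonzero(1)) auto
  have below: "next_below n a i q 1 \<longleftrightarrow> q \<in> f (2*n + 1 - i - 1)"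
    "next_below n a i q (-1) \<or> (\<forall>r\<in>{i<..2*n}. a (r, q) = 0) \<longleftrightarrow> q \<notin> f (2*n + 1 - i - 1)"
    if "i \<in> {1..2*n}" "q \<in> {1..n}" for i q
  proof -
    have ok: "(\<Sum>r\<in>{p..2*n}. a (r, q)) \<in> {0, 1}" if "i < p" "p \<le> 2*n" for p
      using that \<open>q \<in> {1..n}\<close> by (simp add: col)
    have s: "(\<Sum>r\<in>{Suc i..2*n}. a (r, q)) = of_bool (q \<in> f (2*n + 1 - i - 1))"
      using that by (subst col) auto
    show "next_below n a i q 1 \<longleftrightarrow> q \<in> f (2*n + 1 - i - 1)"
      "next_below n a i q (-1) \<or> (\<forall>r\<in>{i<..2*n}. a (r, q) = 0) \<longleftrightarrow> q \<notin> f (2*n + 1 - i - 1)"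
      unfolding next_below_def
      using next_nonzero[of i "2*n" "\<lambda>r. a (r, q)", OF ok] s by simp_all
  qed
  have pz: "pos_zero n a i q \<longleftrightarrow> occupied n f (2*n + 1 - i) q \<and> occupied n f (2*n + 1 - i) (Suc q)"
    if "i \<in> {1..2*n}" "q \<in> {1..n}" for i q
    unfolding pos_zero_def right[OF that] entry[OF that] by auto
  have box: "a (i, q) = 1 \<or> pos_zero n a i q \<longleftrightarrow> occupied n f (2*n + 1 - i) q"
    if "i \<in> {1..2*n}" "q \<in> {1..n}" for i q
    unfolding pz[OF that] entry[OF that] by auto
  have par: "even i \<longleftrightarrow> odd (2*n + 1 - i)" if "i \<in> {1..2*n}" for i
    using that by auto
  have neg: "neg n a = card {(c, q) \<in> {1..2*n} \<times> {1..n}. \<not> occupied n f c q \<and> occupied n f c (Suc q)}"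
    unfolding neg_def card_reflect[of n "\<lambda>c q. \<not> occupied n f c q \<and> occupied n f c (Suc q)", symmetric]
    by (intro arg_cong[where f = card]) (auto simp: entry of_bool_def split: if_splits)
  have bar: "bar_UA n a = card {(c, q) \<in> {1..2*n} \<times> {1..n}. odd c \<and> occupied n f c q}"
    unfolding bar_UA_def card_reflect[of n "\<lambda>c q. odd c \<and> occupied n f c q", symmetric]
    using box par by (intro arg_cong[where f = card]) blast
  have ssi: "ssi n a = card {(c, q) \<in> {1..2*n} \<times> {1..n}. joined n f c q}"
  proof -
    have "ssi n a = card {(i, q) \<in> {1..2*n} \<times> {1..n}. joined n f (2*n + 1 - i) q}"
      unfolding ssi_def joined_def
      using pz below par by (intro arg_cong[where f = card]) blast
    then show ?thesis by (simp only: card_reflect)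
  qed
  have "m_UA n a (Unbar k) = card {q\<in>{1..n}. occupied n f (2*k) q}"
    "m_UA n a (Bar k) = card {q\<in>{1..n}. occupied n f (2*k-1) q}" if "k \<in> {1..n}" for k
  proof -
    have "2*n + 1 - (2*n + 1 - 2*k) = 2*k" "2*n + 1 - (2*n + 2 - 2*k) = 2*k-1"
      "2*n + 1 - 2*k \<in> {1..2*n}" "2*n + 2 - 2*k \<in> {1..2*n}"
      using that by auto
    then show "m_UA n a (Unbar k) = card {q\<in>{1..n}. occupied n f (2*k) q}"
      "m_UA n a (Bar k) = card {q\<in>{1..n}. occupied n f (2*k-1) q}"
      unfolding m_UA_def row_count_UA_def
      using box[of "2*n + 1 - 2*k"] box[of "2*n + 2 - 2*k"]
      by (auto intro!: arg_cong[where f = card] simp del: atLeastAtMost_iff)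
  qed
  then show ?thesis
    unfolding state_wt_def xwgt_UA_def ssi bar neg by simp
qed

lemma sum_UA:
  "(\<Sum>a\<in>UA n. t_var ^ (ssi n a + bar_UA n a) * (1 + t_var) ^ neg n a * xwgt_UA n a) =
    (\<Sum>f\<in>states n. state_wt n f)"
  by (rule sum.reindex_bij_witness[of _ "ua_of n" "state_of_ua n"])
    (auto simp: ua_of_in_UA state_of_ua_in_states state_of_ua_of ua_of_state_of_ua UA_wt[symmetric])

section \<open>U-turn square ice\<close>

lemma UNIV_side: "(UNIV :: side set) = {Up, Down, Left, Right}"
proof -
  have "d \<in> {Up, Down, Left, Right}" for d by (cases d) auto
  then show ?thesis by auto
qed

lemma incoming_simps:
  "Up \<in> incoming (v, h) (i, q) \<longleftrightarrow> v (i - 1) q" "Down \<in> incoming (v, h) (i, q) \<longleftrightarrow> \<not> v i q"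
  "Left \<in> incoming (v, h) (i, q) \<longleftrightarrow> h i (q - 1)" "Right \<in> incoming (v, h) (i, q) \<longleftrightarrow> \<not> h i q"
  by (simp_all add: incoming_def)

lemma card_sides:
  "card (X :: side set) =
    of_bool (Up \<in> X) + of_bool (Down \<in> X) + of_bool (Left \<in> X) + of_bool (Right \<in> X)"
proof -
  have fin: "finite (UNIV :: side set)" by (simp add: UNIV_side)
  have "card X = (\<Sum>d\<in>UNIV. of_bool (d \<in> X))"
    by (simp add: fin)
  then show ?thesis by (simp add: UNIV_side)
qed

lemma side_set_eq_iff:
  "X = Y \<longleftrightarrow> (Up \<in> X \<longleftrightarrow> Up \<in> Y) \<and> (Down \<in> X \<longleftrightarrow> Down \<in> Y) \<and> (Left \<in> X \<longleftrightarrow> Left \<in> Y) \<and>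
    (Right \<in> X \<longleftrightarrow> Right \<in> Y)"
  (is "_ \<longleftrightarrow> ?R")
proof
  assume ?R
  then have "d \<in> X \<longleftrightarrow> d \<in> Y" for d by (cases d) auto
  then show "X = Y" by auto
qed simp

text \<open>Two of four edges being incoming is conservation of particles once edges pointing right
  or up are regarded as occupied.\<close>

lemma ice_rule_iff:
  "card (incoming (v, h) (i, q)) = 2 \<and> card (outgoing (v, h) (i, q)) = 2 \<longleftrightarrow>
    of_bool (h i (q - 1)) = of_bool (h i q) + of_bool (\<not> v (i - 1) q) - (of_bool (\<not> v i q) :: int)"
  unfolding card_sides outgoing_def by (auto simp: incoming_simps)

lemma ice_type_eq:
  "ice_type (v, h) (i, q) =
    (if h i (q - 1) then
       if \<not> h i q \<and> \<not> v (i - 1) q \<and> v i q then WE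
       else if h i q \<and> \<not> v (i - 1) q \<and> \<not> v i q then NE else SE
     else if h i q \<and> v (i - 1) q \<and> \<not> v i q then NS
       else if \<not> h i q \<and> v (i - 1) q \<and> v i q then SW
       else if \<not> h i q \<and> \<not> v (i - 1) q \<and> \<not> v i q then NW else SE)"
  unfolding ice_type_def outgoing_def side_set_eq_iff by (auto simp: incoming_simps)

text \<open>Occupied edges point up or right. The vertical edges below row i form level 2n - i, and
  the horizontal edge right of column q is the one left of column q + 1.\<close>

definition orientation_of :: "nat \<Rightarrow> (nat \<Rightarrow> nat set) \<Rightarrow> orientation" where
  "orientation_of n f = (\<lambda>i q. q \<notin> f (2*n - i), \<lambda>i q. occupied n f (2*n + 1 - i) (Suc q))"

definition cm_of :: "nat \<Rightarrow> (nat \<Rightarrow> nat set) \<Rightarrow> nat \<times> nat \<Rightarrow> ice" where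
  "cm_of n f = restrict (ice_type (orientation_of n f)) ({1..2*n} \<times> {1..n})"

text \<open>WE, NE and NW are the vertices whose top edge is outgoing. Level 0 lies below the last
  row, where all edges point down, and has no row to be read from.\<close>

definition state_of_cm :: "nat \<Rightarrow> (nat \<times> nat \<Rightarrow> ice) \<Rightarrow> nat \<Rightarrow> nat set" where
  "state_of_cm n C = restrict
     (\<lambda>c. {q \<in> {1..n}. c \<noteq> 0 \<and> C (2*n + 1 - c, q) \<in> {WE, NE, NW}}) {0..2*n}"

text \<open>The growth in size over a letter pair is the number of its occupied left boundary edges;
  growth by one is the U-turn condition.\<close>

lemma card_pair_flow:
  assumes "f 0 = {}" "\<And>c. c \<le> 2*n \<Longrightarrow> f c \<subseteq> {1..n}" "k < n"
  shows "int (card (f (2 * Suc k))) - int (card (f (2*k))) =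
    flow 0 n (f (2*k+2)) (f (2*k+1)) 1 + flow 0 n (f (2*k+1)) (f (2*k)) 1"
  using assms(2)[of "2*k+2"] assms(2)[of "2*k"] assms(3) by (simp add: flow_def inf_absorb1)

lemma orientation_of_ice:
  assumes "f \<in> states n"
  shows "ice_orientation n (orientation_of n f)"
proof -
  note f = statesD[OF assms]
  \<comment> \<open>Stated with \<open>Suc (q - 1)\<close> and double negations because this is
    literally what \<open>ice_rule_iff\<close> yields for this orientation.\<close>
  have vertex: "of_bool (occupied n f (2*n + 1 - i) (Suc (q - 1))) = of_bool (occupied n f (2*n + 1 - i) (Suc q)) +
      of_bool (\<not> q \<notin> f (2*n - (i - 1))) - (of_bool (\<not> q \<notin> f (2*n - i)) :: int)"
    if "i \<in> {1..2*n}" "q \<in> {1..n}" for i q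
  proof -
    have i: "2*n + 1 - i - 1 = 2*n - i" "2*n - (i - 1) = 2*n + 1 - i" "2*n + 1 - i \<le> 2*n"
      "1 \<le> 2*n + 1 - i"
      using that by auto
    show ?thesis
      using states_step[OF assms(1) i(4,3), of q] that unfolding i by simp
  qed
  have right: "\<not> occupied n f c (Suc n)" for c
    by (simp add: occupied_def flow_empty)
  have turn: "occupied n f (2*n + 1 - (2*i-1)) 1 \<longleftrightarrow> \<not> occupied n f (2*n + 1 - 2*i) 1" if "i \<in> {1..n}" for i
  proof -
    define k where "k = n - i"
    have k: "2*n + 1 - (2*i-1) = 2*k+2" "2*n + 1 - 2*i = 2*k+1" "k < n"
      using that by (auto simp: k_def)
    show ?thesis
      using card_pair_flow[of f n k, OF f(1,2) k(3)] f(3)[of k] f(3)[of "Suc k"] k(3)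
        f(6)[of "2*k+2" 1] f(6)[of "2*k+1" 1]
      unfolding k by (auto simp: of_bool_def split: if_splits)
  qed
  show ?thesis
    unfolding ice_orientation_def orientation_of_def
  proof (intro conjI ballI)
    fix p assume "p \<in> {1..2*n} \<times> {1..n}"
    then obtain i q where p: "p = (i, q)" "i \<in> {1..2*n}" "q \<in> {1..n}" by auto
    have "card (incoming (\<lambda>i q. q \<notin> f (2*n - i), \<lambda>i q. occupied n f (2*n + 1 - i) (Suc q)) p) = 2 \<and>
      card (outgoing (\<lambda>i q. q \<notin> f (2*n - i), \<lambda>i q. occupied n f (2*n + 1 - i) (Suc q)) p) = 2"
      unfolding p(1) ice_rule_iff by (rule vertex[OF p(2,3)])
    then show "card (incoming (\<lambda>i q. q \<notin> f (2*n - i), \<lambda>i q. occupied n f (2*n + 1 - i) (Suc q)) p) = 2"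
      "card (outgoing (\<lambda>i q. q \<notin> f (2*n - i), \<lambda>i q. occupied n f (2*n + 1 - i) (Suc q)) p) = 2"
      by blast+
  next
    fix i assume "i \<in> {1..n}"
    then show "(Left \<in> incoming (\<lambda>i q. q \<notin> f (2*n - i), \<lambda>i q. occupied n f (2*n + 1 - i) (Suc q)) (2*i-1, 1)) =
      (Left \<in> outgoing (\<lambda>i q. q \<notin> f (2*n - i), \<lambda>i q. occupied n f (2*n + 1 - i) (Suc q)) (2*i, 1))"
      using turn[of i] by (simp add: incoming_simps outgoing_def)
  qed (use f(1,4) right in \<open>auto simp: incoming_simps outgoing_def\<close>)
qed

section \<open>Recovering the state from an ice orientation\<close>

context
  fixes n v h
  assumes ice: "ice_orientation n (v, h)"
begin

lemma ice_vertex: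
  assumes "i \<in> {1..2*n}" "q \<in> {1..n}"
  shows "of_bool (h i (q - 1)) =
    of_bool (h i q) + of_bool (\<not> v (i - 1) q) - (of_bool (\<not> v i q) :: int)"
  using ice assms unfolding ice_orientation_def by (intro iffD1[OF ice_rule_iff]) blast

lemma ice_boundary:
  "i \<in> {1..2*n} \<Longrightarrow> \<not> h i n" "q \<in> {1..n} \<Longrightarrow> v (2*n) q" "q \<in> {1..n} \<Longrightarrow> \<not> v 0 q"
  "i \<in> {1..n} \<Longrightarrow> h (2*i-1) 0 \<longleftrightarrow> \<not> h (2*i) 0"
  using ice by (auto simp: ice_orientation_def incoming_simps outgoing_def)

definition "the_state = state_of_cm n (restrict (ice_type (v, h)) ({1..2*n} \<times> {1..n}))"

lemma the_state_member:
  assumes "c \<le> 2*n" "q \<in> {1..n}"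
  shows "q \<in> the_state c \<longleftrightarrow> \<not> v (2*n - c) q"
proof (cases "c = 0")
  case True
  then show ?thesis using assms ice_boundary(2) by (simp add: the_state_def state_of_cm_def)
next
  case False
  then have i: "2*n + 1 - c \<in> {1..2*n}" "2*n + 1 - c - 1 = 2*n - c" using assms by auto
  show ?thesis
    using assms False ice_vertex[OF i(1) assms(2)] i
    by (auto simp: the_state_def state_of_cm_def ice_type_eq of_bool_def split: if_splits)
qed

text \<open>Starting at the right boundary, the vertical edges and the ice rule determine all
  horizontal edges. Hence the top edges, visible in the letters, determine the whole
  configuration.\<close>

lemma the_state_flow:
  assumes "i \<in> {1..2*n}" "1 \<le> q" "q \<le> Suc n"
  shows "flow 0 n (the_state (2*n + 1 - i)) (the_state (2*n + 1 - i - 1)) q = of_bool (h i (q - 1))"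
  using assms(3,2)
proof (induction q rule: inc_induct)
  case base
  then show ?case using ice_boundary(1)[OF assms(1)] by (simp add: flow_empty)
next
  case (step q)
  then have q: "q \<in> {1..n}" by auto
  have i: "2*n - (2*n + 1 - i) = i - 1" "2*n - (2*n + 1 - i - 1) = i" "2*n + 1 - i \<le> 2*n"
    "2*n + 1 - i - 1 \<le> 2*n"
    using assms(1) by auto
  show ?case
    using step flow_step[of q n 0 "the_state (2*n + 1 - i)" "the_state (2*n + 1 - i - 1)"]
      ice_vertex[OF assms(1) q] the_state_member[OF i(3) q] the_state_member[OF i(4) q]
    unfolding i(1,2) by simp
qed

lemma the_state_in_states: "the_state \<in> states n"
proof -
  have sub: "the_state c \<subseteq> {1..n}" if "c \<le> 2*n" for c
    using that by (auto simp: the_state_def state_of_cm_def)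
  have empty: "the_state 0 = {}"
    by (simp add: the_state_def state_of_cm_def)
  have card: "card (the_state (2*k)) = k" if "k \<le> n" for k
    using that
  proof (induction k)
    case 0
    then show ?case using empty by simp
  next
    case (Suc k)
    define i where "i = n - k"
    have i: "i \<in> {1..n}" "2*k+2 = 2*n + 1 - (2*i-1)" "2*k+1 = 2*n + 1 - (2*i-1) - 1"
      "2*k+1 = 2*n + 1 - 2*i" "2*k = 2*n + 1 - 2*i - 1" "2*i-1 \<in> {1..2*n}" "2*i \<in> {1..2*n}"
      using Suc.prems by (auto simp: i_def)
    have "int (card (the_state (2 * Suc k))) - int (card (the_state (2*k))) =
        of_bool (h (2*i-1) 0) + of_bool (h (2*i) 0)"
      using card_pair_flow[of the_state n k, OF empty sub] the_state_flow[OF i(6), of 1]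
        the_state_flow[OF i(7), of 1] Suc.prems
      unfolding i(2)[symmetric] i(3)[symmetric] i(4)[symmetric] i(5)[symmetric] by simp
    then show ?case using Suc ice_boundary(4)[OF i(1)] by auto
  qed
  have "row_ok n (the_state c) (the_state (c - 1))" if "c \<in> {1..2*n}" for c
  proof -
    have "2*n + 1 - c \<in> {1..2*n}" "2*n + 1 - (2*n + 1 - c) = c" using that by auto
    then show ?thesis
      using the_state_flow[of "2*n + 1 - c"] unfolding row_ok_def by auto
  qed
  then show ?thesis
    using sub card by (intro statesI) (simp_all add: the_state_def state_of_cm_def)
qed

lemma cm_of_the_state: "cm_of n the_state = restrict (ice_type (v, h)) ({1..2*n} \<times> {1..n})"
  unfolding cm_of_def
proof (rule restrict_ext)
  fix p assume "p \<in> {1..2*n} \<times> {1..n}"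
  then obtain i q where p: "p = (i, q)" "i \<in> {1..2*n}" "q \<in> {1..n}" by auto
  have "q \<notin> the_state (2*n - i) \<longleftrightarrow> v i q" "q \<notin> the_state (2*n - (i - 1)) \<longleftrightarrow> v (i - 1) q"
    using the_state_member[of "2*n - i" q, OF _ p(3)] the_state_member[of "2*n - (i - 1)" q, OF _ p(3)]
      p(2) by auto
  moreover have "occupied n the_state (2*n + 1 - i) (Suc q) \<longleftrightarrow> h i q"
    "occupied n the_state (2*n + 1 - i) (Suc (q - 1)) \<longleftrightarrow> h i (q - 1)"
    unfolding occupied_def using p the_state_flow[OF p(2), of "Suc q"] the_state_flow[OF p(2), of q] by auto
  ultimately show "ice_type (orientation_of n the_state) p = ice_type (v, h) p"
    unfolding p(1) orientation_of_def ice_type_eq by simp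
qed

end

lemma state_of_cm_of:
  assumes "f \<in> states n"
  shows "state_of_cm n (cm_of n f) = f"
proof
  fix c
  note ice = orientation_of_ice[OF assms, unfolded orientation_of_def]
  show "state_of_cm n (cm_of n f) c = f c"
  proof (cases "c \<le> 2*n")
    case True
    have "q \<in> state_of_cm n (cm_of n f) c \<longleftrightarrow> q \<in> f c" if "q \<in> {1..n}" for q
      using the_state_member[OF ice True that] True
      unfolding the_state_def[OF ice] cm_of_def orientation_of_def by simp
    moreover have "state_of_cm n (cm_of n f) c \<subseteq> {1..n}"
      using True by (auto simp: state_of_cm_def)
    ultimately show ?thesis using statesD(2)[OF assms True] by blast
  qed (simp add: state_of_cm_def statesD(5)[OF assms])
qed

lemma CM_wt:
  assumes "f \<in> states n"
  defines "C \<equiv> cm_of n f"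
  shows "t_var ^ (ne_odd n C + se_even n C + wgt_even n C) * (1 + t_var) ^ ns n C * xwgt_CM n C =
    state_wt n f"
proof -
  note f = statesD[OF assms(1)]
  have type: "C (i, q) \<in> {NE, SE, WE} \<longleftrightarrow> occupied n f (2*n + 1 - i) q"
    "C (i, q) = NS \<longleftrightarrow> \<not> occupied n f (2*n + 1 - i) q \<and> occupied n f (2*n + 1 - i) (Suc q)"
    "C (i, q) = NE \<longleftrightarrow> occupied n f (2*n + 1 - i) q \<and> occupied n f (2*n + 1 - i) (Suc q) \<and> q \<in> f (2*n + 1 - i - 1)"
    "C (i, q) = SE \<longleftrightarrow> occupied n f (2*n + 1 - i) q \<and> occupied n f (2*n + 1 - i) (Suc q) \<and> q \<notin> f (2*n + 1 - i - 1)"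
    if "i \<in> {1..2*n}" "q \<in> {1..n}" for i q
  proof -
    have i: "2*n + 1 - i - 1 = 2*n - i" "2*n - (i - 1) = 2*n + 1 - i" "Suc (q - 1) = q"
      "2*n + 1 - i \<le> 2*n" "1 \<le> 2*n + 1 - i"
      using that by auto
    have C: "C (i, q) = ice_type (orientation_of n f) (i, q)"
      using that by (simp add: C_def cm_of_def)
    have "of_bool (occupied n f (2*n + 1 - i) q) = of_bool (occupied n f (2*n + 1 - i) (Suc q)) +
      of_bool (q \<in> f (2*n + 1 - i)) - (of_bool (q \<in> f (2*n - i)) :: int)"
      using states_step[OF assms(1) i(5,4), of q] that unfolding i by simp
    then show "C (i, q) \<in> {NE, SE, WE} \<longleftrightarrow> occupied n f (2*n + 1 - i) q"
      "C (i, q) = NS \<longleftrightarrow> \<not> occupied n f (2*n + 1 - i) q \<and> occupied n f (2*n + 1 - i) (Suc q)"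
      "C (i, q) = NE \<longleftrightarrow> occupied n f (2*n + 1 - i) q \<and> occupied n f (2*n + 1 - i) (Suc q) \<and> q \<in> f (2*n + 1 - i - 1)"
      "C (i, q) = SE \<longleftrightarrow> occupied n f (2*n + 1 - i) q \<and> occupied n f (2*n + 1 - i) (Suc q) \<and> q \<notin> f (2*n + 1 - i - 1)"
      unfolding C orientation_of_def ice_type_eq i by (auto simp: of_bool_def split: if_splits)
  qed
  have par: "even i \<longleftrightarrow> odd (2*n + 1 - i)" if "i \<in> {1..2*n}" for i
    using that by auto
  have ns: "ns n C = card {(c, q) \<in> {1..2*n} \<times> {1..n}. \<not> occupied n f c q \<and> occupied n f c (Suc q)}"
  proof -
    have "ns n C = card {(i, q) \<in> {1..2*n} \<times> {1..n}.
        \<not> occupied n f (2*n + 1 - i) q \<and> occupied n f (2*n + 1 - i) (Suc q)}"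
      unfolding ns_def using type(2) by (intro arg_cong[where f = card]) blast
    then show ?thesis using card_reflect[of n "\<lambda>c q. \<not> occupied n f c q \<and> occupied n f c (Suc q)"] by simp
  qed
  have wgt: "wgt_even n C = card {(c, q) \<in> {1..2*n} \<times> {1..n}. odd c \<and> occupied n f c q}"
  proof -
    have "wgt_even n C = card {(i, q) \<in> {1..2*n} \<times> {1..n}. odd (2*n + 1 - i) \<and> occupied n f (2*n + 1 - i) q}"
      unfolding wgt_even_def using type(1) par by (intro arg_cong[where f = card]) blast
    then show ?thesis using card_reflect[of n "\<lambda>c q. odd c \<and> occupied n f c q"] by simp
  qed
  have joined: "ne_odd n C + se_even n C = card {(c, q) \<in> {1..2*n} \<times> {1..n}. joined n f c q}"
  proof -
    let ?A = "{(i, q) \<in> {1..2*n} \<times> {1..n}. odd i \<and> C (i, q) = NE}"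
    let ?B = "{(i, q) \<in> {1..2*n} \<times> {1..n}. even i \<and> C (i, q) = SE}"
    have fin: "finite ?A" "finite ?B"
      by (rule finite_subset[of _ "{1..2*n} \<times> {1..n}"]; auto)+
    have "ne_odd n C + se_even n C = card (?A \<union> ?B)"
      unfolding ne_odd_def se_even_def by (rule card_Un_disjoint[symmetric, OF fin]) auto
    also have "?A \<union> ?B = {(i, q) \<in> {1..2*n} \<times> {1..n}. joined n f (2*n + 1 - i) q}"
      unfolding joined_def using type(3,4) par by blast
    finally show ?thesis by (simp only: card_reflect)
  qed
  have "m_CM n C (Unbar k) = card {q\<in>{1..n}. occupied n f (2*k) q}"
    "m_CM n C (Bar k) = card {q\<in>{1..n}. occupied n f (2*k-1) q}" if "k \<in> {1..n}" for k
  proof -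
    have "2*n + 1 - (2*n + 1 - 2*k) = 2*k" "2*n + 1 - (2*n + 2 - 2*k) = 2*k-1"
      "2*n + 1 - 2*k \<in> {1..2*n}" "2*n + 2 - 2*k \<in> {1..2*n}"
      using that by auto
    then show "m_CM n C (Unbar k) = card {q\<in>{1..n}. occupied n f (2*k) q}"
      "m_CM n C (Bar k) = card {q\<in>{1..n}. occupied n f (2*k-1) q}"
      unfolding m_CM_def row_count_CM_def
      using type(1)[of "2*n + 1 - 2*k"] type(1)[of "2*n + 2 - 2*k"]
      by (auto intro!: arg_cong[where f = card] simp del: atLeastAtMost_iff)
  qed
  then show ?thesis
    unfolding state_wt_def xwgt_CM_def wgt joined ns by simp
qed

lemma sum_CM:
  "(\<Sum>C\<in>CM n. t_var ^ (ne_odd n C + se_even n C + wgt_even n C) * (1 + t_var) ^ ns n C * xwgt_CM n C) =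
    (\<Sum>f\<in>states n. state_wt n f)"
proof (rule sum.reindex_bij_witness[of _ "cm_of n" "state_of_cm n"])
  fix C assume "C \<in> CM n"
  then obtain v h where "ice_orientation n (v, h)"
    and C: "C = restrict (ice_type (v, h)) ({1..2*n} \<times> {1..n})"
    unfolding CM_def by auto
  note ice = this(1)
  show st: "state_of_cm n C \<in> states n" and eq: "cm_of n (state_of_cm n C) = C"
    using the_state_in_states[OF ice] cm_of_the_state[OF ice] unfolding the_state_def[OF ice] C by auto
  show "state_wt n (state_of_cm n C) = t_var ^ (ne_odd n C + se_even n C + wgt_even n C) *
      (1 + t_var) ^ ns n C * xwgt_CM n C"
    using CM_wt[OF st] unfolding eq by simp
next
  fix f assume f: "f \<in> states n"
  show "state_of_cm n (cm_of n f) = f" by (rule state_of_cm_of[OF f])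
  show "cm_of n f \<in> CM n"
    unfolding CM_def cm_of_def using orientation_of_ice[OF f] by blast
qed

section \<open>Shifted tableaux\<close>

text \<open>As \<open>d\<close> is injective and changes by one along edges, the graph is a disjoint
  union of paths, and each path has one lower end.\<close>

lemma card_quotient_ends:
  fixes d :: "'a \<Rightarrow> nat"
  assumes "R \<subseteq> B \<times> B" "sym R" "inj_on d B"
    and step: "\<And>a b. (a, b) \<in> R \<Longrightarrow> d a = Suc (d b) \<or> d b = Suc (d a)"
  shows "card (B // R\<^sup>*) = card {b \<in> B. \<forall>a. (b, a) \<in> R \<longrightarrow> d b < d a}"
proof -
  let ?E = "{b \<in> B. \<forall>a. (b, a) \<in> R \<longrightarrow> d b < d a}"
  define Down where "Down = {(b, a). (b, a) \<in> R \<and> d b = Suc (d a)}"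
  have det: "a = a'" if "(b, a) \<in> Down" "(b, a') \<in> Down" for a a' b
    using that assms(1,3) by (auto simp: Down_def inj_on_def)
  have Down_R: "Down \<subseteq> R" by (auto simp: Down_def)
  \<comment> \<open>Every element reachable from a lower end \<open>e\<close> descends back to
    \<open>e\<close>: a downward edge is the unique descent at its source, hence the first step of
    the chain already found.\<close>
  have closed: "(c, e) \<in> Down\<^sup>*" if "(e, c) \<in> R\<^sup>*" "e \<in> ?E" for e c
    using that(1)
  proof (induction rule: rtrancl_induct)
    case (step b c)
    from \<open>(b, c) \<in> R\<close> assms(4) consider "d b = Suc (d c)" | "d c = Suc (d b)" by blast
    then show ?case
    proof cases
      case 1
      then have bc: "(b, c) \<in> Down" using step by (simp add: Down_def)
      from \<open>(b, e) \<in> Down\<^sup>*\<close> show ?thesis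
      proof (cases rule: converse_rtranclE)
        case base
        then show ?thesis using that(2) step 1 by auto
      next
        case (step a)
        then show ?thesis using det[OF bc] by auto
      qed
    next
      case 2
      then have "(c, b) \<in> Down" using step assms(2) by (simp add: Down_def sym_def)
      then show ?thesis using step by (meson converse_rtrancl_into_rtrancl)
    qed
  qed simp
  have sym: "sym (R\<^sup>*)" using assms(2) by (rule sym_rtrancl)
  have inj: "inj_on (\<lambda>e. R\<^sup>* `` {e}) ?E"
  proof (rule inj_onI)
    fix e e' assume e: "e \<in> ?E" "e' \<in> ?E" "R\<^sup>* `` {e} = R\<^sup>* `` {e'}"
    then have "(e', e) \<in> Down\<^sup>*" by (intro closed) auto
    then show "e = e'"
      using e(2) by (cases rule: converse_rtranclE) (auto simp: Down_def)
  qed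
  have reach: "\<exists>e\<in>?E. (b, e) \<in> R\<^sup>*" if "b \<in> B" for b
    using that
  proof (induction "d b" arbitrary: b rule: less_induct)
    case less
    show ?case
    proof (cases "b \<in> ?E")
      case False
      then obtain a where a: "(b, a) \<in> R" "\<not> d b < d a" using less.prems by auto
      then have "d a < d b" "a \<in> B" using step[OF a(1)] assms(1) by auto
      then show ?thesis
        using less.hyps[of a] a(1) by (meson converse_rtrancl_into_rtrancl)
    qed auto
  qed
  have "B // R\<^sup>* = (\<lambda>e. R\<^sup>* `` {e}) ` ?E"
  proof
    show "B // R\<^sup>* \<subseteq> (\<lambda>e. R\<^sup>* `` {e}) ` ?E"
    proof
      fix X assume "X \<in> B // R\<^sup>*"
      then obtain b where b: "b \<in> B" "X = R\<^sup>* `` {b}" by (auto simp: quotient_def)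
      obtain e where e: "e \<in> ?E" "(b, e) \<in> R\<^sup>*" using reach[OF b(1)] by blast
      moreover have "(e, b) \<in> R\<^sup>*" using e(2) sym by (simp add: sym_def)
      ultimately have "X = R\<^sup>* `` {e}" using b(2) by (auto intro: rtrancl_trans)
      then show "X \<in> (\<lambda>e. R\<^sup>* `` {e}) ` ?E" using e(1) by blast
    qed
  qed (auto simp: quotient_def)
  then show ?thesis using card_image[OF inj] by simp
qed

text \<open>The two hypotheses say that the elements without \<open>P\<close> are the least elements
  of the fibres of \<open>g\<close>.\<close>

lemma card_image_leaders:
  fixes B :: "nat set"
  assumes "\<And>q q'. q' \<in> B \<Longrightarrow> q \<in> B \<Longrightarrow> q' < q \<Longrightarrow> g q' = g q \<Longrightarrow> P q"
    "\<And>q. q \<in> B \<Longrightarrow> P q \<Longrightarrow> \<exists>q'\<in>B. q' < q \<and> g q' = g q"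
  shows "card (g ` B) = card {q \<in> B. \<not> P q}"
proof -
  have "inj_on g {q \<in> B. \<not> P q}"
  proof (rule inj_onI)
    fix q q' assume "q \<in> {q \<in> B. \<not> P q}" "q' \<in> {q \<in> B. \<not> P q}" "g q = g q'"
    then show "q = q'" using assms(1)[of q q'] assms(1)[of q' q] by (cases q q' rule: linorder_cases) auto
  qed
  moreover have "g q \<in> g ` {q \<in> B. \<not> P q}" if "q \<in> B" for q
    using that
  proof (induction q rule: less_induct)
    case (less q)
    show ?case
    proof (cases "P q")
      case True
      then obtain q' where "q' \<in> B" "q' < q" "g q' = g q" using assms(2) less.prems by blast
      then show ?thesis using less.IH[of q'] by simp
    qed (use less.prems in auto)
  qed
  then have "g ` B = g ` {q \<in> B. \<not> P q}" by auto
  ultimately show ?thesis by (simp add: card_image)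
qed

lemma initial_segment:
  assumes "A \<subseteq> {1..m}" "\<And>i j. i \<in> A \<Longrightarrow> 1 \<le> j \<Longrightarrow> j \<le> i \<Longrightarrow> j \<in> A"
  shows "A = {1..card A :: nat}"
proof (cases "A = {}")
  case False
  have fin: "finite A" using assms(1) finite_subset by blast
  have "A = {1..Max A}"
  proof
    show "A \<subseteq> {1..Max A}" using fin assms(1) by auto
    show "{1..Max A} \<subseteq> A" using assms(2)[OF Max_in[OF fin False]] by auto
  qed
  then show ?thesis by (metis card_atLeastAtMost diff_Suc_1)
qed simp

text \<open>The c-th smallest letter of the alphabet, starting with the barred 1, whose rank is 2;
  hence ranks exceed levels by one.\<close>

definition letter_of :: "nat \<Rightarrow> letter" where
  "letter_of c = (if even c then Unbar (c div 2) else Bar (Suc c div 2))"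

lemma letter_rank_letter_of: "letter_rank (letter_of c) = Suc c"
  by (simp add: letter_of_def)

lemma letter_of_le_iff: "letter_of c \<le> letter_of c' \<longleftrightarrow> c \<le> c'"
  and letter_of_less_iff: "letter_of c < letter_of c' \<longleftrightarrow> c < c'"
  by (simp_all add: less_eq_letter_def less_letter_def letter_rank_letter_of)

lemma letter_of_inject: "letter_of c = letter_of c' \<longleftrightarrow> c = c'"
  by (metis letter_rank_letter_of nat.inject)

lemma letter_of_simps: "letter_of (2*k) = Unbar k" "1 \<le> k \<Longrightarrow> letter_of (2*k-1) = Bar k"
  by (auto simp: letter_of_def)

lemma alphabet_eq: "alphabet n = letter_of ` {1..2*n}"
proof
  show "alphabet n \<subseteq> letter_of ` {1..2*n}"
  proof
    fix l assume "l \<in> alphabet n"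
    then obtain k where k: "k \<in> {1..n}" "l = Unbar k \<or> l = Bar k" by (auto simp: alphabet_def)
    then have "l = letter_of (2*k) \<or> l = letter_of (2*k-1)" by (auto simp: letter_of_def)
    moreover have "2*k \<in> {1..2*n}" "2*k-1 \<in> {1..2*n}" using k by auto
    ultimately show "l \<in> letter_of ` {1..2*n}" by blast
  qed
  show "letter_of ` {1..2*n} \<subseteq> alphabet n"
  proof
    fix l assume "l \<in> letter_of ` {1..2*n}"
    then obtain c where c: "c \<in> {1..2*n}" "l = letter_of c" by auto
    then show "l \<in> alphabet n"
      by (cases "even c") (auto simp: letter_of_def alphabet_def elim!: evenE oddE)
  qed
qed

text \<open>If \<open>f c\<close> holds the row lengths of a shifted shape, this is the number of
  rows of length at least \<open>q\<close>, that is, of boxes on diagonal \<open>q\<close>. All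
  tableau conditions become inequalities between these counts.\<close>

definition tail_card :: "nat \<Rightarrow> (nat \<Rightarrow> nat set) \<Rightarrow> nat \<Rightarrow> nat \<Rightarrow> nat" where
  "tail_card n f c q = card (f c \<inter> {q..n})"

lemma flow_tail_card: "flow 0 n (f c) (f c') q = int (tail_card n f c q) - int (tail_card n f c' q)"
  by (simp add: flow_def tail_card_def)

lemma tail_card_step: "q \<le> n \<Longrightarrow> tail_card n f c q = of_bool (q \<in> f c) + tail_card n f c (Suc q)"
  by (simp add: tail_card_def card_Int_atLeast)

lemma tail_card_antimono: "q \<le> q' \<Longrightarrow> tail_card n f c q' \<le> tail_card n f c q"
  unfolding tail_card_def by (intro card_mono) auto

lemma tail_card_lipschitz: "q \<le> q' \<Longrightarrow> q' \<le> Suc n \<Longrightarrow> tail_card n f c q \<le> tail_card n f c q' + (q' - q)"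
proof (induction q rule: inc_induct)
  case (step q)
  then show ?case using tail_card_step[of q n f c] by (auto simp: of_bool_def split: if_splits)
qed simp

lemma occupied_tail_card:
  assumes "f \<in> states n" "1 \<le> c" "c \<le> 2*n" "1 \<le> q" "q \<le> Suc n"
  shows "tail_card n f c q = tail_card n f (c - 1) q + of_bool (occupied n f c q)"
  using statesD(6)[OF assms] by (simp add: flow_tail_card of_bool_def split: if_splits)

lemma tail_card_mono:
  assumes "f \<in> states n" "c \<le> c'" "c' \<le> 2*n" "1 \<le> q" "q \<le> Suc n"
  shows "tail_card n f c q \<le> tail_card n f c' q"
  using assms(2,3)
proof (induction c' rule: dec_induct)
  case (step c')
  then show ?case using occupied_tail_card[OF assms(1), of "Suc c'" q] assms(4,5) by simp
qed simp

lemma tail_card_ends: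
  assumes "f \<in> states n"
  shows "tail_card n f 0 q = 0" "1 \<le> q \<Longrightarrow> tail_card n f (2*n) q = n + 1 - q"
  using statesD(1,4)[OF assms] by (auto simp: tail_card_def Int_atLeastAtMost)

text \<open>The level at which diagonal \<open>q\<close> of the growing shape receives its
  \<open>i\<close>-th box.\<close>

definition letter_index :: "nat \<Rightarrow> (nat \<Rightarrow> nat set) \<Rightarrow> nat \<Rightarrow> nat \<Rightarrow> nat" where
  "letter_index n f i q = (LEAST c. i \<le> tail_card n f c q)"

definition st_of :: "nat \<Rightarrow> (nat \<Rightarrow> nat set) \<Rightarrow> box \<Rightarrow> letter" where
  "st_of n f = restrict (\<lambda>(i, j). letter_of (letter_index n f i (j + 1 - i))) (SF n)"

text \<open>A Galois connection between levels and positions on a diagonal, through which the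
  tableau inequalities are obtained.\<close>

lemma letter_index_le_iff:
  assumes "f \<in> states n" "1 \<le> q" "i + q \<le> n + 1" "c \<le> 2*n"
  shows "letter_index n f i q \<le> c \<longleftrightarrow> i \<le> tail_card n f c q"
proof
  \<comment> \<open>Level 2n shows that a least level exists and keeps it in the range where
    \<open>f\<close> is a genuine state.\<close>
  have "i \<le> tail_card n f (2*n) q" using tail_card_ends(2)[OF assms(1,2)] assms(3) by simp
  then have "i \<le> tail_card n f (letter_index n f i q) q" unfolding letter_index_def by (rule LeastI)
  moreover assume "letter_index n f i q \<le> c"
  ultimately show "i \<le> tail_card n f c q"
    using tail_card_mono[OF assms(1), of "letter_index n f i q" c q] assms by linarith
qed (simp add: letter_index_def Least_le)

lemma letter_index_range:
  assumes "f \<in> states n" "1 \<le> q" "1 \<le> i" "i + q \<le> n + 1"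
  shows "1 \<le> letter_index n f i q" "letter_index n f i q \<le> 2*n"
proof -
  show "letter_index n f i q \<le> 2*n"
    using letter_index_le_iff[OF assms(1,2,4), of "2*n"] tail_card_ends(2)[OF assms(1,2)] assms by simp
  show "1 \<le> letter_index n f i q"
    using letter_index_le_iff[OF assms(1,2,4), of 0] tail_card_ends(1)[OF assms(1), of q] assms(3) by simp
qed

lemma letter_index_eq_iff:
  assumes "f \<in> states n" "1 \<le> q" "1 \<le> i" "i + q \<le> n + 1" "1 \<le> c" "c \<le> 2*n"
  shows "letter_index n f i q = c \<longleftrightarrow> occupied n f c q \<and> i = tail_card n f c q"
proof -
  have "letter_index n f i q = c \<longleftrightarrow> letter_index n f i q \<le> c \<and> \<not> letter_index n f i q \<le> c - 1"
    using assms(5) by auto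
  then show ?thesis
    using letter_index_le_iff[OF assms(1,2,4), of c] letter_index_le_iff[OF assms(1,2,4), of "c - 1"]
      occupied_tail_card[OF assms(1,5,6,2)] assms by auto
qed

lemma st_of_eq: "(i, j) \<in> SF n \<Longrightarrow> st_of n f (i, j) = letter_of (letter_index n f i (j + 1 - i))"
  by (simp add: st_of_def)

text \<open>Rows increase weakly because \<open>tail_card\<close> falls with the diagonal, columns
  because it falls by at most one per diagonal, and diagonals strictly because one level raises it
  by at most one. The size k at level 2k fixes the main diagonal.\<close>

lemma st_of_in_ST:
  assumes "f \<in> states n"
  shows "st_of n f \<in> ST n"
proof -
  note le = letter_index_le_iff[OF assms]
  have range: "letter_index n f i (j + 1 - i) \<in> {1..2*n}" if "(i, j) \<in> SF n" for i j
    using that letter_index_range[OF assms, of "j + 1 - i" i] by (auto simp: SF_def)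
  have self: "i \<le> tail_card n f (letter_index n f i (j + 1 - i)) (j + 1 - i)" if "(i, j) \<in> SF n" for i j
    using that range[OF that] le[of "j + 1 - i" i "letter_index n f i (j + 1 - i)"] by (auto simp: SF_def)
  have "st_of n f \<in> SF n \<rightarrow>\<^sub>E alphabet n"
    unfolding alphabet_eq st_of_def using range by auto
  moreover have "st_of n f (i, i) \<in> {Unbar i, Bar i}" if "(i, i) \<in> SF n" for i
  proof -
    have i: "1 \<le> i" "i \<le> n" using that by (auto simp: SF_def)
    have card: "tail_card n f (2*k) 1 = k" if "k \<le> n" for k
      using that statesD(2,3)[OF assms, of "2*k"] statesD(3)[OF assms that]
      by (auto simp: tail_card_def inf_absorb1)
    have "letter_index n f i 1 \<le> 2*i" "\<not> letter_index n f i 1 \<le> 2*(i-1)"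
      using le[of 1 i "2*i"] le[of 1 i "2*(i-1)"] card[of i] card[of "i-1"] i by auto
    then have "letter_index n f i 1 = 2*i \<or> letter_index n f i 1 = 2*i-1" by auto
    then show ?thesis using that i letter_of_simps[of i] by (auto simp: st_of_eq)
  qed
  moreover have "st_of n f (i, j) \<le> st_of n f (i, j + 1)" if "(i, j) \<in> SF n" "(i, j + 1) \<in> SF n" for i j
  proof -
    have q: "j + 1 + 1 - i = Suc (j + 1 - i)" "1 \<le> i" "i \<le> j" "j + 1 \<le> n"
      using that by (auto simp: SF_def)
    show ?thesis
      using self[OF that(2)] range[OF that(2)] q
        tail_card_antimono[of "j + 1 - i" "Suc (j + 1 - i)" n f "letter_index n f i (j + 1 + 1 - i)"]
        le[of "j + 1 - i" i "letter_index n f i (j + 1 + 1 - i)"]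
      unfolding st_of_eq[OF that(1)] st_of_eq[OF that(2)] letter_of_le_iff by auto
  qed
  moreover have "st_of n f (i, j) \<le> st_of n f (i + 1, j)" if "(i, j) \<in> SF n" "(i + 1, j) \<in> SF n" for i j
  proof -
    have q: "j + 1 - i = Suc (j + 1 - (i + 1))" "1 \<le> i" "i + 1 \<le> j" "j \<le> n"
      using that by (auto simp: SF_def)
    show ?thesis
      using self[OF that(2)] range[OF that(2)]
        tail_card_step[of "j + 1 - (i + 1)" n f "letter_index n f (i + 1) (j + 1 - (i + 1))"]
        le[of "j + 1 - i" i "letter_index n f (i + 1) (j + 1 - (i + 1))"] q
      unfolding st_of_eq[OF that(1)] st_of_eq[OF that(2)] letter_of_le_iff
      by (auto simp: of_bool_def split: if_splits)
  qed
  moreover have "st_of n f (i, j) < st_of n f (i + 1, j + 1)"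
    if "(i, j) \<in> SF n" "(i + 1, j + 1) \<in> SF n" for i j
  proof -
    define q where "q = j + 1 - i"
    define c where "c = letter_index n f (i + 1) q"
    have q: "j + 1 + 1 - (i + 1) = q" "1 \<le> q" "q \<le> n" "i + q \<le> n" "1 \<le> i"
      using that by (auto simp: SF_def q_def)
    have c: "c \<in> {1..2*n}" "i + 1 \<le> tail_card n f c q"
      using self[OF that(2)] range[OF that(2)] unfolding q(1) c_def by auto
    have "i \<le> tail_card n f (c - 1) q"
      using occupied_tail_card[OF assms, of c q] c q by (auto simp: of_bool_def split: if_splits)
    moreover have "c - 1 \<le> 2*n" using c by auto
    ultimately have "letter_index n f i q < c"
      using le[of q i "c - 1"] c q by auto
    then show ?thesis
      unfolding st_of_eq[OF that(1)] st_of_eq[OF that(2)] q(1) letter_of_less_iff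
      by (simp add: c_def q_def)
  qed
  ultimately show ?thesis unfolding ST_def by blast
qed

section \<open>From tableaux to states\<close>

definition entry_index :: "(box \<Rightarrow> letter) \<Rightarrow> nat \<Rightarrow> nat \<Rightarrow> nat" where
  "entry_index \<eta> i q = letter_rank (\<eta> (i, i + q - 1)) - 1"

definition diag_count :: "nat \<Rightarrow> (box \<Rightarrow> letter) \<Rightarrow> nat \<Rightarrow> nat \<Rightarrow> nat" where
  "diag_count n \<eta> c q = card {i \<in> {1..n + 1 - q}. entry_index \<eta> i q \<le> c}"

text \<open>A row of length \<open>q\<close> ends on diagonal \<open>q\<close>, so that diagonal has
  one box more than the next.\<close>

definition state_of_st :: "nat \<Rightarrow> (box \<Rightarrow> letter) \<Rightarrow> nat \<Rightarrow> nat set" where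
  "state_of_st n \<eta> = restrict
     (\<lambda>c. {q \<in> {1..n}. diag_count n \<eta> c q = Suc (diag_count n \<eta> c (Suc q))}) {0..2*n}"

lemma state_of_st_of:
  assumes "f \<in> states n"
  shows "state_of_st n (st_of n f) = f"
proof
  fix c
  show "state_of_st n (st_of n f) c = f c"
  proof (cases "c \<le> 2*n")
    case True
    have count: "diag_count n (st_of n f) c q = tail_card n f c q" if "1 \<le> q" "q \<le> Suc n" for q
    proof -
      have "entry_index (st_of n f) i q = letter_index n f i q" if "i \<in> {1..n + 1 - q}" for i
      proof -
        have "(i, i + q - 1) \<in> SF n" "i + q - 1 + 1 - i = q"
          using that \<open>1 \<le> q\<close> by (auto simp: SF_def)
        then show ?thesis by (simp add: entry_index_def st_of_eq letter_rank_letter_of)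
      qed
      then have "{i \<in> {1..n + 1 - q}. entry_index (st_of n f) i q \<le> c} =
          {i \<in> {1..n + 1 - q}. i \<le> tail_card n f c q}"
        using letter_index_le_iff[OF assms \<open>1 \<le> q\<close> _ True] that by fastforce
      also have "\<dots> = {1..tail_card n f c q}"
        using tail_card_mono[OF assms True, of q] tail_card_ends(2)[OF assms \<open>1 \<le> q\<close>] that by auto
      finally show ?thesis by (simp add: diag_count_def)
    qed
    have "diag_count n (st_of n f) c q = Suc (diag_count n (st_of n f) c (Suc q)) \<longleftrightarrow> q \<in> f c"
      if "q \<in> {1..n}" for q
      using that tail_card_step[of q n f c] by (simp add: count)
    then have "state_of_st n (st_of n f) c = {q \<in> {1..n}. q \<in> f c}"
      using True by (auto simp: state_of_st_def)
    then show ?thesis using statesD(2)[OF assms True] by auto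
  qed (simp add: state_of_st_def statesD(5)[OF assms])
qed

context
  fixes n :: nat and \<eta> :: "box \<Rightarrow> letter"
  assumes ST: "\<eta> \<in> ST n"
begin

lemma entry_letter:
  assumes "1 \<le> i" "1 \<le> q" "i + q \<le> n + 1"
  shows "\<eta> (i, i + q - 1) = letter_of (entry_index \<eta> i q)" "entry_index \<eta> i q \<in> {1..2*n}"
proof -
  have "(i, i + q - 1) \<in> SF n" using assms by (auto simp: SF_def)
  then have "\<eta> (i, i + q - 1) \<in> letter_of ` {1..2*n}"
    using ST unfolding alphabet_eq[symmetric] ST_def by (auto simp: PiE_def Pi_def)
  then show "\<eta> (i, i + q - 1) = letter_of (entry_index \<eta> i q)" "entry_index \<eta> i q \<in> {1..2*n}"
    by (auto simp: entry_index_def letter_rank_letter_of)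
qed

lemma entry_index_row:
  assumes "1 \<le> i" "1 \<le> q" "i + q \<le> n"
  shows "entry_index \<eta> i q \<le> entry_index \<eta> i (Suc q)"
proof -
  have "(i, i + q - 1) \<in> SF n" "(i, i + q - 1 + 1) \<in> SF n" using assms by (auto simp: SF_def)
  then have "\<eta> (i, i + q - 1) \<le> \<eta> (i, i + q - 1 + 1)"
    using ST unfolding ST_def by blast
  moreover have "i + q - 1 + 1 = i + Suc q - 1" using assms by simp
  ultimately show ?thesis
    using entry_letter[of i q] entry_letter[of i "Suc q"] assms by (simp add: letter_of_le_iff)
qed

lemma entry_index_col:
  assumes "1 \<le> i" "1 \<le> q" "i + q \<le> n"
  shows "entry_index \<eta> i (Suc q) \<le> entry_index \<eta> (Suc i) q"
proof -
  have "(i, i + Suc q - 1) \<in> SF n" "(i + 1, i + Suc q - 1) \<in> SF n" using assms by (auto simp: SF_def)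
  then have "\<eta> (i, i + Suc q - 1) \<le> \<eta> (i + 1, i + Suc q - 1)"
    using ST unfolding ST_def by blast
  then show ?thesis
    using entry_letter[of i "Suc q"] entry_letter[of "Suc i" q] assms by (simp add: letter_of_le_iff)
qed

lemma entry_index_diag:
  assumes "1 \<le> i" "1 \<le> q" "i + q \<le> n"
  shows "entry_index \<eta> i q < entry_index \<eta> (Suc i) q"
proof -
  have "(i, i + q - 1) \<in> SF n" "(i + 1, i + q - 1 + 1) \<in> SF n" using assms by (auto simp: SF_def)
  then have "\<eta> (i, i + q - 1) < \<eta> (i + 1, i + q - 1 + 1)"
    using ST unfolding ST_def by blast
  moreover have "i + q - 1 + 1 = Suc i + q - 1" using assms by simp
  ultimately show ?thesis
    using entry_letter[of i q] entry_letter[of "Suc i" q] assms by (simp add: letter_of_less_iff)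
qed

text \<open>Entries grow strictly down a diagonal, so the small ones form an initial segment; this
  is the counterpart of \<open>letter_index_le_iff\<close>.\<close>

lemma entry_index_le_iff:
  assumes "1 \<le> i" "1 \<le> q" "i + q \<le> n + 1"
  shows "entry_index \<eta> i q \<le> c \<longleftrightarrow> i \<le> diag_count n \<eta> c q"
proof -
  have mono: "entry_index \<eta> i q \<le> entry_index \<eta> j q" if "1 \<le> i" "i \<le> j" "j + q \<le> n + 1" for i j
    using that(2,3)
  proof (induction j rule: dec_induct)
    case (step j)
    then show ?case using entry_index_diag[of j q] that(1) assms(2) by simp
  qed simp
  have "{i \<in> {1..n + 1 - q}. entry_index \<eta> i q \<le> c} = {1..diag_count n \<eta> c q}"
    unfolding diag_count_def
  proof (rule initial_segment)
    fix i j assume i: "i \<in> {i \<in> {1..n + 1 - q}. entry_index \<eta> i q \<le> c}" "1 \<le> j" "j \<le> i"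
    then have "i + q \<le> n + 1" by auto
    with i show "j \<in> {i \<in> {1..n + 1 - q}. entry_index \<eta> i q \<le> c}"
      using mono[of j i] by (auto intro: order_trans)
  qed auto
  then have "i \<in> {i \<in> {1..n + 1 - q}. entry_index \<eta> i q \<le> c} \<longleftrightarrow> i \<in> {1..diag_count n \<eta> c q}"
    by simp
  then show ?thesis using assms by auto
qed

lemma diag_count_bound: "diag_count n \<eta> c q \<le> n + 1 - q"
proof -
  have "diag_count n \<eta> c q \<le> card {1..n + 1 - q}"
    unfolding diag_count_def by (intro card_mono) auto
  then show ?thesis by simp
qed

text \<open>Weak increase along rows gives the first inequality, weak increase down columns the
  second.\<close>

lemma diag_count_step:
  assumes "q \<in> {1..n}"
  shows "diag_count n \<eta> c (Suc q) \<le> diag_count n \<eta> c q"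
    "diag_count n \<eta> c q \<le> Suc (diag_count n \<eta> c (Suc q))"
proof -
  let ?D = "diag_count n \<eta> c"
  show "?D (Suc q) \<le> ?D q"
  proof (cases "?D (Suc q) = 0")
    case False
    then have "?D (Suc q) + q \<le> n" using diag_count_bound[of c "Suc q"] by simp
    then show ?thesis
      using entry_index_le_iff[of "?D (Suc q)" "Suc q" c] entry_index_le_iff[of "?D (Suc q)" q c]
        entry_index_row[of "?D (Suc q)" q] False assms by auto
  qed simp
  show "?D q \<le> Suc (?D (Suc q))"
  proof (cases "?D q \<le> 1")
    case False
    define i where "i = ?D q - 1"
    have i: "Suc i = ?D q" "1 \<le> i" "i + q \<le> n"
      using False diag_count_bound[of c q] by (auto simp: i_def)
    then show ?thesis
      using entry_index_le_iff[of "Suc i" q c] entry_index_le_iff[of i "Suc q" c]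
        entry_index_col[of i q] assms by auto
  qed simp
qed

lemma tail_card_state_of_st:
  assumes "c \<le> 2*n" "1 \<le> q" "q \<le> Suc n"
  shows "tail_card n (state_of_st n \<eta>) c q = diag_count n \<eta> c q"
  using assms(3,2)
proof (induction q rule: inc_induct)
  case base
  then show ?case by (simp add: tail_card_def diag_count_def)
next
  case (step q)
  then have "q \<in> state_of_st n \<eta> c \<longleftrightarrow> diag_count n \<eta> c q = Suc (diag_count n \<eta> c (Suc q))"
    using assms(1) by (simp add: state_of_st_def)
  then show ?case
    using step tail_card_step[of q n "state_of_st n \<eta>" c] diag_count_step[of q c] by auto
qed

text \<open>The main diagonal fixes the sizes at even levels, and strictness along diagonals lets a
  level add at most one box to each.\<close>

lemma state_of_st_in_states: "state_of_st n \<eta> \<in> states n"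
proof (rule statesI)
  let ?f = "state_of_st n \<eta>"
  show sub: "?f c \<subseteq> {1..n}" if "c \<le> 2*n" for c
    using that by (auto simp: state_of_st_def)
  show "?f c = undefined" if "2*n < c" for c
    using that by (simp add: state_of_st_def)
  show "card (?f (2*k)) = k" if "k \<le> n" for k
  proof -
    have "entry_index \<eta> i 1 \<in> {2*i, 2*i-1}" if "i \<in> {1..n}" for i
    proof -
      have "(i, i) \<in> SF n" using that by (auto simp: SF_def)
      then have "\<eta> (i, i) \<in> {Unbar i, Bar i}" using ST unfolding ST_def by blast
      then show ?thesis by (auto simp: entry_index_def)
    qed
    then have "{i \<in> {1..n + 1 - 1}. entry_index \<eta> i 1 \<le> 2*k} = {1..k}"
      using that by fastforce
    then have "diag_count n \<eta> (2*k) 1 = k" by (simp add: diag_count_def)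
    moreover have "tail_card n ?f (2*k) 1 = card (?f (2*k))"
      using sub[of "2*k"] that by (simp add: tail_card_def inf_absorb1)
    ultimately show ?thesis using tail_card_state_of_st[of "2*k" 1] that by simp
  qed
  show "row_ok n (?f c) (?f (c - 1))" if "c \<in> {1..2*n}" for c
    unfolding row_ok_def
  proof
    fix q assume q: "q \<in> {1..n}"
    let ?D = "\<lambda>c. diag_count n \<eta> c q"
    have "?D (c - 1) \<le> ?D c"
      unfolding diag_count_def by (intro card_mono) auto
    moreover have "?D c \<le> Suc (?D (c - 1))"
    proof (cases "?D c \<le> 1")
      case False
      define i where "i = ?D c - 1"
      have i: "Suc i = ?D c" "1 \<le> i" "i + q \<le> n"
        using False diag_count_bound[of c q] by (auto simp: i_def)
      then show ?thesis
        using entry_index_le_iff[of "Suc i" q c] entry_index_le_iff[of i q "c - 1"]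
          entry_index_diag[of i q] q by auto
    qed simp
    ultimately show "flow 0 n (?f c) (?f (c - 1)) q \<in> {0, 1}"
      using that q tail_card_state_of_st[of c q] tail_card_state_of_st[of "c - 1" q]
      by (auto simp: flow_tail_card)
  qed
qed

lemma st_of_state_of_st: "st_of n (state_of_st n \<eta>) = \<eta>"
proof
  fix b :: box
  obtain i j where b: "b = (i, j)" by (cases b)
  show "st_of n (state_of_st n \<eta>) b = \<eta> b"
  proof (cases "b \<in> SF n")
    case True
    define q where "q = j + 1 - i"
    have q: "1 \<le> i" "1 \<le> q" "i + q \<le> n + 1" "j = i + q - 1"
      using True by (auto simp: b SF_def q_def)
    have "letter_index n (state_of_st n \<eta>) i q = entry_index \<eta> i q"
    proof (rule antisym)
      show "letter_index n (state_of_st n \<eta>) i q \<le> entry_index \<eta> i q"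
        using letter_index_le_iff[OF state_of_st_in_states q(2,3), of "entry_index \<eta> i q"] entry_letter(2)[OF q(1-3)]
          entry_index_le_iff[OF q(1-3), of "entry_index \<eta> i q"]
          tail_card_state_of_st[of "entry_index \<eta> i q" q] q by auto
      have "letter_index n (state_of_st n \<eta>) i q \<le> 2*n"
        by (rule letter_index_range(2)[OF state_of_st_in_states q(2,1,3)])
      then show "entry_index \<eta> i q \<le> letter_index n (state_of_st n \<eta>) i q"
        using letter_index_le_iff[OF state_of_st_in_states q(2,3), of "letter_index n (state_of_st n \<eta>) i q"]
          entry_index_le_iff[OF q(1-3), of "letter_index n (state_of_st n \<eta>) i q"]
          tail_card_state_of_st[of "letter_index n (state_of_st n \<eta>) i q" q] q by auto
    qed
    then show ?thesis
      using True entry_letter(1)[OF q(1-3)] unfolding b q(4)[symmetric] by (simp add: st_of_eq q_def)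
  next
    case False
    then show ?thesis
      using ST PiE_arb[of \<eta> "SF n" "\<lambda>_. alphabet n" b] unfolding ST_def st_of_def by simp
  qed
qed

end

section \<open>The boxes of a single letter\<close>

context
  fixes n :: nat and f :: "nat \<Rightarrow> nat set" and c :: nat
  assumes f: "f \<in> states n" and c: "1 \<le> c" "c \<le> 2*n"
begin

definition "used = {q \<in> {1..n}. occupied n f c q}"

text \<open>The letter of level \<open>c\<close> can only stand in the last box that diagonal
  \<open>q\<close> has at that level.\<close>

definition "box_at q = (tail_card n f c q, tail_card n f c q + q - 1)"

text \<open>The first diagonals of the maximal runs of occupied diagonals.\<close>

definition "ends = {q \<in> used. \<not> (2 \<le> q \<and> occupied n f c (q - 1))}"

definition "letter_boxes = boxes n (st_of n f) (letter_of c)"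

lemma tail_card_used:
  assumes "q \<in> used"
  shows "1 \<le> tail_card n f c q" "tail_card n f c q + q \<le> n + 1"
proof -
  have q: "1 \<le> q" "q \<le> n" "occupied n f c q" using assms by (auto simp: used_def)
  show "1 \<le> tail_card n f c q" using occupied_tail_card[OF f c, of q] q by simp
  show "tail_card n f c q + q \<le> n + 1"
    using tail_card_mono[OF f, of c "2*n" q] tail_card_ends(2)[OF f q(1)] c q by simp
qed

lemma letter_boxes_eq: "letter_boxes = box_at ` used"
proof
  show "letter_boxes \<subseteq> box_at ` used"
  proof
    fix b assume "b \<in> letter_boxes"
    then obtain i j where b: "b = (i, j)" "(i, j) \<in> SF n" "st_of n f (i, j) = letter_of c"
      by (cases b) (auto simp: letter_boxes_def boxes_def)
    define q where "q = j + 1 - i"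
    have q: "1 \<le> i" "1 \<le> q" "i + q \<le> n + 1" "j = i + q - 1" "q \<le> n"
      using b(2) by (auto simp: SF_def q_def)
    have "letter_index n f i q = c" using b by (simp add: st_of_eq letter_of_inject q_def)
    then have "occupied n f c q" "i = tail_card n f c q"
      using letter_index_eq_iff[OF f q(2,1,3) c] by auto
    then show "b \<in> box_at ` used"
      using q b(1) by (intro image_eqI[of _ _ q]) (auto simp: box_at_def used_def)
  qed
  show "box_at ` used \<subseteq> letter_boxes"
  proof (rule image_subsetI)
    fix q assume q: "q \<in> used"
    then have q': "1 \<le> q" "occupied n f c q" by (auto simp: used_def)
    define i where "i = tail_card n f c q"
    have i: "1 \<le> i" "i + q \<le> n + 1" using tail_card_used[OF q] by (auto simp: i_def)
    have SF: "(i, i + q - 1) \<in> SF n" "i + q - 1 + 1 - i = q" using i q' by (auto simp: SF_def)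
    have "letter_index n f i q = c"
      using letter_index_eq_iff[OF f q'(1) i c] q'(2) by (simp add: i_def)
    then show "box_at q \<in> letter_boxes"
      using SF by (simp add: letter_boxes_def boxes_def box_at_def i_def[symmetric] st_of_eq)
  qed
qed

lemma box_at_diag: "1 \<le> q \<Longrightarrow> snd (box_at q) + 1 - fst (box_at q) = q"
  by (simp add: box_at_def)

lemma inj_box_at: "inj_on box_at used"
proof (rule inj_onI)
  fix q q' assume "q \<in> used" "q' \<in> used" "box_at q = box_at q'"
  then show "q = q'" using box_at_diag[of q] box_at_diag[of q'] by (auto simp: used_def)
qed

lemma card_letter_boxes: "m_ST n (st_of n f) (letter_of c) = card used"
  unfolding m_ST_def letter_boxes_def[symmetric] letter_boxes_eq by (rule card_image[OF inj_box_at])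

text \<open>From one diagonal to the next \<open>tail_card\<close> changes by 0 or 1, which makes
  the two boxes horizontal or vertical neighbours.\<close>

lemma share_edge_previous:
  assumes "q \<in> used" "2 \<le> q"
  shows "share_edge (box_at q) (box_at (q - 1))"
proof -
  obtain p where p: "q = Suc p" "1 \<le> p" "p \<le> n" using assms by (cases q) (auto simp: used_def)
  show ?thesis
    using tail_card_step[OF p(3), of f c] p by (cases "p \<in> f c") (auto simp: box_at_def)
qed

text \<open>Boxes of a letter touch exactly when their diagonals are consecutive, so the components
  are the runs, counted by their lower ends.\<close>

lemma con_eq: "con n (st_of n f) (letter_of c) = card ends"
proof -
  define R where "R = {(a, b). a \<in> letter_boxes \<and> b \<in> letter_boxes \<and> share_edge a b}"
  define d :: "box \<Rightarrow> nat" where "d = (\<lambda>(i, j). j + 1 - i)"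
  have d: "d (box_at q) = q" if "q \<in> used" for q
    using box_at_diag[of q] that by (simp add: d_def case_prod_beta used_def)
  have step: "d a = Suc (d b) \<or> d b = Suc (d a)" if "(a, b) \<in> R" for a b
  proof -
    obtain i j k l where ab: "a = (i, j)" "b = (k, l)" by (cases a; cases b)
    have "i \<le> j" "k \<le> l" using that by (auto simp: R_def ab letter_boxes_def boxes_def SF_def)
    moreover have "share_edge (i, j) (k, l)" using that by (simp add: R_def ab)
    ultimately show ?thesis by (auto simp: ab d_def)
  qed
  have sym: "sym R"
    unfolding R_def by (rule symI) (auto simp del: split_paired_All)
  have "con n (st_of n f) (letter_of c) = card (letter_boxes // R\<^sup>*)"
    by (simp add: con_def components_def letter_boxes_def R_def)
  also have "\<dots> = card {b \<in> letter_boxes. \<forall>a. (b, a) \<in> R \<longrightarrow> d b < d a}"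
  proof (rule card_quotient_ends[OF _ sym _ step])
    show "inj_on d letter_boxes"
      unfolding letter_boxes_eq
    proof (rule inj_onI, elim imageE)
      fix x y q q' assume "d x = d y" "x = box_at q" "q \<in> used" "y = box_at q'" "q' \<in> used"
      then show "x = y" using d[of q] d[of q'] by simp
    qed
  qed (auto simp: R_def)
  also have "{b \<in> letter_boxes. \<forall>a. (b, a) \<in> R \<longrightarrow> d b < d a} = box_at ` ends"
  proof -
    have "(\<forall>a. (box_at q, a) \<in> R \<longrightarrow> d (box_at q) < d a) \<longleftrightarrow> \<not> (2 \<le> q \<and> occupied n f c (q - 1))"
      if q: "q \<in> used" for q
    proof
      assume *: "\<forall>a. (box_at q, a) \<in> R \<longrightarrow> d (box_at q) < d a"
      show "\<not> (2 \<le> q \<and> occupied n f c (q - 1))"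
      proof
        assume q2: "2 \<le> q \<and> occupied n f c (q - 1)"
        then have "q - 1 \<in> used" using q by (auto simp: used_def)
        moreover from this have "(box_at q, box_at (q - 1)) \<in> R"
          using share_edge_previous[OF q] q q2 by (simp add: R_def letter_boxes_eq)
        moreover from this have "d (box_at q) < d (box_at (q - 1))" using * by blast
        ultimately show False using d[OF q] d[of "q - 1"] by simp
      qed
    next
      assume *: "\<not> (2 \<le> q \<and> occupied n f c (q - 1))"
      show "\<forall>a. (box_at q, a) \<in> R \<longrightarrow> d (box_at q) < d a"
      proof (intro allI impI)
        fix a assume a: "(box_at q, a) \<in> R"
        then obtain q' where q': "q' \<in> used" "a = box_at q'" by (auto simp: R_def letter_boxes_eq)
        then have "q = Suc q' \<or> q' = Suc q" using step[OF a] d q by auto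
        then show "d (box_at q) < d a" using * q' d q by (auto simp: used_def)
      qed
    qed
    then have "{q \<in> used. \<forall>a. (box_at q, a) \<in> R \<longrightarrow> d (box_at q) < d a} = ends"
      unfolding ends_def by blast
    moreover have "{b \<in> letter_boxes. \<forall>a. (b, a) \<in> R \<longrightarrow> d b < d a} =
        box_at ` {q \<in> used. \<forall>a. (box_at q, a) \<in> R \<longrightarrow> d (box_at q) < d a}"
      unfolding letter_boxes_eq by blast
    ultimately show ?thesis by simp
  qed
  also have "card (box_at ` ends) = card ends"
    by (rule card_image, rule inj_on_subset[OF inj_box_at]) (auto simp: ends_def)
  finally show ?thesis .
qed

text \<open>A run begins on the main diagonal or right after a gap; such a gap is an NS vertex, or
  an entry -1.\<close>

lemma card_ends:
  assumes "1 \<le> n"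
  shows "card ends = of_bool (occupied n f c 1) + card {q \<in> {1..n}. \<not> occupied n f c q \<and> occupied n f c (Suc q)}"
proof -
  have no: "\<not> occupied n f c (Suc n)" by (simp add: occupied_def flow_empty)
  have "ends = {q \<in> {1}. occupied n f c q} \<union> Suc ` {q \<in> {1..n}. \<not> occupied n f c q \<and> occupied n f c (Suc q)}"
  proof
    show "ends \<subseteq> {q \<in> {1}. occupied n f c q} \<union> Suc ` {q \<in> {1..n}. \<not> occupied n f c q \<and> occupied n f c (Suc q)}"
    proof
      fix q assume "q \<in> ends"
      then show "q \<in> {q \<in> {1}. occupied n f c q} \<union> Suc ` {q \<in> {1..n}. \<not> occupied n f c q \<and> occupied n f c (Suc q)}"
        by (cases "q = 1") (auto simp: ends_def used_def intro!: image_eqI[of _ _ "q - 1"])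
    qed
    show "{q \<in> {1}. occupied n f c q} \<union> Suc ` {q \<in> {1..n}. \<not> occupied n f c q \<and> occupied n f c (Suc q)} \<subseteq> ends"
      using assms no by (auto simp: ends_def used_def) (metis le_antisym not_less_eq_eq)
  qed
  then have "card ends = card {q \<in> {1}. occupied n f c q} +
      card (Suc ` {q \<in> {1..n}. \<not> occupied n f c q \<and> occupied n f c (Suc q)})"
    by (simp only:) (rule card_Un_disjoint; auto)
  also have "card {q \<in> {1}. occupied n f c q} = of_bool (occupied n f c 1)"
  proof -
    have "{q \<in> {1}. occupied n f c q} = (if occupied n f c 1 then {1} else {})" by auto
    then show ?thesis by simp
  qed
  finally show ?thesis by (simp add: card_image)
qed

text \<open>The boxes on diagonals \<open>q - 1\<close> and \<open>q\<close> are vertically adjacent iff \<open>q - 1 \<in> f c\<close>.\<close>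

lemma occupied_between:
  assumes "q' \<in> used" "q \<in> used" "q' < q"
    and "tail_card n f c q' = tail_card n f c q \<or>
      tail_card n f c q' + q' = tail_card n f c q + q"
  shows "2 \<le> q \<and> occupied n f c (q - 1) \<and>
    (q - 1 \<in> f c \<longleftrightarrow> tail_card n f c q' \<noteq> tail_card n f c q)"
proof -
  let ?N = "tail_card n f"
  have q: "1 \<le> q'" "q \<le> n" "occupied n f c q" "occupied n f c q'" "q' \<le> q - 1" "q - 1 \<le> q" "1 \<le> q - 1"
    "Suc (q - 1) = q"
    using assms(1-3) by (auto simp: used_def)
  have h: "?N c q = ?N (c - 1) q + 1" "?N c q' = ?N (c - 1) q' + 1"
    "?N c (q - 1) = ?N (c - 1) (q - 1) + of_bool (occupied n f c (q - 1))"
    using occupied_tail_card[OF f c, of q] occupied_tail_card[OF f c, of q'] occupied_tail_card[OF f c, of "q - 1"] q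
      assms(3) by auto
  have s: "?N c (q - 1) = of_bool (q - 1 \<in> f c) + ?N c q"
    using tail_card_step[of "q - 1" n f c] q by simp
  have a: "?N e (q - 1) \<le> ?N e q'" "?N e q \<le> ?N e (q - 1)" for e
    using tail_card_antimono q by blast+
  have l: "?N e q' \<le> ?N e (q - 1) + (q - 1 - q')" "?N e (q - 1) \<le> ?N e q + 1" for e
    using tail_card_lipschitz[of q' "q - 1" n f e] tail_card_lipschitz[of "q - 1" q n f e] q by auto
  from assms(4) show ?thesis
  proof
    \<comment> \<open>Same row: \<open>?N c\<close> and \<open>?N (c - 1)\<close> are antitone in
      the diagonal and each has equal values at both ends, so both are constant in between.\<close>
    assume *: "?N c q' = ?N c q"
    then have "?N c (q - 1) = ?N c q" using a[of c] by linarith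
    moreover have "?N (c - 1) (q - 1) = ?N (c - 1) q" using * h(1,2) a[of "c - 1"] by linarith
    ultimately have "of_bool (occupied n f c (q - 1)) = (1 :: nat)" "of_bool (q - 1 \<in> f c) = (0 :: nat)"
      using h s by linarith+
    then show ?thesis using * q(7) unfolding of_bool_eq_1_iff of_bool_eq_0_iff by auto
  next
    \<comment> \<open>Same column: both counts drop at the maximal rate, one per diagonal, over the
      whole interval.\<close>
    assume *: "?N c q' + q' = ?N c q + q"
    then have "?N c (q - 1) = ?N c q + 1" using l[of c] q(5,7,8) by linarith
    moreover have "?N (c - 1) (q - 1) = ?N (c - 1) q + 1"
      using * h(1,2) l[of "c - 1"] q(5,7,8) by linarith
    ultimately have "of_bool (occupied n f c (q - 1)) = (1 :: nat)" "of_bool (q - 1 \<in> f c) = (1 :: nat)"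
      using h s by linarith+
    moreover have "?N c q' \<noteq> ?N c q" using * assms(3) by linarith
    ultimately show ?thesis using q(7) unfolding of_bool_eq_1_iff by auto
  qed
qed

text \<open>What remains are the run starts and the boxes whose predecessor lies in the other
  direction. When both horizontal edges at a vertex are occupied, its vertical edges agree, so
  \<open>f c\<close> may be exchanged for \<open>f (c - 1)\<close>.\<close>

lemma card_nonleaders:
  "card {q \<in> used. \<not> (2 \<le> q \<and> occupied n f c (q - 1) \<and> (q - 1 \<in> f c \<longleftrightarrow> b))} =
    card ends + card {q \<in> {1..n}. occupied n f c q \<and> occupied n f c (Suc q) \<and> (q \<in> f (c - 1) \<longleftrightarrow> \<not> b)}"
proof -
  have no: "\<not> occupied n f c (Suc n)" by (simp add: occupied_def flow_empty)
  let ?J = "{q \<in> {1..n}. occupied n f c q \<and> occupied n f c (Suc q) \<and> (q \<in> f (c - 1) \<longleftrightarrow> \<not> b)}"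
  have mem: "q \<in> f (c - 1) \<longleftrightarrow> q \<in> f c" if "q \<in> {1..n}" "occupied n f c q" "occupied n f c (Suc q)" for q
    using states_step[OF f c that(1)] that by (auto simp: of_bool_def split: if_splits)
  have "{q \<in> used. \<not> (2 \<le> q \<and> occupied n f c (q - 1) \<and> (q - 1 \<in> f c \<longleftrightarrow> b))} = ends \<union> Suc ` ?J"
  proof
    show "{q \<in> used. \<not> (2 \<le> q \<and> occupied n f c (q - 1) \<and> (q - 1 \<in> f c \<longleftrightarrow> b))} \<subseteq> ends \<union> Suc ` ?J"
    proof
      fix q assume q: "q \<in> {q \<in> used. \<not> (2 \<le> q \<and> occupied n f c (q - 1) \<and> (q - 1 \<in> f c \<longleftrightarrow> b))}"
      show "q \<in> ends \<union> Suc ` ?J"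
      proof (cases "q \<in> ends")
        case False
        then have q2: "2 \<le> q" "occupied n f c (q - 1)" "occupied n f c (Suc (q - 1))" "q - 1 \<in> {1..n}"
          using q by (auto simp: ends_def used_def)
        then have "q - 1 \<in> ?J" using q mem[of "q - 1"] by auto
        then show ?thesis using q2 by (intro UnI2 image_eqI[of _ _ "q - 1"]) auto
      qed simp
    qed
    show "ends \<union> Suc ` ?J \<subseteq> {q \<in> used. \<not> (2 \<le> q \<and> occupied n f c (q - 1) \<and> (q - 1 \<in> f c \<longleftrightarrow> b))}"
    proof
      fix q assume "q \<in> ends \<union> Suc ` ?J"
      then show "q \<in> {q \<in> used. \<not> (2 \<le> q \<and> occupied n f c (q - 1) \<and> (q - 1 \<in> f c \<longleftrightarrow> b))}"
      proof
        assume "q \<in> Suc ` ?J"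
        then obtain p where p: "q = Suc p" "p \<in> ?J" by auto
        then have "p < n" using no by (cases "p = n") auto
        then show ?thesis using p mem[of p] by (auto simp: used_def)
      qed (auto simp: ends_def)
    qed
  qed
  moreover have "card (ends \<union> Suc ` ?J) = card ends + card (Suc ` ?J)"
  proof (rule card_Un_disjoint)
    show "finite ends" unfolding ends_def used_def by simp
    show "ends \<inter> Suc ` ?J = {}" unfolding ends_def by auto
  qed simp
  ultimately show ?thesis by (simp add: card_image)
qed

lemma previous_used: "q \<in> used \<Longrightarrow> 2 \<le> q \<and> occupied n f c (q - 1) \<Longrightarrow> q - 1 \<in> used \<and> q - 1 < q"
  by (auto simp: used_def)

text \<open>A box opens a new row unless its predecessor is its left neighbour, so the rows exceed
  the components by the number of vertical adjacencies.\<close>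

lemma card_rows: "card (fst ` letter_boxes) =
    card ends + card {q \<in> {1..n}. occupied n f c q \<and> occupied n f c (Suc q) \<and> q \<in> f (c - 1)}"
proof -
  have "card (fst ` letter_boxes) = card (tail_card n f c ` used)"
    unfolding letter_boxes_eq image_image by (simp add: box_at_def)
  also have "\<dots> = card {q \<in> used. \<not> (2 \<le> q \<and> occupied n f c (q - 1) \<and> (q - 1 \<in> f c \<longleftrightarrow> False))}"
  proof (rule card_image_leaders)
    fix q q' assume "q' \<in> used" "q \<in> used" "q' < q" "tail_card n f c q' = tail_card n f c q"
    then show "2 \<le> q \<and> occupied n f c (q - 1) \<and> (q - 1 \<in> f c \<longleftrightarrow> False)"
      using occupied_between[of q' q] by blast
  next
    fix q assume q: "q \<in> used" "2 \<le> q \<and> occupied n f c (q - 1) \<and> (q - 1 \<in> f c \<longleftrightarrow> False)"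
    then have "tail_card n f c (q - 1) = tail_card n f c q"
      using tail_card_step[of "q - 1" n f c] by (auto simp: used_def)
    then show "\<exists>q'\<in>used. q' < q \<and> tail_card n f c q' = tail_card n f c q"
      using previous_used[of q] q by blast
  qed
  finally show ?thesis using card_nonleaders[of False] by simp
qed

text \<open>Here a box opens a new column unless its predecessor is the box below it, and the excess
  counts horizontal adjacencies.\<close>

lemma card_columns: "card (snd ` letter_boxes) =
    card ends + card {q \<in> {1..n}. occupied n f c q \<and> occupied n f c (Suc q) \<and> q \<notin> f (c - 1)}"
proof -
  have "card (snd ` letter_boxes) = card ((\<lambda>q. tail_card n f c q + q - 1) ` used)"
    unfolding letter_boxes_eq image_image by (simp add: box_at_def)
  also have "\<dots> = card {q \<in> used. \<not> (2 \<le> q \<and> occupied n f c (q - 1) \<and> (q - 1 \<in> f c \<longleftrightarrow> True))}"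
  proof (rule card_image_leaders)
    fix q q' assume q: "q' \<in> used" "q \<in> used" "q' < q"
      "tail_card n f c q' + q' - 1 = tail_card n f c q + q - 1"
    then have "tail_card n f c q' + q' = tail_card n f c q + q"
      using tail_card_used(1)[of q] tail_card_used(1)[of q'] by auto
    then show "2 \<le> q \<and> occupied n f c (q - 1) \<and> (q - 1 \<in> f c \<longleftrightarrow> True)"
      using occupied_between[of q' q] q by auto
  next
    fix q assume q: "q \<in> used" "2 \<le> q \<and> occupied n f c (q - 1) \<and> (q - 1 \<in> f c \<longleftrightarrow> True)"
    then have "tail_card n f c (q - 1) + (q - 1) - 1 = tail_card n f c q + q - 1"
      using tail_card_step[of "q - 1" n f c] by (auto simp: used_def)
    then show "\<exists>q'\<in>used. q' < q \<and> tail_card n f c q' + q' - 1 = tail_card n f c q + q - 1"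
      using previous_used[of q] q by blast
  qed
  finally show ?thesis using card_nonleaders[of True] by simp
qed

end

text \<open>\<open>var\<close> counts vertical adjacencies of unbarred and horizontal adjacencies of
  barred letters, which are the positions selected by the parity in \<open>joined\<close>.\<close>

lemma ST_wt:
  assumes "f \<in> states n" "1 \<le> n"
  defines "\<eta> \<equiv> st_of n f"
  shows "t_var ^ nat (var n \<eta> + int (bar_ST n \<eta>)) * (1 + t_var) ^ (str n \<eta> - n) * xwgt_ST n \<eta> =
    state_wt n f"
proof -
  define R where "R c = card {q\<in>{1..n}. occupied n f c q}" for c
  define J where "J c = card {q\<in>{1..n}. joined n f c q}" for c
  define E where "E c = card {q\<in>{1..n}. \<not> occupied n f c q \<and> occupied n f c (Suc q)}" for c
  have fin: "finite {1..2*n}" "finite {1..n}" by auto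
  have m: "m_ST n \<eta> (Unbar k) = R (2*k)" "m_ST n \<eta> (Bar k) = R (2*k-1)" if "k \<in> {1..n}" for k
  proof -
    have "1 \<le> k" "1 \<le> 2*k" "2*k \<le> 2*n" "1 \<le> 2*k-1" "2*k-1 \<le> 2*n" using that by auto
    then show "m_ST n \<eta> (Unbar k) = R (2*k)" "m_ST n \<eta> (Bar k) = R (2*k-1)"
      using card_letter_boxes[OF assms(1), of "2*k"] card_letter_boxes[OF assms(1), of "2*k-1"]
      by (simp_all only: letter_of_simps \<eta>_def R_def used_def[OF assms(1)])
  qed
  have bar: "bar_ST n \<eta> = card {(c, q) \<in> {1..2*n} \<times> {1..n}. odd c \<and> occupied n f c q}"
    unfolding card_pairs[OF fin] sum_pairs bar_ST_def
    by (intro sum.cong refl) (simp add: m R_def)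
  have row: "int (row n \<eta> k) - int (con n \<eta> (Unbar k)) = int (J (2*k))" if "k \<in> {1..n}" for k
  proof -
    have k: "1 \<le> 2*k" "2*k \<le> 2*n" using that by auto
    have "{i. \<exists>j. (i, j) \<in> boxes n \<eta> (Unbar k)} = fst ` boxes n \<eta> (Unbar k)" by force
    then have "row n \<eta> k = card (fst ` boxes n \<eta> (Unbar k))" by (simp add: row_def)
    then show ?thesis
      using card_rows[OF assms(1) k] con_eq[OF assms(1) k]
      unfolding letter_boxes_def[OF assms(1) k] letter_of_simps \<eta>_def[symmetric]
      by (simp add: J_def joined_def)
  qed
  have col: "int (col n \<eta> k) - int (con n \<eta> (Bar k)) = int (J (2*k-1))" if "k \<in> {1..n}" for k
  proof -
    have k: "1 \<le> 2*k-1" "2*k-1 \<le> 2*n" "1 \<le> k" using that by auto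
    have "odd (2*k-1)" using k by auto
    have "{j. \<exists>i. (i, j) \<in> boxes n \<eta> (Bar k)} = snd ` boxes n \<eta> (Bar k)" by force
    then have "col n \<eta> k = card (snd ` boxes n \<eta> (Bar k))" by (simp add: col_def)
    then show ?thesis
      using card_columns[OF assms(1) k(1,2)] con_eq[OF assms(1) k(1,2)] \<open>odd (2*k-1)\<close>
      unfolding letter_boxes_def[OF assms(1) k(1,2)] letter_of_simps(2)[OF k(3)] \<eta>_def[symmetric]
      by (simp add: J_def joined_def)
  qed
  have var: "var n \<eta> = int (card {(c, q) \<in> {1..2*n} \<times> {1..n}. joined n f c q})"
  proof -
    have "var n \<eta> = (\<Sum>k\<in>{1..n}. int (J (2*k-1) + J (2*k)))"
      unfolding var_def
    proof (rule sum.cong[OF refl])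
      fix k assume k: "k \<in> {1..n}"
      show "int (row n \<eta> k) - int (con n \<eta> (Unbar k)) + int (col n \<eta> k) - int (con n \<eta> (Bar k)) =
          int (J (2*k-1) + J (2*k))"
        using row[OF k] col[OF k] by linarith
    qed
    then show ?thesis
      unfolding card_pairs[OF fin] sum_pairs J_def by simp
  qed
  have str: "str n \<eta> = n + card {(c, q) \<in> {1..2*n} \<times> {1..n}. \<not> occupied n f c q \<and> occupied n f c (Suc q)}"
  proof -
    \<comment> \<open>The runs starting on the main diagonal are the occupied left boundary edges of
      all rows. Their number telescopes to the size \<open>n\<close> of the top state, which is the
      \<open>n\<close> subtracted from \<open>str\<close>.\<close>
    have tel: "(\<Sum>c\<in>{1..m}. flow 0 n (f c) (f (c - 1)) 1) = flow 0 n (f m) (f 0) 1" for m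
      by (induction m) (simp_all add: flow_def)
    have "int (\<Sum>c\<in>{1..2*n}. of_bool (occupied n f c 1)) = (\<Sum>c\<in>{1..2*n}. flow 0 n (f c) (f (c - 1)) 1)"
      unfolding of_nat_sum using statesD(6)[OF assms(1), of _ 1] by (intro sum.cong refl) simp
    also have "\<dots> = int n"
      unfolding tel using statesD(1,4)[OF assms(1)] by (simp add: flow_def)
    finally have ones: "(\<Sum>c\<in>{1..2*n}. of_bool (occupied n f c 1)) = n" by linarith
    have "inj_on letter_of {1..2*n}" by (rule inj_onI) (simp add: letter_of_inject)
    then have "str n \<eta> = (\<Sum>c\<in>{1..2*n}. con n \<eta> (letter_of c))"
      unfolding str_def alphabet_eq by (simp add: sum.reindex comp_def)
    also have "\<dots> = (\<Sum>c\<in>{1..2*n}. of_bool (occupied n f c 1) + E c)"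
      unfolding \<eta>_def E_def
      by (intro sum.cong refl) (simp add: con_eq[OF assms(1)] card_ends[OF assms(1) _ _ assms(2)])
    also have "\<dots> = n + (\<Sum>c\<in>{1..2*n}. E c)"
      using ones by (simp only: sum.distrib)
    finally show ?thesis unfolding card_pairs[OF fin] E_def .
  qed
  have x: "xwgt_ST n \<eta> = (\<Prod>k\<in>{1..n}. x_pow k (int (R (2*k)) - int (R (2*k-1))))"
    unfolding xwgt_ST_def by (intro prod.cong refl) (simp add: m)
  show ?thesis
    unfolding state_wt_def x bar var str R_def by (simp flip: of_nat_add)
qed

lemma sum_ST:
  assumes "1 \<le> n"
  shows "(\<Sum>\<eta>\<in>ST n. t_var ^ nat (var n \<eta> + int (bar_ST n \<eta>)) * (1 + t_var) ^ (str n \<eta> - n) * xwgt_ST n \<eta>) =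
    (\<Sum>f\<in>states n. state_wt n f)"
proof (rule sum.reindex_bij_witness[of _ "st_of n" "state_of_st n"])
  fix \<eta> assume \<eta>: "\<eta> \<in> ST n"
  show "st_of n (state_of_st n \<eta>) = \<eta>" by (rule st_of_state_of_st[OF \<eta>])
  show "state_of_st n \<eta> \<in> states n" by (rule state_of_st_in_states[OF \<eta>])
  show "state_wt n (state_of_st n \<eta>) =
      t_var ^ nat (var n \<eta> + int (bar_ST n \<eta>)) * (1 + t_var) ^ (str n \<eta> - n) * xwgt_ST n \<eta>"
    using ST_wt[OF state_of_st_in_states[OF \<eta>] assms] unfolding st_of_state_of_st[OF \<eta>] by simp
qed (simp_all add: state_of_st_of st_of_in_ST)

theorem theorem6p7:
  fixes n :: nat
  assumes "n \<ge> 1"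
  shows "D_sp n =
      (\<Sum>\<eta>\<in>ST n. t_var ^ nat (var n \<eta> + int (bar_ST n \<eta>)) * (1 + t_var) ^ (str n \<eta> - n) * xwgt_ST n \<eta>)
    \<and> D_sp n =
      (\<Sum>a\<in>UA n. t_var ^ (ssi n a + bar_UA n a) * (1 + t_var) ^ neg n a * xwgt_UA n a)
    \<and> D_sp n =
      (\<Sum>C\<in>CM n. t_var ^ (ne_odd n C + se_even n C + wgt_even n C) * (1 + t_var) ^ ns n C * xwgt_CM n C)"
  unfolding sum_ST[OF assms] sum_UA sum_CM by (simp add: D_sp_states)

end
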